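(* Let $q\ge1$ be an integer, let $\alpha_0$ be the uniform distribution on the sphere $S^q\subset\mathbb{R}^{q+1}$, and for $h\in\mathbb{R}^{q+1}$ let $\alpha_h(d\sigma)=e^{h\cdot\sigma}\alpha_0(d\sigma)/\alpha_0(e^{h\cdot\sigma})$. Let $c,\theta>0$ be such that $K(\sigma,\sigma')=e^{\Phi(\sigma,\sigma')}=c+\theta\,\sigma\cdot\sigma'$ is strictly positive on $S^q\times S^q$, and let the weights have limiting variable $W$ with law $P$ as described in the context. Let $e_1$ be the first unit vector. Then: (a) Every solution $V$ of the mean-field fixed point equation with a priori measure $\alpha_h$ has the form $V(\sigma)=c+m\cdot\sigma$, where $m\in\mathbb{R}^{q+1}$ satisfies $$\frac m\theta=\mathbb{E}^{sb}\left[\frac{\alpha_h(e^{Wm\cdot\sigma}\,\sigma)}{\alpha_h(e^{Wm\cdot\sigma})}\right].\qquad( * )$$ (b) If $h=0$, every rotation of a solution of $( * )$ is also a solution, so without loss of generality $m=|m|e_1$, and $( * )$ becomes $$\frac{|m|}{\theta}e_1=\mathbb{E}^{sb}\left[\frac{\alpha_0(e^{W|m|e_1\cdot\sigma}\,\sigma)}{\alpha_0(e^{W|m|e_1\cdot\sigma})}\right].$$ (c) If $h\ne0$, assume without loss of generality that $h=|h|e_1$. Then the annealed pressure is $$\psi(\Phi,P,\alpha_h)=\frac{c\,\mathbb{E}[W]}{2}+\sup_{|m|}\Bigl(-\frac{\mathbb{E}[W]}{2}\frac{|m|^2}{\theta}+\mathbb{E}\bigl[\log\alpha_h(e^{W|m|e_1\cdot\sigma})\bigr]\Bigr),$$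 where the supremum is over solutions $|m|\ge 0$ of $$\frac{|m|}{\theta}e_1=\mathbb{E}^{sb}\left[\frac{\alpha_h(e^{W|m|e_1\cdot\sigma}\,\sigma)}{\alpha_h(e^{W|m|e_1\cdot\sigma})}\right].$$ (d) Under $\alpha_0$, the variable $t=e_1\cdot\sigma\in[-1,1]$ has density proportional to $(1-t)^{q/2-1}(1+t)^{q/2-1}$. Hence this model on $S^q$ behaves the same as the model with spins in $[-1,1]$ with kernel $c+\theta\sigma\sigma'$ whose even a priori measure is the Beta$(b,b)$ distribution with $b=q/2$, stretched affinely to $[-1,1]$ (and tilted by $e^{|h|\sigma}$ in the presence of a field).
   Context: Annealed spin model: weights $w_i>0$ are such that $W_N=w_{V_N}$ ($V_N$ uniform on $[N]=\{1,\dots,N\}$) converges in distribution to a variable $W$ with law $P$, and $\frac1N\sum_{i\le N}w_i^2\to\mathbb{E}[W^2]<\infty$. The generalized random graph on $[N]$ has independent edges between $i\neq j$ with probability $\frac{w_iw_j}{l_N+w_iw_j}$, $l_N=\sum_{i\le N}w_i$; $Q_N^w$ is its law and $E_N$ its edge set. The annealed pressure for interaction $\Phi$ and a priori measure $\alpha$ is $\psi(\Phi,P,\alpha)=\lim_{N\to\infty}\frac1N\log Q_N^w\alpha^{N}\bigl(e^{\sum_{(i,j)\in E_N}\Phi(\sigma_i,\sigma_j)}\bigr)$, where $\alpha^N$ is the $N$-fold product of $\alpha$. $\mu(f)=\int f\,d\mu$; $\mathbb{E}^{sb}[f(W)]=\mathbb{E}[Wf(W)]/\mathbb{E}[W]$.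 The mean-field fixed point equation with a priori measure $\alpha$ for continuous $V:S^q\to\mathbb{R}$ is $$V(\sigma)=\mathbb{E}^{sb}\left[\frac{\int\alpha(d\tilde\sigma)\,e^{\Phi(\sigma,\tilde\sigma)}e^{WV(\tilde\sigma)}}{\int\alpha(d\tilde\sigma)\,e^{WV(\tilde\sigma)}}\right].$$
   Formalization: In (c) the pressure is c E[W]/2 − E[W]/2 + sup(...), not c E[W]/2 + sup(...): with the pressure as defined, the printed constant is wrong (e.g. W=1, c=1, 0<θ<1 gives ψ≤θ/2<1/2). E[W]>0 is assumed so that the size-biased expectation is defined. *)

theory Defs
  imports "HOL-Probability.Probability"
begin

section \<open>Spin measures\<close>

text \<open>
  The uniform distribution on the unit sphere is the normalised cone measure: the radial
  projection of the uniform distribution on the unit ball (\<^term>\<open>sgn x\<close> is \<open>x / |x|\<close>).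
  The measure space is the sphere itself, so functions only matter on the sphere.
  Lemmas \<open>prob_space_uniform_sphere\<close> and \<open>uniform_sphere_rotation\<close> below confirm that
  it is a rotation invariant probability measure.
\<close>

definition uniform_sphere :: "'a::euclidean_space measure" where
  "uniform_sphere = restrict_space (distr (uniform_measure lborel (ball 0 1)) borel sgn) (sphere 0 1)"

definition field_tilt :: "'a::euclidean_space \<Rightarrow> 'a measure \<Rightarrow> 'a measure" where
  "field_tilt h \<alpha> = density \<alpha> (\<lambda>\<sigma>. ennreal (exp (h \<bullet> \<sigma>) / (\<integral>\<tau>. exp (h \<bullet> \<tau>) \<partial>\<alpha>)))"

abbreviation sphere_measure :: "'a::euclidean_space \<Rightarrow> 'a measure" where
  "sphere_measure h \<equiv> field_tilt h uniform_sphere"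

definition beta_measure :: "real \<Rightarrow> real \<Rightarrow> real measure" where
  "beta_measure a b = density lborel
     (\<lambda>x. ennreal (x powr (a - 1) * (1 - x) powr (b - 1) / Beta a b * indicator {0..1} x))"

definition stretched_beta :: "real \<Rightarrow> real measure" where
  "stretched_beta b = restrict_space (distr (beta_measure b b) borel (\<lambda>x. 2 * x - 1)) {-1..1}"

abbreviation tilted_stretched_beta :: "real \<Rightarrow> real \<Rightarrow> real measure" where
  "tilted_stretched_beta b h \<equiv> field_tilt h (stretched_beta b)"

text \<open>
  The interaction \<open>\<Phi>\<close> with \<open>exp (\<Phi> \<sigma> \<tau>) = c + \<theta> * (\<sigma> \<bullet> \<tau>)\<close> wherever the right-hand side is positive.
  On the type of reals the inner product is multiplication, so that all notions stated through
  inner products also apply to spins in the interval from -1 to 1.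
\<close>

definition inner_interaction :: "real \<Rightarrow> real \<Rightarrow> 'a::real_inner \<Rightarrow> 'a \<Rightarrow> real" where
  "inner_interaction c \<theta> \<sigma> \<tau> = ln (c + \<theta> * (\<sigma> \<bullet> \<tau>))"


section \<open>The annealed model on the generalized random graph\<close>

text \<open>
  \<open>w N i\<close> is the weight of vertex \<open>i\<close> in the graph on \<open>{1..N}\<close>; a single weight sequence is the
  special case in which \<open>w N i\<close> does not depend on \<open>N\<close>. The limiting variable \<open>W\<close> is represented
  by its law \<open>P\<close>.
\<close>

definition weights_converge :: "(nat \<Rightarrow> nat \<Rightarrow> real) \<Rightarrow> real measure \<Rightarrow> bool" where
  "weights_converge w P \<longleftrightarrow>
     (\<forall>N. \<forall>i\<in>{1..N}. 0 < w N i) \<and>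
     weak_conv_m (\<lambda>N. distr (measure_pmf (pmf_of_set {1..N})) borel (w N)) P \<and>
     integrable P (\<lambda>x. x\<^sup>2) \<and>
     (\<lambda>N. (\<Sum>i=1..N. (w N i)\<^sup>2) / real N) \<longlonglongrightarrow> (\<integral>x. x\<^sup>2 \<partial>P)"

definition edge_prob :: "(nat \<Rightarrow> nat \<Rightarrow> real) \<Rightarrow> nat \<Rightarrow> nat \<Rightarrow> nat \<Rightarrow> real" where
  "edge_prob w N i j = w N i * w N j / ((\<Sum>k=1..N. w N k) + w N i * w N j)"

definition vertex_pairs :: "nat \<Rightarrow> (nat \<times> nat) set" where
  "vertex_pairs N = {(i, j). 1 \<le> i \<and> i < j \<and> j \<le> N}"

text \<open>The law of the edge set; each undirected edge is the pair of its ends in increasing order.\<close>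

definition grg_law :: "(nat \<Rightarrow> nat \<Rightarrow> real) \<Rightarrow> nat \<Rightarrow> (nat \<times> nat) set pmf" where
  "grg_law w N = map_pmf (\<lambda>\<omega>. {e \<in> vertex_pairs N. \<omega> e})
     (Pi_pmf (vertex_pairs N) False (\<lambda>(i, j). bernoulli_pmf (edge_prob w N i j)))"

text \<open>
  The annealed pressure \<open>\<psi>(\<Phi>, P, \<alpha>)\<close> is the limit of \<open>finite_pressure \<Phi> w \<alpha> N\<close> as \<open>N\<close> tends
  to infinity. Averaging over the edges turns the integrand into the product over \<open>i < j\<close> of
  \<open>1 + p i j * (exp (\<Phi> (\<sigma> i) (\<sigma> j)) - 1)\<close>; the \<open>-1\<close> contributes \<open>-E[W]/2\<close> to the limit.
\<close>

definition finite_pressure ::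
    "('a \<Rightarrow> 'a \<Rightarrow> real) \<Rightarrow> (nat \<Rightarrow> nat \<Rightarrow> real) \<Rightarrow> 'a measure \<Rightarrow> nat \<Rightarrow> real" where
  "finite_pressure \<Phi> w \<alpha> N = 1 / real N * ln
     (\<integral>E. (\<integral>\<sigma>. exp (\<Sum>(i, j)\<in>E. \<Phi> (\<sigma> i) (\<sigma> j)) \<partial>PiM {1..N} (\<lambda>_. \<alpha>)) \<partial>measure_pmf (grg_law w N))"


section \<open>Mean-field equations\<close>

definition sb_expectation ::
    "real measure \<Rightarrow> (real \<Rightarrow> 'b::{banach, second_countable_topology}) \<Rightarrow> 'b" where
  "sb_expectation P f = (\<integral>x. x *\<^sub>R f x \<partial>P) /\<^sub>R (\<integral>x. x \<partial>P)"

definition mean_field_solution ::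
    "('a::topological_space \<Rightarrow> 'a \<Rightarrow> real) \<Rightarrow> real measure \<Rightarrow> 'a measure \<Rightarrow> ('a \<Rightarrow> real) \<Rightarrow> bool" where
  "mean_field_solution \<Phi> P \<alpha> V \<longleftrightarrow>
     continuous_on (space \<alpha>) V \<and>
     (\<forall>\<sigma>\<in>space \<alpha>. V \<sigma> = sb_expectation P (\<lambda>x.
        (\<integral>\<tau>. exp (\<Phi> \<sigma> \<tau>) * exp (x * V \<tau>) \<partial>\<alpha>) / (\<integral>\<tau>. exp (x * V \<tau>) \<partial>\<alpha>)))"

definition magnetization_solution ::
    "real \<Rightarrow> real measure \<Rightarrow> 'a::euclidean_space measure \<Rightarrow> 'a \<Rightarrow> bool" where
  "magnetization_solution \<theta> P \<alpha> m \<longleftrightarrow>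
     m /\<^sub>R \<theta> = sb_expectation P (\<lambda>x.
       (\<integral>\<sigma>. exp (x * (m \<bullet> \<sigma>)) *\<^sub>R \<sigma> \<partial>\<alpha>) /\<^sub>R (\<integral>\<sigma>. exp (x * (m \<bullet> \<sigma>)) \<partial>\<alpha>))"

text \<open>The same equation along a fixed unit vector \<open>e\<close>, for the scalar \<open>r\<close>.\<close>

definition axial_solution ::
    "real \<Rightarrow> real measure \<Rightarrow> 'a::euclidean_space measure \<Rightarrow> 'a \<Rightarrow> real \<Rightarrow> bool" where
  "axial_solution \<theta> P \<alpha> e r \<longleftrightarrow>
     (r / \<theta>) *\<^sub>R e = sb_expectation P (\<lambda>x.
       (\<integral>\<sigma>. exp (x * r * (e \<bullet> \<sigma>)) *\<^sub>R \<sigma> \<partial>\<alpha>) /\<^sub>R (\<integral>\<sigma>. exp (x * r * (e \<bullet> \<sigma>)) \<partial>\<alpha>))"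

definition pressure_functional ::
    "real \<Rightarrow> real measure \<Rightarrow> 'a::euclidean_space measure \<Rightarrow> 'a \<Rightarrow> real \<Rightarrow> real" where
  "pressure_functional \<theta> P \<alpha> e r =
     - ((\<integral>x. x \<partial>P) / 2) * (r\<^sup>2 / \<theta>) + (\<integral>x. ln (\<integral>\<sigma>. exp (x * r * (e \<bullet> \<sigma>)) \<partial>\<alpha>) \<partial>P)"


section \<open>Basic properties of the uniform distribution on the sphere\<close>

lemma space_uniform_sphere [simp]: "space uniform_sphere = sphere 0 1"
  by (simp add: uniform_sphere_def space_restrict_space)

lemma sets_uniform_sphere: "sets uniform_sphere = sets (restrict_space borel (sphere 0 1))"
  unfolding uniform_sphere_def by (rule sets_restrict_space_cong) simp

lemma space_stretched_beta [simp]: "space (stretched_beta b) = {-1..1}"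
  by (simp add: stretched_beta_def space_restrict_space)

lemma space_field_tilt [simp]: "space (field_tilt h \<alpha>) = space \<alpha>"
  by (simp add: field_tilt_def)

lemma prob_uniform_ball: "prob_space (uniform_measure lborel (ball (0::'a::euclidean_space) 1))"
proof (rule prob_space_uniform_measure)
  have "measure lborel (ball (0::'a) 1) > 0"
    by (simp add: content_ball_pos)
  then show "emeasure lborel (ball (0::'a) 1) \<noteq> 0"
    by (metis measure_eq_0_null_sets measure_def enn2real_0 less_irrefl)
  show "emeasure lborel (ball (0::'a) 1) \<noteq> \<infinity>"
    using emeasure_lborel_ball_finite less_top by force
qed

lemma sgn_measurable [measurable]:
  "(sgn :: 'a::euclidean_space \<Rightarrow> 'a) \<in> borel_measurable borel"
proof -
  have "(\<lambda>x::'a. x /\<^sub>R norm x) \<in> borel_measurable borel" by measurable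
  then show ?thesis by (simp add: sgn_div_norm[abs_def])
qed

lemma prob_space_uniform_sphere: "prob_space (uniform_sphere :: 'a::euclidean_space measure)"
proof -
  let ?U = "uniform_measure lborel (ball (0::'a) 1)"
  interpret U: prob_space ?U by (rule prob_uniform_ball)
  let ?D = "distr ?U borel sgn"
  interpret D: prob_space ?D by (rule U.prob_space_distr) simp
  have "AE x in lborel. x \<noteq> (0::'a)" by (rule AE_lborel_singleton)
  then have "AE x in ?U. x \<noteq> 0"
    by (intro AE_uniform_measureI) auto
  then have "AE x in ?U. sgn x \<in> sphere 0 1"
    by eventually_elim (simp add: norm_sgn)
  then have "AE x in ?D. x \<in> sphere 0 1"
    by (subst AE_distr_iff) auto
  then have "emeasure ?D (sphere 0 1) = 1"
    by (intro D.emeasure_eq_1_AE) auto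
  then show ?thesis
    unfolding uniform_sphere_def by (intro prob_spaceI) (simp add: space_restrict_space emeasure_restrict_space)
qed

lemma lborel_distr_orthogonal:
  fixes f :: "real ^ 'n::{finite,wellorder} \<Rightarrow> real ^ 'n::{finite,wellorder}"
  assumes f: "orthogonal_transformation f"
  shows "distr lborel borel f = lborel"
proof (rule lborel_eqI[symmetric])
  have lin: "linear f" using f by (simp add: orthogonal_transformation_linear)
  then have meas: "f \<in> borel_measurable borel"
    by (intro borel_measurable_continuous_onI linear_continuous_on linear_conv_bounded_linear[THEN iffD1])
  have bij: "bij f" using f by (rule orthogonal_transformation_bij)
  have inv: "orthogonal_transformation (inv f)" using f by (rule orthogonal_transformation_inv)
  fix l u :: "real ^ 'n::{finite,wellorder}"
  assume lu: "\<And>b. b \<in> Basis \<Longrightarrow> l \<bullet> b \<le> u \<bullet> b"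
  have box: "box l u \<in> lmeasurable" by (rule lmeasurable_box)
  have eq: "f -` box l u = inv f ` box l u" using bij by (simp add: bij_vimage_eq_inv_image)
  have bs: "f -` box l u \<in> sets borel" using measurable_sets[OF meas, of "box l u"] by simp
  have m1: "f -` box l u \<in> lmeasurable"
    unfolding eq by (rule measurable_orthogonal_image[OF inv box])
  have m2: "measure lebesgue (f -` box l u) = measure lebesgue (box l u)"
    unfolding eq by (rule measure_orthogonal_image[OF inv box])
  have "emeasure (distr lborel borel f) (box l u) = emeasure lborel (f -` box l u)"
    using meas by (simp add: emeasure_distr)
  also have "\<dots> = emeasure lebesgue (f -` box l u)"
    using bs by simp
  also have "\<dots> = emeasure lebesgue (box l u)"
    using m1 m2 box by (simp add: emeasure_eq_measure2)
  also have "\<dots> = (\<Prod>b\<in>Basis. (u - l) \<bullet> b)"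
    using lu by (simp add: emeasure_lborel_box)
  finally show "emeasure (distr lborel borel f) (box l u) = (\<Prod>b\<in>Basis. (u - l) \<bullet> b)" .
qed simp

lemma uniform_sphere_rotation:
  fixes f :: "real ^ 'n::{finite,wellorder} \<Rightarrow> real ^ 'n::{finite,wellorder}"
  assumes f: "orthogonal_transformation f"
  shows "distr uniform_sphere uniform_sphere f = uniform_sphere"
proof (rule measure_eqI)
  show "sets (distr uniform_sphere uniform_sphere f) = sets (uniform_sphere :: (real ^ 'n::{finite,wellorder}) measure)" by simp
  fix A assume "A \<in> sets (distr uniform_sphere (uniform_sphere :: (real ^ 'n::{finite,wellorder}) measure) f)"
  then have A: "A \<in> sets borel" "A \<subseteq> sphere 0 1"
    by (auto simp: sets_uniform_sphere sets_restrict_space)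
  have lin: "linear f" using f by (simp add: orthogonal_transformation_linear)
  then have meas: "f \<in> borel_measurable borel"
    by (intro borel_measurable_continuous_onI linear_continuous_on linear_conv_bounded_linear[THEN iffD1])
  have nf: "norm (f x) = norm x" for x using f by (rule orthogonal_transformation_norm)
  have sg: "sgn (f x) = f (sgn x)" for x
    using f by (simp add: sgn_div_norm nf orthogonal_transformation_scaleR)
  have measS: "f \<in> measurable uniform_sphere uniform_sphere"
    unfolding measurable_cong_sets[OF sets_uniform_sphere sets_uniform_sphere]
    by (rule measurable_restrict_space3[OF meas]) (auto simp: nf)
  have pre: "f -` A \<in> sets borel" "f -` A \<subseteq> sphere 0 1"
    using measurable_sets[OF meas A(1)] A(2) nf by (auto simp: subset_iff)
  have U: "emeasure uniform_sphere B = emeasure lborel (ball 0 1 \<inter> sgn -` B) / emeasure lborel (ball (0::real^'n::{finite,wellorder}) 1)"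
    if "B \<in> sets borel" "B \<subseteq> sphere 0 1" for B :: "(real ^ 'n::{finite,wellorder}) set"
    using that measurable_sets[OF sgn_measurable that(1)] unfolding uniform_sphere_def
    by (subst emeasure_restrict_space) (auto simp: emeasure_distr)
  have eq: "ball 0 1 \<inter> sgn -` (f -` A) = f -` (ball 0 1 \<inter> sgn -` A)"
    by (auto simp: nf sg)
  have bs: "ball 0 1 \<inter> sgn -` A \<in> sets borel"
    using measurable_sets[OF sgn_measurable A(1)] by auto
  have "emeasure (distr uniform_sphere uniform_sphere f) A = emeasure uniform_sphere (f -` A)"
    using A measS pre by (subst emeasure_distr) (auto simp: sets_uniform_sphere sets_restrict_space Int_absorb2)
  also have "\<dots> = emeasure lborel (f -` (ball 0 1 \<inter> sgn -` A)) / emeasure lborel (ball (0::real^'n::{finite,wellorder}) 1)"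
    using U[OF pre] eq by simp
  also have "emeasure lborel (f -` (ball 0 1 \<inter> sgn -` A)) = emeasure (distr lborel borel f) (ball 0 1 \<inter> sgn -` A)"
    using meas bs by (subst emeasure_distr) auto
  also have "\<dots> = emeasure lborel (ball 0 1 \<inter> sgn -` A)"
    by (simp add: lborel_distr_orthogonal[OF f])
  finally show "emeasure (distr uniform_sphere uniform_sphere f) A = emeasure uniform_sphere A"
    using U[OF A] by simp
qed

end

(*
  Averaging over the edges turns the annealed partition function into the integral of a product
  over the pairs i < j of factors (1 + x K) / (1 + x), where x = w_i w_j / l and
  K = c + theta * (s_i . s_j). Since the squares of these x sum to at most (sum w_i^2)^2 / l^2,
  which is bounded, the logarithm of the product is, up to an O(1) error,
  (c - 1) l / 2 + theta / (2 l) * |sum w_i s_i|^2. The square is bounded below by its tangents and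
  above by the maximum of finitely many of them, so the pressure converges to (c - 1) E[W] / 2 plus
  the maximum over m of the free energy - E[W] |m|^2 / (2 theta) + E[ln alpha(exp (W m . s))].
  A maximiser solves the magnetisation equation because the logarithmic moment generating function
  is convex. On the sphere, the integral of exp (v . s) increases with |v|, so the maximiser can be
  taken in the direction of the field, which identifies the maximum with the supremum over axial
  solutions.

  The law of one coordinate on the sphere comes from Fubini on the ball: for a fixed distance from
  the axis, the projection of the point to the sphere is a change of variables along the axis.
*)

theory Submission
  imports Defs
begin

section \<open>Tilted spin measures and the free energy\<close>

text \<open>One variational theorem, for a spin law on any subset of the closed unit ball, serves
  both the sphere and the interval. This is what makes the Beta comparison possible for pressures:
  in finite volume the two models differ in general, because products of kernels around a cycle see
  the transversal components, and only the maxima of the two limiting free energies coincide. The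
  tangents of the square take the place of a Hubbard-Stratonovich transform: each is linear in the
  spins, so its exponential factorises over the vertices, and finitely many suffice because the
  magnetisation per unit of weight lies in the unit ball. The functions of the weights that arise in
  this way grow linearly, whereas convergence in law controls only bounded ones; they are Lipschitz
  because spins are bounded, and the convergent second moments pay for a truncation. With a field, a
  vertex of weight x sees the norm of h + x m. Turning m into the direction of h makes the triangle
  inequality an equality only for x >= 0, so the limit law must first be shown to charge no negative
  values.\<close>

locale spin_measure = prob_space \<alpha> for \<alpha> :: "'a::euclidean_space measure" +
  assumes space_subset: "space \<alpha> \<subseteq> cball 0 1"
    and sets_eq: "sets \<alpha> = sets (restrict_space borel (space \<alpha>))"
begin

lemma norm_le_1: "\<sigma> \<in> space \<alpha> \<Longrightarrow> norm \<sigma> \<le> 1"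
  using space_subset by auto

lemma continuous_on_measurable:
  assumes "continuous_on (space \<alpha>) f"
  shows "f \<in> borel_measurable \<alpha>"
  unfolding measurable_cong_sets[OF sets_eq refl]
  by (rule borel_measurable_continuous_on_restrict[OF assms])

lemma measurable_ident_borel [measurable]: "(\<lambda>\<sigma>. \<sigma>) \<in> borel_measurable \<alpha>"
  by (rule continuous_on_measurable) (rule continuous_on_id)

lemma abs_inner_le: "\<sigma> \<in> space \<alpha> \<Longrightarrow> \<bar>v \<bullet> \<sigma>\<bar> \<le> norm v"
  using Cauchy_Schwarz_ineq2[of v \<sigma>] norm_le_1[of \<sigma>]
  by (meson mult_left_le norm_ge_zero order_trans)

lemma integrable_bounded:
  fixes f :: "'a \<Rightarrow> 'b::{banach, second_countable_topology}"
  assumes "f \<in> borel_measurable \<alpha>" "\<And>\<sigma>. \<sigma> \<in> space \<alpha> \<Longrightarrow> norm (f \<sigma>) \<le> B"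
  shows "integrable \<alpha> f"
  using assms by (intro integrable_const_bound[of _ B]) auto

lemma integrable_exp: "integrable \<alpha> (\<lambda>\<sigma>. exp (v \<bullet> \<sigma>))"
proof (rule integrable_bounded[where B="exp (norm v)"])
  show "norm (exp (v \<bullet> \<sigma>)) \<le> exp (norm v)" if "\<sigma> \<in> space \<alpha>" for \<sigma>
    using abs_inner_le[OF that, of v] by simp
qed simp

lemma integrable_exp_scaleR: "integrable \<alpha> (\<lambda>\<sigma>. exp (v \<bullet> \<sigma>) *\<^sub>R \<sigma>)"
proof (rule integrable_bounded[where B="exp (norm v)"])
  show "norm (exp (v \<bullet> \<sigma>) *\<^sub>R \<sigma>) \<le> exp (norm v)" if "\<sigma> \<in> space \<alpha>" for \<sigma>
    using abs_inner_le[OF that, of v] norm_le_1[OF that]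
    by (simp add: abs_le_iff mult_left_le order_trans[OF mult_left_le[of "norm \<sigma>" "exp (v \<bullet> \<sigma>)"]])
qed simp

lemma integral_pos:
  fixes f :: "'a \<Rightarrow> real"
  assumes "integrable \<alpha> f" "\<And>\<sigma>. \<sigma> \<in> space \<alpha> \<Longrightarrow> 0 < f \<sigma>"
  shows "0 < integral\<^sup>L \<alpha> f"
proof -
  have "0 \<le> integral\<^sup>L \<alpha> f"
    using assms(2) by (intro integral_nonneg_AE AE_I2) (auto simp: less_imp_le)
  moreover have "integral\<^sup>L \<alpha> f \<noteq> 0"
  proof
    assume "integral\<^sup>L \<alpha> f = 0"
    then have "AE \<sigma> in \<alpha>. f \<sigma> = 0"
      using assms by (subst (asm) integral_nonneg_eq_0_iff_AE) (auto simp: less_imp_le)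
    then have "AE \<sigma> in \<alpha>. False"
      using AE_space by eventually_elim (use assms(2) in fastforce)
    then show False by simp
  qed
  ultimately show ?thesis by simp
qed

definition partition_fn :: "'a \<Rightarrow> real" where
  "partition_fn v = (\<integral>\<sigma>. exp (v \<bullet> \<sigma>) \<partial>\<alpha>)"

text \<open>This is the gradient of \<open>ln \<circ> partition_fn\<close> at \<open>v\<close>: the
  mean spin under the law tilted by \<open>exp (v \<bullet> \<sigma>)\<close>.\<close>

definition tilted_mean :: "'a \<Rightarrow> 'a" where
  "tilted_mean v = (\<integral>\<sigma>. exp (v \<bullet> \<sigma>) *\<^sub>R \<sigma> \<partial>\<alpha>) /\<^sub>R partition_fn v"

lemma partition_fn_pos: "0 < partition_fn v"
  unfolding partition_fn_def by (rule integral_pos[OF integrable_exp]) simp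

lemma partition_fn_0 [simp]: "partition_fn 0 = 1"
  by (simp add: partition_fn_def prob_space)

text \<open>Spins lie in the unit ball, so replacing \<open>v\<close> by \<open>u\<close> raises the
  exponent by at most \<open>norm (u - v)\<close> at every point. Consequently
  \<open>ln (partition_fn (x *\<^sub>R m))\<close> is Lipschitz in the weight \<open>x\<close>,
  which makes it an admissible test function for the convergence of the weights.\<close>

lemma ln_partition_fn_Lipschitz: "ln (partition_fn u) \<le> ln (partition_fn v) + norm (u - v)"
proof -
  have "partition_fn u \<le> (\<integral>\<sigma>. exp (norm (u - v)) * exp (v \<bullet> \<sigma>) \<partial>\<alpha>)"
    unfolding partition_fn_def
  proof (intro integral_mono integrable_exp integrable_mult_right)
    fix \<sigma> assume "\<sigma> \<in> space \<alpha>"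
    then have "u \<bullet> \<sigma> \<le> norm (u - v) + v \<bullet> \<sigma>"
      using abs_inner_le[of \<sigma> "u - v"] by (simp add: inner_diff_left)
    then show "exp (u \<bullet> \<sigma>) \<le> exp (norm (u - v)) * exp (v \<bullet> \<sigma>)"
      by (simp flip: exp_add)
  qed
  also have "\<dots> = exp (norm (u - v)) * partition_fn v"
    by (simp add: partition_fn_def)
  finally have "ln (partition_fn u) \<le> ln (exp (norm (u - v)) * partition_fn v)"
    using partition_fn_pos[of u] partition_fn_pos[of v] by simp
  then show ?thesis
    using partition_fn_pos[of v] by (simp add: ln_mult)
qed

lemma abs_ln_partition_fn_diff_le:
  "\<bar>ln (partition_fn u) - ln (partition_fn v)\<bar> \<le> norm (u - v)"
  using ln_partition_fn_Lipschitz[of u v] ln_partition_fn_Lipschitz[of v u]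
  by (simp add: norm_minus_commute)

lemma abs_ln_partition_fn_le: "\<bar>ln (partition_fn v)\<bar> \<le> norm v"
  using abs_ln_partition_fn_diff_le[of v 0] by simp

text \<open>Jensen's inequality, through \<open>exp y \<ge> exp a * (1 + (y - a))\<close> at the tilted mean \<open>a\<close> of \<open>y\<close>.\<close>

lemma ln_partition_fn_tangent:
  "ln (partition_fn u) + tilted_mean u \<bullet> (v - u) \<le> ln (partition_fn v)"
proof -
  define a where "a = tilted_mean u \<bullet> (v - u)"
  have i1: "integrable \<alpha> (\<lambda>\<sigma>. (exp (u \<bullet> \<sigma>) *\<^sub>R \<sigma>) \<bullet> (v - u))"
    by (intro integrable_inner_left integrable_exp_scaleR)
  have a: "(\<integral>\<sigma>. (exp (u \<bullet> \<sigma>) *\<^sub>R \<sigma>) \<bullet> (v - u) \<partial>\<alpha>) = a * partition_fn u"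
    using partition_fn_pos[of u]
    by (subst integral_inner_left[OF integrable_exp_scaleR]) (simp add: a_def tilted_mean_def)
  have "exp a * partition_fn u
      = (\<integral>\<sigma>. exp a * ((1 - a) * exp (u \<bullet> \<sigma>) + (exp (u \<bullet> \<sigma>) *\<^sub>R \<sigma>) \<bullet> (v - u)) \<partial>\<alpha>)"
    using i1 integrable_exp[of u] a
    by (simp add: partition_fn_def Bochner_Integration.integral_add del: inner_scaleR_left)
      (simp add: algebra_simps)
  also have "\<dots> \<le> partition_fn v"
    unfolding partition_fn_def
  proof (intro integral_mono integrable_exp integrable_mult_right Bochner_Integration.integrable_add i1)
    fix \<sigma> assume "\<sigma> \<in> space \<alpha>"
    define y where "y = \<sigma> \<bullet> (v - u)"
    have "exp a * (1 + (y - a)) \<le> exp a * exp (y - a)"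
      by (intro mult_left_mono exp_ge_add_one_self) simp
    also have "\<dots> = exp y" by (simp flip: exp_add)
    finally have "exp a * (1 + (y - a)) * exp (u \<bullet> \<sigma>) \<le> exp y * exp (u \<bullet> \<sigma>)"
      by (rule mult_right_mono) simp
    also have "\<dots> = exp (v \<bullet> \<sigma>)"
      by (simp add: y_def inner_diff_right inner_commute flip: exp_add)
    finally show "exp a * ((1 - a) * exp (u \<bullet> \<sigma>) + (exp (u \<bullet> \<sigma>) *\<^sub>R \<sigma>) \<bullet> (v - u)) \<le> exp (v \<bullet> \<sigma>)"
      by (simp add: y_def algebra_simps)
  qed
  finally have "ln (exp a * partition_fn u) \<le> ln (partition_fn v)"
    using partition_fn_pos[of u] partition_fn_pos[of v] by simp
  then show ?thesis
    using partition_fn_pos[of u] by (simp add: ln_mult a_def)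
qed

text \<open>The exponent is an arbitrary bounded function because a mean-field solution is only
  known to be continuous on a compact space until it is shown to be affine. The quotient averages
  points of the unit ball under a probability measure, whence the bound 1.\<close>

lemma norm_tilted_integral_le:
  assumes "V \<in> borel_measurable \<alpha>" "\<And>\<sigma>. \<sigma> \<in> space \<alpha> \<Longrightarrow> \<bar>V \<sigma>\<bar> \<le> B"
  shows "norm ((\<integral>\<sigma>. exp (V \<sigma>) *\<^sub>R \<sigma> \<partial>\<alpha>) /\<^sub>R (\<integral>\<sigma>. exp (V \<sigma>) \<partial>\<alpha>)) \<le> 1"
    and "integrable \<alpha> (\<lambda>\<sigma>. exp (V \<sigma>))" and "integrable \<alpha> (\<lambda>\<sigma>. exp (V \<sigma>) *\<^sub>R \<sigma>)"
    and "0 < (\<integral>\<sigma>. exp (V \<sigma>) \<partial>\<alpha>)"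
proof -
  have V: "exp (V \<sigma>) \<le> exp B" "exp (V \<sigma>) * norm \<sigma> \<le> exp (V \<sigma>)" if "\<sigma> \<in> space \<alpha>" for \<sigma>
    using assms(2)[OF that] norm_le_1[OF that] by (auto simp: mult_left_le)
  show i1: "integrable \<alpha> (\<lambda>\<sigma>. exp (V \<sigma>))"
    using assms(1) V by (intro integrable_bounded[where B="exp B"]) auto
  show i2: "integrable \<alpha> (\<lambda>\<sigma>. exp (V \<sigma>) *\<^sub>R \<sigma>)"
    using assms(1) order_trans[OF V(2) V(1)] by (intro integrable_bounded[where B="exp B"]) auto
  show pos: "0 < (\<integral>\<sigma>. exp (V \<sigma>) \<partial>\<alpha>)"
    by (rule integral_pos[OF i1]) simp
  have "norm (\<integral>\<sigma>. exp (V \<sigma>) *\<^sub>R \<sigma> \<partial>\<alpha>) \<le> (\<integral>\<sigma>. norm (exp (V \<sigma>) *\<^sub>R \<sigma>) \<partial>\<alpha>)"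
    by (rule integral_norm_bound)
  also have "\<dots> \<le> (\<integral>\<sigma>. exp (V \<sigma>) \<partial>\<alpha>)"
    using i1 i2 V by (intro integral_mono integrable_norm) auto
  finally show "norm ((\<integral>\<sigma>. exp (V \<sigma>) *\<^sub>R \<sigma> \<partial>\<alpha>) /\<^sub>R (\<integral>\<sigma>. exp (V \<sigma>) \<partial>\<alpha>)) \<le> 1"
    using pos by (simp add: field_simps)
qed

lemma tilted_integral_measurable:
  assumes [measurable]: "V \<in> borel_measurable \<alpha>"
  shows "(\<lambda>x::real. (\<integral>\<sigma>. exp (x * V \<sigma>) *\<^sub>R \<sigma> \<partial>\<alpha>) /\<^sub>R (\<integral>\<sigma>. exp (x * V \<sigma>) \<partial>\<alpha>)) \<in> borel_measurable borel"
  by measurable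

text \<open>The quotient is bounded by 1 uniformly in \<open>x\<close>, although the bound on the
  exponent \<open>x * V\<close> grows with \<open>x\<close>. Hence the identity, integrable by
  assumption, dominates the integrand.\<close>

lemma integrable_tilted_integral:
  assumes P: "finite_measure P" "sets P = sets borel" "integrable P (\<lambda>x::real. x)"
    and V: "V \<in> borel_measurable \<alpha>" "\<And>\<sigma>. \<sigma> \<in> space \<alpha> \<Longrightarrow> \<bar>V \<sigma>\<bar> \<le> B"
  shows "integrable P (\<lambda>x. x *\<^sub>R ((\<integral>\<sigma>. exp (x * V \<sigma>) *\<^sub>R \<sigma> \<partial>\<alpha>) /\<^sub>R (\<integral>\<sigma>. exp (x * V \<sigma>) \<partial>\<alpha>)))"
proof (rule Bochner_Integration.integrable_bound[OF P(3)])
  note [measurable] = tilted_integral_measurable[OF V(1)] and [measurable_cong] = P(2)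
  show "(\<lambda>x. x *\<^sub>R ((\<integral>\<sigma>. exp (x * V \<sigma>) *\<^sub>R \<sigma> \<partial>\<alpha>) /\<^sub>R (\<integral>\<sigma>. exp (x * V \<sigma>) \<partial>\<alpha>))) \<in> borel_measurable P"
    by measurable
  have "norm ((\<integral>\<sigma>. exp (x * V \<sigma>) *\<^sub>R \<sigma> \<partial>\<alpha>) /\<^sub>R (\<integral>\<sigma>. exp (x * V \<sigma>) \<partial>\<alpha>)) \<le> 1" for x
    using V by (intro norm_tilted_integral_le(1)[where B="\<bar>x\<bar> * B"]) (auto simp: abs_mult intro!: mult_left_mono)
  then have "\<bar>x\<bar> * norm ((\<integral>\<sigma>. exp (x * V \<sigma>) *\<^sub>R \<sigma> \<partial>\<alpha>) /\<^sub>R (\<integral>\<sigma>. exp (x * V \<sigma>) \<partial>\<alpha>)) \<le> \<bar>x\<bar>" for x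
    by (intro mult_left_le) auto
  then show "AE x in P. norm (x *\<^sub>R ((\<integral>\<sigma>. exp (x * V \<sigma>) *\<^sub>R \<sigma> \<partial>\<alpha>) /\<^sub>R (\<integral>\<sigma>. exp (x * V \<sigma>) \<partial>\<alpha>))) \<le> norm x"
    by (intro AE_I2) (simp only: norm_scaleR real_norm_def)
qed

end

section \<open>The limiting free energy and its maximisers\<close>

locale annealed_spin = spin_measure +
  fixes P :: "real measure" and \<theta> :: real
  assumes P: "real_distribution P"
    and integrable_P: "integrable P (\<lambda>x. x)"
    and EW_pos: "0 < (\<integral>x. x \<partial>P)"
    and \<theta>_pos: "0 < \<theta>"
begin

sublocale P: real_distribution P by (rule P)

abbreviation EW :: real where "EW \<equiv> \<integral>x. x \<partial>P"

text \<open>The contribution, per vertex and in the limit, of one tangent to the quadratic energy.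
  The tilt \<open>m\<close> is \<theta> times the magnetisation per unit of weight at which that
  tangent touches. The constant part of the pressure, \<open>(c - 1) * EW / 2\<close>, is kept
  outside.\<close>

definition free_energy :: "'a \<Rightarrow> real" where
  "free_energy m = - (EW / 2) * ((norm m)\<^sup>2 / \<theta>) + (\<integral>x. ln (partition_fn (x *\<^sub>R m)) \<partial>P)"

lemma partition_fn_scaleR_measurable [measurable]:
  "(\<lambda>x. partition_fn (x *\<^sub>R m)) \<in> borel_measurable borel"
  unfolding partition_fn_def by measurable

lemma integrable_ln_partition_fn: "integrable P (\<lambda>x. ln (partition_fn (x *\<^sub>R m)))"
proof (rule Bochner_Integration.integrable_bound)
  show "integrable P (\<lambda>x. norm m * x)" using integrable_P by simp
  show "AE x in P. norm (ln (partition_fn (x *\<^sub>R m))) \<le> norm (norm m * x)"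
    using abs_ln_partition_fn_le[of "_ *\<^sub>R m"] by (intro AE_I2) (simp add: abs_mult mult.commute)
qed simp

lemma free_energy_continuous: "continuous_on S free_energy"
proof -
  have "continuous_on S (\<lambda>m. \<integral>x. ln (partition_fn (x *\<^sub>R m)) \<partial>P)"
  proof (rule continuous_on_subset[OF lipschitz_on_continuous_on])
    show "(\<integral>x. \<bar>x\<bar> \<partial>P)-lipschitz_on UNIV (\<lambda>m. \<integral>x. ln (partition_fn (x *\<^sub>R m)) \<partial>P)"
    proof (rule lipschitz_onI)
      fix m m' :: 'a
      have "\<bar>(\<integral>x. ln (partition_fn (x *\<^sub>R m)) \<partial>P) - (\<integral>x. ln (partition_fn (x *\<^sub>R m')) \<partial>P)\<bar>
          \<le> (\<integral>x. \<bar>ln (partition_fn (x *\<^sub>R m)) - ln (partition_fn (x *\<^sub>R m'))\<bar> \<partial>P)"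
        by (subst Bochner_Integration.integral_diff[symmetric])
          (auto intro!: integrable_ln_partition_fn integral_abs_bound)
      also have "\<dots> \<le> (\<integral>x. \<bar>x\<bar> * norm (m - m') \<partial>P)"
      proof (rule integral_mono)
        show "\<bar>ln (partition_fn (x *\<^sub>R m)) - ln (partition_fn (x *\<^sub>R m'))\<bar> \<le> \<bar>x\<bar> * norm (m - m')" for x
          using abs_ln_partition_fn_diff_le[of "x *\<^sub>R m" "x *\<^sub>R m'"] by (simp flip: scaleR_diff_right)
      qed (auto intro!: integrable_ln_partition_fn integrable_P Bochner_Integration.integrable_diff integrable_mult_left integrable_abs)
      finally show "dist (\<integral>x. ln (partition_fn (x *\<^sub>R m)) \<partial>P) (\<integral>x. ln (partition_fn (x *\<^sub>R m')) \<partial>P)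
          \<le> (\<integral>x. \<bar>x\<bar> \<partial>P) * dist m m'"
        by (simp add: dist_norm)
    qed simp
  qed simp
  then show ?thesis
    unfolding free_energy_def using \<theta>_pos by (intro continuous_intros) auto
qed

text \<open>By convexity of \<open>ln \<circ> partition_fn\<close>, at a maximiser the linear part of
  the increment is dominated by a quadratic term in every direction, hence vanishes.\<close>

lemma maximiser_magnetization_solution:
  assumes max: "\<And>m'. free_energy m' \<le> free_energy m"
  shows "magnetization_solution \<theta> P \<alpha> m"
proof -
  define A where "A = (\<integral>x. x *\<^sub>R tilted_mean (x *\<^sub>R m) \<partial>P)"
  have tm: "tilted_mean (x *\<^sub>R m) = (\<integral>\<sigma>. exp (x * (m \<bullet> \<sigma>)) *\<^sub>R \<sigma> \<partial>\<alpha>) /\<^sub>R (\<integral>\<sigma>. exp (x * (m \<bullet> \<sigma>)) \<partial>\<alpha>)" for x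
    by (simp add: tilted_mean_def partition_fn_def)
  have iA: "integrable P (\<lambda>x. x *\<^sub>R tilted_mean (x *\<^sub>R m))"
    unfolding tm
    by (rule integrable_tilted_integral[where B="norm m"])
      (auto intro: integrable_P abs_inner_le P.finite_measure_axioms)
  have le: "(A - (EW / \<theta>) *\<^sub>R m) \<bullet> d \<le> EW / (2 * \<theta>) * (norm d)\<^sup>2" for d
  proof -
    have "(\<integral>x. ln (partition_fn (x *\<^sub>R m)) \<partial>P) + A \<bullet> d
        = (\<integral>x. ln (partition_fn (x *\<^sub>R m)) + (x *\<^sub>R tilted_mean (x *\<^sub>R m)) \<bullet> d \<partial>P)"
      unfolding A_def
      by (subst Bochner_Integration.integral_add)
        (auto intro!: integrable_ln_partition_fn integrable_inner_left[OF iA] simp: integral_inner_left[OF iA] simp del: inner_scaleR_left)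
    also have "\<dots> \<le> (\<integral>x. ln (partition_fn (x *\<^sub>R (m + d))) \<partial>P)"
    proof (rule integral_mono)
      show "integrable P (\<lambda>x. ln (partition_fn (x *\<^sub>R m)) + (x *\<^sub>R tilted_mean (x *\<^sub>R m)) \<bullet> d)"
        by (intro Bochner_Integration.integrable_add integrable_ln_partition_fn integrable_inner_left[OF iA])
      show "ln (partition_fn (x *\<^sub>R m)) + (x *\<^sub>R tilted_mean (x *\<^sub>R m)) \<bullet> d \<le> ln (partition_fn (x *\<^sub>R (m + d)))" for x
        using ln_partition_fn_tangent[of "x *\<^sub>R m" "x *\<^sub>R (m + d)"] by (simp flip: scaleR_diff_right)
    qed (rule integrable_ln_partition_fn)
    finally have "(\<integral>x. ln (partition_fn (x *\<^sub>R m)) \<partial>P) + A \<bullet> d \<le> (\<integral>x. ln (partition_fn (x *\<^sub>R (m + d))) \<partial>P)" .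
    with max[of "m + d"] have "A \<bullet> d \<le> EW / 2 * ((norm (m + d))\<^sup>2 / \<theta>) - EW / 2 * ((norm m)\<^sup>2 / \<theta>)"
      by (simp add: free_energy_def)
    also have "\<dots> = EW / (2 * \<theta>) * (2 * (m \<bullet> d) + (norm d)\<^sup>2)"
      using \<theta>_pos by (simp add: power2_norm_eq_inner inner_simps inner_commute field_simps)
    also have "\<dots> = EW / \<theta> * (m \<bullet> d) + EW / (2 * \<theta>) * (norm d)\<^sup>2"
      using \<theta>_pos by (simp add: field_simps)
    finally show ?thesis
      by (simp add: inner_diff_left)
  qed
  define v where "v = A - (EW / \<theta>) *\<^sub>R m"
  define k where "k = EW / (2 * \<theta>)"
  have k: "0 < k" using EW_pos \<theta>_pos by (simp add: k_def)
  \<comment> \<open>Testing the inequality with \<open>d = v / (2 k)\<close> gives |v|^2 / (2 k)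
    \<le> |v|^2 / (4 k), which leaves only v = 0.\<close>
  have "v \<bullet> ((1 / (2 * k)) *\<^sub>R v) \<le> k * (norm ((1 / (2 * k)) *\<^sub>R v))\<^sup>2"
    using le[of "(1 / (2 * k)) *\<^sub>R v"] by (simp only: v_def k_def)
  with k have "v \<bullet> v \<le> 0"
    unfolding power2_norm_eq_inner by (simp add: field_simps)
  then have "v = 0"
    by (metis inner_ge_zero inner_eq_zero_iff order_antisym)
  then have "A = (EW / \<theta>) *\<^sub>R m" by (simp add: v_def)
  then have "m /\<^sub>R \<theta> = A /\<^sub>R EW"
    using EW_pos by (simp add: divide_inverse)
  then show ?thesis
    by (simp add: magnetization_solution_def sb_expectation_def A_def tm)
qed

end

section \<open>Convergence of the weights\<close>

lemma Lipschitz_continuous_at: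
  fixes f :: "real \<Rightarrow> real"
  assumes "\<And>x y. \<bar>f x - f y\<bar> \<le> L * \<bar>x - y\<bar>"
  shows "isCont f x"
proof -
  have "\<bar>L\<bar>-lipschitz_on UNIV f"
  proof (rule lipschitz_onI)
    show "dist (f x) (f y) \<le> \<bar>L\<bar> * dist x y" for x y
      unfolding dist_real_def by (rule order_trans[OF assms mult_right_mono]) auto
  qed simp
  then have "continuous_on UNIV f" by (rule lipschitz_on_continuous_on)
  then show ?thesis by (simp add: continuous_on_eq_continuous_at)
qed

lemma Lipschitz_integrable:
  fixes f :: "real \<Rightarrow> real"
  assumes L: "\<And>x y. \<bar>f x - f y\<bar> \<le> L * \<bar>x - y\<bar>"
    and P: "finite_measure P" "sets P = sets borel" "integrable P (\<lambda>x::real. x)"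
  shows "integrable P f"
proof (rule Bochner_Integration.integrable_bound)
  interpret finite_measure P by (rule P)
  show "integrable P (\<lambda>x. \<bar>f 0\<bar> + L * \<bar>x\<bar>)"
    using P(3) by simp
  show "f \<in> borel_measurable P"
    using Lipschitz_continuous_at[OF L] P(2)
    by (subst measurable_cong_sets[OF P(2) refl]) (intro borel_measurable_continuous_onI continuous_at_imp_continuous_on, auto)
  have "\<bar>f x\<bar> \<le> \<bar>f 0\<bar> + L * \<bar>x\<bar>" for x using L[of x 0] by simp
  then show "AE x in P. norm (f x) \<le> norm (\<bar>f 0\<bar> + L * \<bar>x\<bar>)"
    by (intro AE_I2) (simp add: order_trans[OF _ abs_ge_self])
qed

text \<open>Clamping moves the argument only if |x| > M, and then by at most |x| \<le> x^2 / M. The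
  error is thus governed by second moments alone and small for large \<open>M\<close>.\<close>

lemma clamp_Lipschitz_error:
  fixes f :: "real \<Rightarrow> real"
  assumes L: "\<And>x y. \<bar>f x - f y\<bar> \<le> L * \<bar>x - y\<bar>" and L0: "0 \<le> L" and M: "0 < M"
  shows "\<bar>f x - f (max (- M) (min M x))\<bar> \<le> L / M * x\<^sup>2"
proof (cases "\<bar>x\<bar> \<le> M")
  case True
  then have "max (- M) (min M x) = x" by auto
  then show ?thesis using L0 M by simp
next
  case False
  have "\<bar>f x - f (max (- M) (min M x))\<bar> \<le> L * \<bar>x - max (- M) (min M x)\<bar>" by (rule L)
  also have "\<dots> \<le> L * \<bar>x\<bar>" using False M L0 by (intro mult_left_mono) auto
  also have "\<dots> \<le> L * (x\<^sup>2 / M)"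
  proof (intro mult_left_mono L0)
    have "M * \<bar>x\<bar> \<le> \<bar>x\<bar> * \<bar>x\<bar>" using False by (intro mult_right_mono) auto
    then show "\<bar>x\<bar> \<le> x\<^sup>2 / M" using M by (simp add: field_simps power2_eq_square)
  qed
  finally show ?thesis by simp
qed

text \<open>Truncation: the second moments control the error made by clamping the argument.\<close>

lemma weights_converge_Lipschitz:
  fixes f :: "real \<Rightarrow> real"
  assumes P: "real_distribution P" and w: "weights_converge w P"
    and L: "\<And>x y. \<bar>f x - f y\<bar> \<le> L * \<bar>x - y\<bar>"
  shows "(\<lambda>N. (\<Sum>i=1..N. f (w N i)) / real N) \<longlonglongrightarrow> (\<integral>x. f x \<partial>P)"
proof -
  interpret P: real_distribution P by (rule P)
  have L0: "0 \<le> L" using order_trans[OF abs_ge_zero L[of 1 0]] by simp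
  define s where "s = (\<integral>x. x\<^sup>2 \<partial>P)"
  have s0: "0 \<le> s" unfolding s_def by simp
  have sq: "integrable P (\<lambda>x. x\<^sup>2)"
    and S: "(\<lambda>N. (\<Sum>i=1..N. (w N i)\<^sup>2) / real N) \<longlonglongrightarrow> s"
    and wc: "weak_conv_m (\<lambda>N. distr (measure_pmf (pmf_of_set {1..N})) borel (w N)) P"
    using w by (auto simp: weights_converge_def s_def)
  have ix: "integrable P (\<lambda>x. x)"
    using sq by (rule P.square_integrable_imp_integrable[rotated]) simp
  have if': "integrable P f"
    by (rule Lipschitz_integrable[OF L P.finite_measure_axioms _ ix]) simp
  define g where "g = (\<lambda>M x. f (max (- M) (min M x)))"
  have gL: "\<bar>g M x - g M y\<bar> \<le> L * \<bar>x - y\<bar>" for M x y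
  proof -
    have "\<bar>g M x - g M y\<bar> \<le> L * \<bar>max (- M) (min M x) - max (- M) (min M y)\<bar>"
      unfolding g_def by (rule L)
    also have "\<dots> \<le> L * \<bar>x - y\<bar>"
      by (intro mult_left_mono L0) (auto simp: max_def min_def abs_if)
    finally show ?thesis .
  qed
  have g_conv: "(\<lambda>N. (\<Sum>i=1..N. g M (w N i)) / real N) \<longlonglongrightarrow> (\<integral>x. g M x \<partial>P)" if M: "0 < M" for M
  proof -
    have cont: "isCont (g M) x" for x by (rule Lipschitz_continuous_at[OF gL])
    have bdd: "norm (g M x) \<le> \<bar>f 0\<bar> + L * M" for x
    proof -
      have "\<bar>g M x - f 0\<bar> \<le> L * \<bar>max (- M) (min M x) - 0\<bar>" unfolding g_def by (rule L)
      also have "\<dots> \<le> L * M" using M by (intro mult_left_mono L0) auto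
      finally show ?thesis by simp
    qed
    have "(\<lambda>N. \<integral>x. g M x \<partial>distr (measure_pmf (pmf_of_set {1..N})) borel (w N)) \<longlonglongrightarrow> (\<integral>x. g M x \<partial>P)"
    proof (rule weak_conv_imp_integral_bdd_continuous_conv[OF _ P wc cont bdd])
      show "real_distribution (distr (measure_pmf (pmf_of_set {1..N})) borel (w N))" for N
        by (intro real_distribution.intro real_distribution_axioms.intro measure_pmf.prob_space_distr) auto
    qed
    \<comment> \<open>For N = 0 the vertex set is empty and \<open>pmf_of_set\<close> is
      unspecified, so the integral is identified with the average only for positive N.\<close>
    moreover have "\<forall>\<^sub>F N in sequentially. (\<integral>x. g M x \<partial>distr (measure_pmf (pmf_of_set {1..N})) borel (w N))
        = (\<Sum>i=1..N. g M (w N i)) / real N"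
      using eventually_gt_at_top[of 0]
    proof eventually_elim
      case (elim N)
      have "(\<integral>x. g M x \<partial>distr (measure_pmf (pmf_of_set {1..N})) borel (w N))
        = (\<integral>i. g M (w N i) \<partial>measure_pmf (pmf_of_set {1..N}))"
        using cont by (intro integral_distr) (auto intro!: borel_measurable_continuous_onI continuous_at_imp_continuous_on)
      then show ?case using elim by (simp add: integral_pmf_of_set)
    qed
    ultimately show ?thesis by (rule Lim_transform_eventually)
  qed
  have ig: "integrable P (g M)" for M
    by (rule Lipschitz_integrable[OF gL P.finite_measure_axioms _ ix]) simp
  show ?thesis
  proof (rule tendstoI)
    fix e :: real assume e: "0 < e"
    \<comment> \<open>Chosen so that \<open>L / M * (s + 1) \<le> e / 3\<close>. The summand 1 added
      to \<open>L\<close> keeps \<open>M\<close> positive when L = 0; the one added to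
      \<open>s\<close> leaves room for the second moments at finite N, which may exceed their
      limit.\<close>
    define M where "M = 3 * (L + 1) * (s + 1) / e"
    have M: "0 < M" using e L0 s0 by (simp add: M_def)
    have LM: "L / M * (s + 1) \<le> e / 3"
    proof -
      have "L * (s + 1) \<le> (L + 1) * (s + 1)" using s0 by (intro mult_right_mono) auto
      also have "\<dots> = e / 3 * M" using e by (simp add: M_def)
      finally show ?thesis using M by (simp add: field_simps)
    qed
    have errP: "\<bar>(\<integral>x. f x \<partial>P) - (\<integral>x. g M x \<partial>P)\<bar> \<le> e / 3"
    proof -
      have "(\<integral>x. f x \<partial>P) - (\<integral>x. g M x \<partial>P) = (\<integral>x. f x - g M x \<partial>P)"
        using if' ig[of M] by simp
      then have "\<bar>(\<integral>x. f x \<partial>P) - (\<integral>x. g M x \<partial>P)\<bar> \<le> (\<integral>x. \<bar>f x - g M x\<bar> \<partial>P)"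
        by (simp only: integral_abs_bound)
      also have "\<dots> \<le> (\<integral>x. L / M * x\<^sup>2 \<partial>P)"
      proof (rule integral_mono)
        show "\<bar>f x - g M x\<bar> \<le> L / M * x\<^sup>2" for x
          unfolding g_def by (rule clamp_Lipschitz_error[OF L L0 M])
      qed (use if' ig sq in auto)
      also have "\<dots> = L / M * s" by (simp add: s_def)
      also have "\<dots> \<le> L / M * (s + 1)" using L0 M by (intro mult_left_mono) auto
      also note LM
      finally show ?thesis .
    qed
    have "\<forall>\<^sub>F N in sequentially. (\<Sum>i=1..N. (w N i)\<^sup>2) / real N < s + 1"
      by (rule order_tendstoD(2)[OF S]) simp
    moreover have "\<forall>\<^sub>F N in sequentially. dist ((\<Sum>i=1..N. g M (w N i)) / real N) (\<integral>x. g M x \<partial>P) < e / 3"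
      using tendstoD[OF g_conv[OF M], of "e / 3"] e by simp
    ultimately show "\<forall>\<^sub>F N in sequentially. dist ((\<Sum>i=1..N. f (w N i)) / real N) (\<integral>x. f x \<partial>P) < e"
    proof eventually_elim
      case (elim N)
      have "\<bar>(\<Sum>i=1..N. f (w N i)) / real N - (\<Sum>i=1..N. g M (w N i)) / real N\<bar>
          = \<bar>\<Sum>i=1..N. f (w N i) - g M (w N i)\<bar> / real N"
        unfolding sum_subtractf diff_divide_distrib[symmetric] by simp
      also have "\<dots> \<le> (\<Sum>i=1..N. L / M * (w N i)\<^sup>2) / real N"
        unfolding g_def
        by (intro divide_right_mono order_trans[OF sum_abs] sum_mono clamp_Lipschitz_error[OF L L0 M]) simp
      also have "\<dots> = L / M * ((\<Sum>i=1..N. (w N i)\<^sup>2) / real N)"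
        unfolding sum_distrib_left[symmetric] by simp
      also have "\<dots> \<le> L / M * (s + 1)"
        using elim(1) L0 M by (intro mult_left_mono) auto
      finally show ?case using LM errP elim(2) unfolding dist_real_def by linarith
    qed
  qed
qed

lemma weights_converge_integrable:
  assumes "real_distribution P" "weights_converge w P"
  shows "integrable P (\<lambda>x. x)"
proof -
  interpret P: real_distribution P by (rule assms)
  have "integrable P (\<lambda>x. x\<^sup>2)"
    using assms(2) by (simp add: weights_converge_def)
  then show ?thesis
    by (rule P.square_integrable_imp_integrable[rotated]) simp
qed

text \<open>The negative part is a Lipschitz function whose averages over the positive weights
  vanish, so its integral under the limit law vanishes too.\<close>

lemma weights_converge_limit_nonneg:
  assumes P: "real_distribution P" and w: "weights_converge w P"
  shows "AE x in P. 0 \<le> x"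
proof -
  interpret P: real_distribution P by (rule P)
  have L: "\<bar>max 0 (- x) - max 0 (- y)\<bar> \<le> 1 * \<bar>x - y\<bar>" for x y :: real
    by (simp add: max_def abs_if)
  have "(\<lambda>N. (\<Sum>i=1..N. max 0 (- w N i)) / real N) \<longlonglongrightarrow> (\<integral>x. max 0 (- x) \<partial>P)"
    by (rule weights_converge_Lipschitz[OF P w L])
  moreover have "(\<Sum>i=1..N. max 0 (- w N i)) / real N = 0" for N
  proof -
    have "max 0 (- w N i) = 0" if "i \<in> {1..N}" for i
    proof -
      have "0 < w N i" using w that unfolding weights_converge_def by blast
      then show ?thesis by simp
    qed
    then have "(\<Sum>i=1..N. max 0 (- w N i)) = 0" by (rule sum.neutral[OF ballI])
    then show ?thesis by simp
  qed
  ultimately have "(\<integral>x. max 0 (- x) \<partial>P) = 0"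
    by (simp only: LIMSEQ_const_iff)
  moreover have "integrable P (\<lambda>x. max 0 (- x))"
    by (rule Lipschitz_integrable[OF L P.finite_measure_axioms _ weights_converge_integrable[OF P w]]) simp
  ultimately have "AE x in P. max 0 (- x) = 0"
    by (subst integral_nonneg_eq_0_iff_AE[symmetric]) auto
  then show ?thesis by eventually_elim linarith
qed

section \<open>Averaging over the edges\<close>

lemma finite_vertex_pairs [simp]: "finite (vertex_pairs N)"
  by (rule finite_subset[of _ "{1..N} \<times> {1..N}"]) (auto simp: vertex_pairs_def)

text \<open>Each pair contributes \<open>g\<close> if its edge is present and 1 otherwise, and
  independence lets the expectation factorise over the pairs.\<close>

lemma expectation_grg_law_prod:
  fixes g :: "nat \<times> nat \<Rightarrow> real"
  assumes p: "\<And>i j. (i, j) \<in> vertex_pairs N \<Longrightarrow> 0 \<le> edge_prob w N i j \<and> edge_prob w N i j \<le> 1"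
    and g: "\<And>e. e \<in> vertex_pairs N \<Longrightarrow> 0 \<le> g e"
  shows "(\<integral>E. (\<Prod>e\<in>E. g e) \<partial>measure_pmf (grg_law w N))
    = (\<Prod>(i, j)\<in>vertex_pairs N. 1 + edge_prob w N i j * (g (i, j) - 1))"
proof -
  let ?p = "\<lambda>(i, j). bernoulli_pmf (edge_prob w N i j)"
  have "(\<integral>E. (\<Prod>e\<in>E. g e) \<partial>measure_pmf (grg_law w N))
      = (\<integral>\<omega>. (\<Prod>e\<in>vertex_pairs N. if \<omega> e then g e else 1) \<partial>measure_pmf (Pi_pmf (vertex_pairs N) False ?p))"
    by (simp add: grg_law_def prod.inter_filter)
  also have "\<dots> = (\<Prod>e\<in>vertex_pairs N. \<integral>b. (if b then g e else 1) \<partial>measure_pmf (?p e))"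
    by (rule expectation_prod_Pi_pmf)
      (auto simp: g split: prod.splits intro!: integrable_measure_pmf_finite)
  also have "\<dots> = (\<Prod>(i, j)\<in>vertex_pairs N. 1 + edge_prob w N i j * (g (i, j) - 1))"
  proof (rule prod.cong, simp, clarify)
    fix i j assume "(i, j) \<in> vertex_pairs N"
    then show "(\<integral>b. (if b then g (i, j) else 1) \<partial>measure_pmf (bernoulli_pmf (edge_prob w N i j)))
        = 1 + edge_prob w N i j * (g (i, j) - 1)"
      using p by (simp add: algebra_simps)
  qed
  finally show ?thesis .
qed

lemma sum_symmetric_vertex_pairs:
  fixes f :: "nat \<Rightarrow> nat \<Rightarrow> real"
  assumes sym: "\<And>i j. f i j = f j i"
  shows "(\<Sum>i=1..N. \<Sum>j=1..N. f i j) = 2 * (\<Sum>(i, j)\<in>vertex_pairs N. f i j) + (\<Sum>i=1..N. f i i)"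
proof (induction N)
  case 0
  have "vertex_pairs 0 = {}" by (auto simp: vertex_pairs_def)
  then show ?case by simp
next
  case (Suc N)
  have vp: "vertex_pairs (Suc N) = vertex_pairs N \<union> (\<lambda>i. (i, Suc N)) ` {1..N}"
    by (auto simp: vertex_pairs_def image_iff le_Suc_eq)
  have "(\<Sum>(i, j)\<in>vertex_pairs (Suc N). f i j)
      = (\<Sum>(i, j)\<in>vertex_pairs N. f i j) + (\<Sum>(i, j)\<in>(\<lambda>i. (i, Suc N)) ` {1..N}. f i j)"
    unfolding vp by (intro sum.union_disjoint finite_vertex_pairs) (auto simp: vertex_pairs_def)
  also have "(\<Sum>(i, j)\<in>(\<lambda>i. (i, Suc N)) ` {1..N}. f i j) = (\<Sum>i=1..N. f i (Suc N))"
    by (subst sum.reindex) (auto simp: inj_on_def)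
  finally have "(\<Sum>(i, j)\<in>vertex_pairs (Suc N). f i j)
      = (\<Sum>(i, j)\<in>vertex_pairs N. f i j) + (\<Sum>i=1..N. f i (Suc N))" .
  moreover have "(\<Sum>i=1..Suc N. \<Sum>j=1..Suc N. f i j)
      = (\<Sum>i=1..N. \<Sum>j=1..N. f i j) + (\<Sum>i=1..N. f i (Suc N)) + ((\<Sum>j=1..N. f (Suc N) j) + f (Suc N) (Suc N))"
    by (simp add: sum.distrib)
  moreover have "(\<Sum>j=1..N. f (Suc N) j) = (\<Sum>i=1..N. f i (Suc N))"
    by (rule sum.cong) (auto intro: sym)
  ultimately show ?case using Suc by simp
qed

text \<open>The weights are unbounded, so the bound has to cover large arguments as well as small
  ones. For y > 1 it is crude: the difference lies between -y and 0, and y \<le> y^2.\<close>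

lemma ln_one_plus_quadratic_error:
  fixes y :: real
  assumes "0 \<le> y"
  shows "\<bar>ln (1 + y) - y\<bar> \<le> y\<^sup>2"
proof (cases "y \<le> 1")
  case True
  then show ?thesis
    using ln_one_plus_pos_lower_bound[of y] ln_add_one_self_le_self[of y] assms by linarith
next
  case False
  then have "y * 1 \<le> y * y" by (intro mult_left_mono) auto
  moreover have "0 \<le> ln (1 + y)" using assms by simp
  ultimately show ?thesis
    using ln_add_one_self_le_self[of y] assms unfolding power2_eq_square by linarith
qed

text \<open>With x = a b / l the edge factor is (1 + K x) / (1 + x). Expanding the two logarithms
  separately keeps both arguments above 1, also when K < 1 and the factor itself drops below
  1.\<close>

lemma ln_edge_factor_error:
  fixes a b l K C :: real
  assumes "0 < a" "0 < b" "0 < l" "0 \<le> K" "K \<le> C"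
  shows "\<bar>ln (1 + a * b / (l + a * b) * (K - 1)) - a * b / l * (K - 1)\<bar> \<le> (C\<^sup>2 + 1) * (a * b / l)\<^sup>2"
proof -
  define x where "x = a * b / l"
  have x: "0 < x" using assms by (simp add: x_def)
  have "1 + a * b / (l + a * b) * (K - 1) = (1 + K * x) / (1 + x)"
  proof -
    have "l + a * b \<noteq> 0" using assms by (simp add: add_pos_pos less_imp_neq[symmetric])
    then show ?thesis
      using assms(3) by (simp add: x_def divide_simps) (simp add: algebra_simps)
  qed
  moreover have "0 < 1 + K * x" "0 < 1 + x"
    using x assms by (auto intro: add_pos_nonneg)
  ultimately have "ln (1 + a * b / (l + a * b) * (K - 1)) - a * b / l * (K - 1)
      = (ln (1 + K * x) - K * x) - (ln (1 + x) - x)"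
    by (simp add: ln_div x_def[symmetric] algebra_simps)
  also have "\<bar>\<dots>\<bar> \<le> (K * x)\<^sup>2 + x\<^sup>2"
    using ln_one_plus_quadratic_error[of "K * x"] ln_one_plus_quadratic_error[of x] x assms(4) by simp
  also have "(K * x)\<^sup>2 \<le> (C * x)\<^sup>2"
    using assms x by (intro power_mono mult_right_mono) auto
  finally show ?thesis by (simp add: x_def[symmetric] power_mult_distrib algebra_simps)
qed

text \<open>The error does not depend on the spins, so it will pass through the integral over
  configurations. Its first term comes from linearising the logarithms, with kernel values between 0
  and \<open>c + \<theta>\<close>; its second comes from the diagonal, which the square contains and
  the sum over pairs does not.\<close>

lemma ln_edge_product_error:
  fixes s :: "nat \<Rightarrow> 'a::real_inner" and W :: "nat \<Rightarrow> real"
  assumes W: "\<And>i. i \<in> {1..N} \<Longrightarrow> 0 < W i" and N: "0 < N"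
    and s: "\<And>i. i \<in> {1..N} \<Longrightarrow> norm (s i) \<le> 1"
    and c: "\<theta> < c" "0 < \<theta>"
    and l: "l = (\<Sum>i=1..N. W i)"
  shows "\<bar>(\<Sum>(i, j)\<in>vertex_pairs N. ln (1 + W i * W j / (l + W i * W j) * (c + \<theta> * (s i \<bullet> s j) - 1)))
      - ((c - 1) * l / 2 + \<theta> / (2 * l) * (norm (\<Sum>i=1..N. W i *\<^sub>R s i))\<^sup>2)\<bar>
    \<le> ((c + \<theta>)\<^sup>2 + 1) * ((\<Sum>i=1..N. (W i)\<^sup>2) / l)\<^sup>2 + (c + \<theta> + 1) * ((\<Sum>i=1..N. (W i)\<^sup>2) / l)"
proof -
  define S where "S = (\<Sum>i=1..N. (W i)\<^sup>2)"
  define K where "K i j = c + \<theta> * (s i \<bullet> s j)" for i j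
  have l0: "0 < l" unfolding l using W N by (intro sum_pos) auto
  have K: "0 \<le> K i j" "K i j \<le> c + \<theta>" if "i \<in> {1..N}" "j \<in> {1..N}" for i j
  proof -
    have "\<bar>s i \<bullet> s j\<bar> \<le> 1 * 1"
      using s[OF that(1)] s[OF that(2)] by (intro order_trans[OF Cauchy_Schwarz_ineq2] mult_mono) auto
    then have "- \<theta> \<le> \<theta> * (s i \<bullet> s j)" "\<theta> * (s i \<bullet> s j) \<le> \<theta>"
      using c mult_left_mono[of "- 1" "s i \<bullet> s j" \<theta>] mult_left_mono[of "s i \<bullet> s j" 1 \<theta>] by auto
    then show "0 \<le> K i j" "K i j \<le> c + \<theta>" using c by (auto simp: K_def)
  qed
  let ?V = "vertex_pairs N"
  have V: "i \<in> {1..N}" "j \<in> {1..N}" if "(i, j) \<in> ?V" for i j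
    using that by (auto simp: vertex_pairs_def)
  define T1 where "T1 = (\<Sum>(i, j)\<in>?V. ln (1 + W i * W j / (l + W i * W j) * (K i j - 1)))"
  define T2 where "T2 = (\<Sum>(i, j)\<in>?V. W i * W j / l * (K i j - 1))"
  have e1: "\<bar>T1 - T2\<bar> \<le> ((c + \<theta>)\<^sup>2 + 1) * (S / l)\<^sup>2"
  proof -
    have "T1 - T2 = (\<Sum>(i, j)\<in>?V. ln (1 + W i * W j / (l + W i * W j) * (K i j - 1)) - W i * W j / l * (K i j - 1))"
      unfolding T1_def T2_def sum_subtractf[symmetric] by (rule sum.cong) auto
    moreover have "\<bar>\<Sum>(i, j)\<in>?V. ln (1 + W i * W j / (l + W i * W j) * (K i j - 1)) - W i * W j / l * (K i j - 1)\<bar>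
        \<le> (\<Sum>(i, j)\<in>?V. ((c + \<theta>)\<^sup>2 + 1) * (W i * W j / l)\<^sup>2)"
    proof (intro order_trans[OF sum_abs] sum_mono, unfold split_paired_all prod.case)
      fix i j assume ij: "(i, j) \<in> ?V"
      show "\<bar>ln (1 + W i * W j / (l + W i * W j) * (K i j - 1)) - W i * W j / l * (K i j - 1)\<bar>
          \<le> ((c + \<theta>)\<^sup>2 + 1) * (W i * W j / l)\<^sup>2"
        using V[OF ij] by (intro ln_edge_factor_error W l0 K)
    qed
    ultimately have "\<bar>T1 - T2\<bar> \<le> (\<Sum>(i, j)\<in>?V. ((c + \<theta>)\<^sup>2 + 1) * (W i * W j / l)\<^sup>2)"
      by (simp only:)
    \<comment> \<open>Adding the remaining index pairs only increases the sum and turns it into a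
      product of two single sums.\<close>
    also have "\<dots> \<le> (\<Sum>(i, j)\<in>{1..N} \<times> {1..N}. ((c + \<theta>)\<^sup>2 + 1) * (W i * W j / l)\<^sup>2)"
    proof (rule sum_mono2)
      show "?V \<subseteq> {1..N} \<times> {1..N}" by (auto simp: vertex_pairs_def)
    qed auto
    also have "\<dots> = ((c + \<theta>)\<^sup>2 + 1) * (S / l)\<^sup>2"
    proof -
      have "(S / l)\<^sup>2 = (\<Sum>i=1..N. (W i)\<^sup>2 / l) * (\<Sum>i=1..N. (W i)\<^sup>2 / l)"
        unfolding S_def sum_divide_distrib by (rule power2_eq_square)
      moreover have "\<dots> = (\<Sum>(i, j)\<in>{1..N} \<times> {1..N}. (W i * W j / l)\<^sup>2)"
        unfolding sum_product sum.cartesian_product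
        by (intro sum.cong refl) (auto simp: power2_eq_square)
      ultimately show ?thesis
        by (simp add: sum_distrib_left split_def)
    qed
    finally show ?thesis .
  qed
  \<comment> \<open>The double sum over all indices is the wanted expression times 2. It counts each
    pair twice and the diagonal once, so half of the diagonal is the error;
    \<open>c + \<theta> + 1\<close> bounds \<open>\<bar>K i i - 1\<bar>\<close>.\<close>
  have e2: "\<bar>T2 - ((c - 1) * l / 2 + \<theta> / (2 * l) * (norm (\<Sum>i=1..N. W i *\<^sub>R s i))\<^sup>2)\<bar> \<le> (c + \<theta> + 1) * (S / l)"
  proof -
    have "(\<Sum>i=1..N. \<Sum>j=1..N. W i * W j / l * (K i j - 1))
        = (c - 1) / l * (\<Sum>i=1..N. \<Sum>j=1..N. W i * W j)
          + \<theta> / l * (\<Sum>i=1..N. \<Sum>j=1..N. (W i *\<^sub>R s i) \<bullet> (W j *\<^sub>R s j))"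
      unfolding sum_distrib_left sum.distrib[symmetric]
      using l0 by (intro sum.cong refl) (simp add: K_def field_simps)
    also have "(\<Sum>i=1..N. \<Sum>j=1..N. W i * W j) = l * l"
      by (simp add: l sum_product)
    also have "(\<Sum>i=1..N. \<Sum>j=1..N. (W i *\<^sub>R s i) \<bullet> (W j *\<^sub>R s j)) = (norm (\<Sum>i=1..N. W i *\<^sub>R s i))\<^sup>2"
      unfolding power2_norm_eq_inner inner_sum_left inner_sum_right by (rule sum.swap)
    finally have full: "(\<Sum>i=1..N. \<Sum>j=1..N. W i * W j / l * (K i j - 1))
        = (c - 1) * l + \<theta> / l * (norm (\<Sum>i=1..N. W i *\<^sub>R s i))\<^sup>2"
      using l0 by simp
    have "(\<Sum>i=1..N. \<Sum>j=1..N. W i * W j / l * (K i j - 1))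
        = 2 * T2 + (\<Sum>i=1..N. W i * W i / l * (K i i - 1))"
      unfolding T2_def by (rule sum_symmetric_vertex_pairs) (simp add: K_def inner_commute mult.commute)
    with full have "T2 - ((c - 1) * l / 2 + \<theta> / (2 * l) * (norm (\<Sum>i=1..N. W i *\<^sub>R s i))\<^sup>2)
        = - (\<Sum>i=1..N. W i * W i / l * (K i i - 1)) / 2"
      by (simp add: field_simps)
    also have "\<bar>\<dots>\<bar> = \<bar>\<Sum>i=1..N. W i * W i / l * (K i i - 1)\<bar> / 2" by simp
    also have "\<dots> \<le> \<bar>\<Sum>i=1..N. W i * W i / l * (K i i - 1)\<bar>" by simp
    also have "\<dots> \<le> (\<Sum>i=1..N. (c + \<theta> + 1) * ((W i)\<^sup>2 / l))"
    proof (intro order_trans[OF sum_abs] sum_mono)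
      fix i assume i: "i \<in> {1..N}"
      have "\<bar>W i * W i / l * (K i i - 1)\<bar> = (W i)\<^sup>2 / l * \<bar>K i i - 1\<bar>"
        using l0 by (simp add: abs_mult power2_eq_square)
      also have "\<dots> \<le> (W i)\<^sup>2 / l * (c + \<theta> + 1)"
        using K[OF i i] l0 c by (intro mult_left_mono) auto
      finally show "\<bar>W i * W i / l * (K i i - 1)\<bar> \<le> (c + \<theta> + 1) * ((W i)\<^sup>2 / l)"
        by (simp only: mult.commute)
    qed
    also have "\<dots> = (c + \<theta> + 1) * (S / l)"
      by (simp add: S_def sum_distrib_left sum_divide_distrib)
    finally show ?thesis .
  qed
  show ?thesis
    using e1 e2 unfolding S_def[symmetric] T1_def[unfolded K_def, symmetric] by linarith
qed

section \<open>The variational formula for the annealed pressure\<close>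

text \<open>Inner products of points of the unit ball are at least -1, so
  \<open>\<theta> < c\<close> is what keeps the kernel positive for every spin space considered
  here.\<close>

locale annealed_model = annealed_spin +
  fixes w :: "nat \<Rightarrow> nat \<Rightarrow> real" and c :: real
  assumes weights: "weights_converge w P"
    and \<theta>_less_c: "\<theta> < c"
begin

abbreviation config :: "nat \<Rightarrow> (nat \<Rightarrow> 'a) measure" where
  "config N \<equiv> PiM {1..N} (\<lambda>_. \<alpha>)"

definition total_weight :: "nat \<Rightarrow> real" where
  "total_weight N = (\<Sum>i=1..N. w N i)"

definition magnetisation :: "nat \<Rightarrow> (nat \<Rightarrow> 'a) \<Rightarrow> 'a" where
  "magnetisation N s = (\<Sum>i=1..N. w N i *\<^sub>R s i)"

text \<open>The partition function of an inhomogeneous Curie-Weiss model: coupling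
  \<open>\<theta> * w N i * w N j / total_weight N\<close> between each pair, self-interactions
  included.\<close>

definition mean_field_partition :: "nat \<Rightarrow> real" where
  "mean_field_partition N =
     (\<integral>s. exp (\<theta> / (2 * total_weight N) * (norm (magnetisation N s))\<^sup>2) \<partial>config N)"

text \<open>\<open>free_energy\<close> with the empirical law of the weights in place of
  \<open>P\<close>.\<close>

definition free_energy_at :: "nat \<Rightarrow> 'a \<Rightarrow> real" where
  "free_energy_at N m = - (total_weight N / real N / 2) * ((norm m)\<^sup>2 / \<theta>)
     + (\<Sum>i=1..N. ln (partition_fn (w N i *\<^sub>R m))) / real N"

definition pressure_error :: "nat \<Rightarrow> real" where
  "pressure_error N = ((c + \<theta>)\<^sup>2 + 1) * ((\<Sum>i=1..N. (w N i)\<^sup>2) / total_weight N)\<^sup>2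
     + (c + \<theta> + 1) * ((\<Sum>i=1..N. (w N i)\<^sup>2) / total_weight N)"

lemma weight_pos: "i \<in> {1..N} \<Longrightarrow> 0 < w N i"
  using weights by (auto simp: weights_converge_def)

lemma total_weight_pos: "0 < N \<Longrightarrow> 0 < total_weight N"
  unfolding total_weight_def by (intro sum_pos weight_pos) auto

lemma prob_space_config: "prob_space (config N)"
  by (rule prob_space_PiM) (rule prob_space_axioms)

lemma component_space: "s \<in> space (config N) \<Longrightarrow> i \<in> {1..N} \<Longrightarrow> s i \<in> space \<alpha>"
  by (auto simp: space_PiM)

lemma component_measurable [measurable]:
  assumes "i \<in> {1..N}"
  shows "(\<lambda>s. s i) \<in> borel_measurable (config N)"
proof -
  have "(\<lambda>s. s i) \<in> measurable (config N) \<alpha>"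
    using assms by (rule measurable_component_singleton)
  then show ?thesis by (rule measurable_compose) (rule measurable_ident_borel)
qed

lemma magnetisation_measurable [measurable]: "magnetisation N \<in> borel_measurable (config N)"
  unfolding magnetisation_def[abs_def] by (intro borel_measurable_sum borel_measurable_scaleR component_measurable) auto

lemma norm_magnetisation_le:
  assumes "s \<in> space (config N)"
  shows "norm (magnetisation N s) \<le> total_weight N"
proof -
  have "norm (w N i *\<^sub>R s i) \<le> w N i" if "i \<in> {1..N}" for i
    using norm_le_1[OF component_space[OF assms that]] weight_pos[OF that] by (simp add: mult_left_le)
  then show ?thesis
    unfolding magnetisation_def total_weight_def by (rule sum_norm_le)
qed

lemma config_integrable:
  fixes f :: "(nat \<Rightarrow> 'a) \<Rightarrow> real"
  assumes "f \<in> borel_measurable (config N)" "\<And>s. s \<in> space (config N) \<Longrightarrow> \<bar>f s\<bar> \<le> B"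
  shows "integrable (config N) f"
  using assms
  by (intro finite_measure.integrable_const_bound[OF prob_space.axioms(1)[OF prob_space_config], of _ B]) auto

lemma kernel_bounds:
  assumes "\<sigma> \<in> space \<alpha>" "\<tau> \<in> space \<alpha>"
  shows "0 < c + \<theta> * (\<sigma> \<bullet> \<tau>)" "c + \<theta> * (\<sigma> \<bullet> \<tau>) \<le> c + \<theta>"
proof -
  have "\<bar>\<sigma> \<bullet> \<tau>\<bar> \<le> 1"
    using abs_inner_le[OF assms(2), of \<sigma>] norm_le_1[OF assms(1)] by linarith
  then have "- \<theta> \<le> \<theta> * (\<sigma> \<bullet> \<tau>)" "\<theta> * (\<sigma> \<bullet> \<tau>) \<le> \<theta>"
    using \<theta>_pos mult_left_mono[of "- 1" "\<sigma> \<bullet> \<tau>" \<theta>] mult_left_mono[of "\<sigma> \<bullet> \<tau>" 1 \<theta>] by auto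
  then show "0 < c + \<theta> * (\<sigma> \<bullet> \<tau>)" "c + \<theta> * (\<sigma> \<bullet> \<tau>) \<le> c + \<theta>"
    using \<theta>_less_c by auto
qed

lemma edge_prob_eq: "edge_prob w N i j = w N i * w N j / (total_weight N + w N i * w N j)"
  by (simp add: edge_prob_def total_weight_def)

lemma edge_prob_bounds:
  assumes "(i, j) \<in> vertex_pairs N"
  shows "0 \<le> edge_prob w N i j \<and> edge_prob w N i j \<le> 1"
proof -
  have "0 < w N i" "0 < w N j" "0 < N"
    using assms by (auto simp: vertex_pairs_def intro!: weight_pos)
  then show ?thesis
    using total_weight_pos[of N] by (simp add: edge_prob_eq add_pos_pos less_imp_le)
qed

text \<open>The edge set takes finitely many values, so exchanging the two integrals is linearity
  over a finite sum. On the spin space the kernel is positive, which lets \<open>exp\<close> undo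
  the logarithm in \<open>inner_interaction\<close>.\<close>

lemma finite_pressure_eq:
  "finite_pressure (inner_interaction c \<theta>) w \<alpha> N = 1 / real N * ln (\<integral>s.
     (\<Prod>(i, j)\<in>vertex_pairs N. 1 + edge_prob w N i j * (c + \<theta> * (s i \<bullet> s j) - 1)) \<partial>config N)"
proof -
  let ?V = "vertex_pairs N"
  let ?h = "\<lambda>E s. \<Prod>e\<in>E. c + \<theta> * (s (fst e) \<bullet> s (snd e))"
  let ?G = "measure_pmf (grg_law w N)"
  have V: "i \<in> {1..N}" "j \<in> {1..N}" if "(i, j) \<in> ?V" for i j
    using that by (auto simp: vertex_pairs_def)
  have G: "set_pmf (grg_law w N) \<subseteq> Pow ?V"
    by (auto simp: grg_law_def)
  have fin: "finite (Pow ?V)" by simp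
  have h: "exp (\<Sum>(i, j)\<in>E. inner_interaction c \<theta> (s i) (s j)) = ?h E s"
    if E: "E \<in> Pow ?V" and s: "s \<in> space (config N)" for E s
  proof -
    have "finite E" using E by (auto intro: finite_subset)
    then have "exp (\<Sum>(i, j)\<in>E. inner_interaction c \<theta> (s i) (s j))
        = (\<Prod>e\<in>E. exp (case e of (i, j) \<Rightarrow> inner_interaction c \<theta> (s i) (s j)))"
      by (rule exp_sum)
    also have "\<dots> = ?h E s"
    proof (rule prod.cong[OF refl])
      fix e assume "e \<in> E"
      then have e: "(fst e, snd e) \<in> ?V" using E by auto
      show "exp (case e of (i, j) \<Rightarrow> inner_interaction c \<theta> (s i) (s j)) = c + \<theta> * (s (fst e) \<bullet> s (snd e))"
        using kernel_bounds(1)[OF component_space[OF s V(1)[OF e]] component_space[OF s V(2)[OF e]]]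
        by (simp add: inner_interaction_def split_def)
    qed
    finally show ?thesis .
  qed
  have hi: "integrable (config N) (?h E)" if E: "E \<in> Pow ?V" for E
  proof (rule config_integrable)
    have e: "(fst e, snd e) \<in> ?V" if "e \<in> E" for e using E that by auto
    show "?h E \<in> borel_measurable (config N)"
      using V[OF e] by (intro borel_measurable_prod borel_measurable_add borel_measurable_times
          borel_measurable_const borel_measurable_inner component_measurable) auto
    show "\<bar>?h E s\<bar> \<le> (\<Prod>e\<in>E. c + \<theta>)" if s: "s \<in> space (config N)" for s
      unfolding abs_prod
    proof (intro prod_mono)
      fix f assume "f \<in> E"
      from kernel_bounds[OF component_space[OF s V(1)[OF e[OF this]]] component_space[OF s V(2)[OF e[OF this]]]]
      show "0 \<le> \<bar>c + \<theta> * (s (fst f) \<bullet> s (snd f))\<bar> \<and> \<bar>c + \<theta> * (s (fst f) \<bullet> s (snd f))\<bar> \<le> c + \<theta>"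
        by linarith
    qed
  qed
  have "(\<integral>E. (\<integral>s. exp (\<Sum>(i, j)\<in>E. inner_interaction c \<theta> (s i) (s j)) \<partial>config N) \<partial>?G)
      = (\<Sum>E\<in>Pow ?V. pmf (grg_law w N) E *\<^sub>R (\<integral>s. exp (\<Sum>(i, j)\<in>E. inner_interaction c \<theta> (s i) (s j)) \<partial>config N))"
    using G by (intro integral_measure_pmf[OF fin]) auto
  also have "\<dots> = (\<Sum>E\<in>Pow ?V. \<integral>s. pmf (grg_law w N) E * ?h E s \<partial>config N)"
    using h by (intro sum.cong refl) (auto intro!: arg_cong2[where f=times] Bochner_Integration.integral_cong)
  also have "\<dots> = (\<integral>s. (\<Sum>E\<in>Pow ?V. pmf (grg_law w N) E * ?h E s) \<partial>config N)"
    by (intro Bochner_Integration.integral_sum[symmetric] integrable_mult_right hi)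
  also have "\<dots> = (\<integral>s. (\<integral>E. ?h E s \<partial>?G) \<partial>config N)"
  proof (intro Bochner_Integration.integral_cong refl)
    fix s
    show "(\<Sum>E\<in>Pow ?V. pmf (grg_law w N) E * ?h E s) = (\<integral>E. ?h E s \<partial>?G)"
      using G by (subst integral_measure_pmf[OF fin]) auto
  qed
  also have "\<dots> = (\<integral>s. (\<Prod>(i, j)\<in>?V. 1 + edge_prob w N i j * (c + \<theta> * (s i \<bullet> s j) - 1)) \<partial>config N)"
  proof (intro Bochner_Integration.integral_cong refl)
    fix s assume s: "s \<in> space (config N)"
    have "0 \<le> c + \<theta> * (s (fst e) \<bullet> s (snd e))" if "e \<in> ?V" for e
    proof -
      have e: "(fst e, snd e) \<in> ?V" using that by simp
      show ?thesis
        using kernel_bounds(1)[OF component_space[OF s V(1)[OF e]] component_space[OF s V(2)[OF e]]] by simp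
    qed
    then show "(\<integral>E. ?h E s \<partial>?G) = (\<Prod>(i, j)\<in>?V. 1 + edge_prob w N i j * (c + \<theta> * (s i \<bullet> s j) - 1))"
      using expectation_grg_law_prod[OF edge_prob_bounds, where g="\<lambda>e. c + \<theta> * (s (fst e) \<bullet> s (snd e))"]
      by simp
  qed
  finally show ?thesis by (simp only: finite_pressure_def)
qed

lemma exp_energy_integrable:
  "integrable (config N) (\<lambda>s. exp (\<theta> / (2 * total_weight N) * (norm (magnetisation N s))\<^sup>2))"
proof (rule config_integrable)
  show "\<bar>exp (\<theta> / (2 * total_weight N) * (norm (magnetisation N s))\<^sup>2)\<bar>
      \<le> exp (\<bar>\<theta> / (2 * total_weight N)\<bar> * (total_weight N)\<^sup>2)" if "s \<in> space (config N)" for s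
  proof -
    have "(norm (magnetisation N s))\<^sup>2 \<le> (total_weight N)\<^sup>2"
      using norm_magnetisation_le[OF that] by (intro power_mono) auto
    then have "\<theta> / (2 * total_weight N) * (norm (magnetisation N s))\<^sup>2
        \<le> \<bar>\<theta> / (2 * total_weight N)\<bar> * (total_weight N)\<^sup>2"
      by (intro mult_mono abs_ge_self) auto
    then show ?thesis by simp
  qed
qed measurable

lemma mean_field_partition_pos: "0 < mean_field_partition N"
proof -
  have "measure (config N) (space (config N)) = 1"
    by (rule prob_space.prob_space[OF prob_space_config])
  then have "(1::real) = (\<integral>s. 1 \<partial>config N)" by simp
  also have "\<dots> \<le> mean_field_partition N"
    unfolding mean_field_partition_def
  proof (rule integral_mono[OF _ exp_energy_integrable])
    show "1 \<le> exp (\<theta> / (2 * total_weight N) * (norm (magnetisation N s))\<^sup>2)" for s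
      using \<theta>_pos total_weight_pos[of N] by (cases "N = 0") (auto simp: total_weight_def)
  qed (rule config_integrable[of _ _ 1]; simp)
  finally show ?thesis by simp
qed

text \<open>The exponent is known up to an error uniform in the configuration. The integrand is
  therefore squeezed between two constant multiples of the mean-field Boltzmann factor, and so is
  its integral.\<close>

lemma finite_pressure_mean_field:
  assumes N: "0 < N"
  shows "\<bar>finite_pressure (inner_interaction c \<theta>) w \<alpha> N
      - ((c - 1) * total_weight N / 2 + ln (mean_field_partition N)) / real N\<bar> \<le> pressure_error N / real N"
proof -
  let ?V = "vertex_pairs N"
  let ?l = "total_weight N" and ?J = "mean_field_partition N" and ?D = "pressure_error N"
  define a where "a = (c - 1) * ?l / 2"
  define F where "F s = (\<Prod>(i, j)\<in>?V. 1 + edge_prob w N i j * (c + \<theta> * (s i \<bullet> s j) - 1))" for s :: "nat \<Rightarrow> 'a"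
  define H where "H s = \<theta> / (2 * ?l) * (norm (magnetisation N s))\<^sup>2" for s
  have V: "i \<in> {1..N}" "j \<in> {1..N}" if "(i, j) \<in> ?V" for i j
    using that by (auto simp: vertex_pairs_def)
  have l0: "0 < ?l" by (rule total_weight_pos[OF N])
  have FH: "exp (a - ?D) * exp (H s) \<le> F s" "F s \<le> exp (a + ?D) * exp (H s)" if s: "s \<in> space (config N)" for s
  proof -
    have pos: "0 < 1 + edge_prob w N i j * (c + \<theta> * (s i \<bullet> s j) - 1)" if "(i, j) \<in> ?V" for i j
    proof -
      have x: "0 < w N i * w N j" using weight_pos V[OF that] by simp
      have K: "0 < c + \<theta> * (s i \<bullet> s j)"
        by (rule kernel_bounds(1)[OF component_space[OF s V(1)[OF that]] component_space[OF s V(2)[OF that]]])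
      have l: "?l + w N i * w N j \<noteq> 0" using x l0 by simp
      have "1 + edge_prob w N i j * (c + \<theta> * (s i \<bullet> s j) - 1)
          = (?l + w N i * w N j * (c + \<theta> * (s i \<bullet> s j))) / (?l + w N i * w N j)"
        using l by (simp add: edge_prob_eq divide_simps) (simp add: algebra_simps)
      also have "0 < \<dots>" 
          by (rule divide_pos_pos[OF add_pos_pos[OF l0 mult_pos_pos[OF x K]] add_pos_pos[OF l0 x]])
      finally show ?thesis .
    qed
    then have "F s = exp (\<Sum>(i, j)\<in>?V. ln (1 + edge_prob w N i j * (c + \<theta> * (s i \<bullet> s j) - 1)))"
      unfolding F_def by (subst exp_sum[OF finite_vertex_pairs]) (auto intro!: prod.cong)
    moreover have "\<bar>(\<Sum>(i, j)\<in>?V. ln (1 + edge_prob w N i j * (c + \<theta> * (s i \<bullet> s j) - 1))) - (a + H s)\<bar> \<le> ?D"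
      unfolding pressure_error_def a_def H_def magnetisation_def edge_prob_eq
      by (rule ln_edge_product_error[OF weight_pos N norm_le_1[OF component_space[OF s]] \<theta>_less_c \<theta>_pos])
        (auto simp: total_weight_def)
    ultimately show "exp (a - ?D) * exp (H s) \<le> F s" "F s \<le> exp (a + ?D) * exp (H s)"
      by (auto simp flip: exp_add)
  qed
  have iH: "integrable (config N) (\<lambda>s. exp (H s))"
    unfolding H_def by (rule exp_energy_integrable)
  have iF: "integrable (config N) F"
  proof (rule Bochner_Integration.integrable_bound[OF integrable_mult_right[OF iH]])
    show "F \<in> borel_measurable (config N)"
      unfolding F_def[abs_def] split_def using V
      by (intro borel_measurable_prod borel_measurable_add borel_measurable_times borel_measurable_diff
          borel_measurable_const borel_measurable_inner component_measurable) auto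
    show "AE s in config N. norm (F s) \<le> norm (exp (a + ?D) * exp (H s))"
    proof (rule AE_I2)
      fix s assume "s \<in> space (config N)"
      from FH[OF this] have "0 \<le> F s" "F s \<le> exp (a + ?D) * exp (H s)"
        by (auto intro: order_trans[rotated])
      then show "norm (F s) \<le> norm (exp (a + ?D) * exp (H s))" by simp
    qed
  qed
  have J: "(\<integral>s. exp (H s) \<partial>config N) = ?J" by (simp add: H_def mean_field_partition_def)
  have lo: "exp (a - ?D) * ?J \<le> (\<integral>s. F s \<partial>config N)"
    unfolding J[symmetric] integral_mult_right_zero[symmetric]
    using FH(1) by (intro integral_mono integrable_mult_right iH iF)
  have up: "(\<integral>s. F s \<partial>config N) \<le> exp (a + ?D) * ?J"
    unfolding J[symmetric] integral_mult_right_zero[symmetric]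
    using FH(2) by (intro integral_mono integrable_mult_right iH iF)
  have Jpos: "0 < ?J" by (rule mean_field_partition_pos)
  have Ipos: "0 < (\<integral>s. F s \<partial>config N)"
    by (rule less_le_trans[OF _ lo]) (simp add: Jpos)
  have "ln (exp (a - ?D) * ?J) \<le> ln (\<integral>s. F s \<partial>config N)"
    using lo Jpos Ipos by (subst ln_le_cancel_iff) auto
  moreover have "ln (\<integral>s. F s \<partial>config N) \<le> ln (exp (a + ?D) * ?J)"
    using up Jpos Ipos by (subst ln_le_cancel_iff) auto
  ultimately have "\<bar>ln (\<integral>s. F s \<partial>config N) - (a + ln ?J)\<bar> \<le> ?D"
    using Jpos by (simp add: ln_mult abs_le_iff)
  then have "\<bar>ln (\<integral>s. F s \<partial>config N) - (a + ln ?J)\<bar> / real N \<le> ?D / real N"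
    by (rule divide_right_mono) simp
  moreover have "finite_pressure (inner_interaction c \<theta>) w \<alpha> N - (a + ln ?J) / real N
      = (ln (\<integral>s. F s \<partial>config N) - (a + ln ?J)) / real N"
    unfolding finite_pressure_eq F_def by (simp add: diff_divide_distrib)
  ultimately show ?thesis
    by (simp add: a_def)
qed

text \<open>An exponent linear in the spins is a sum of single-spin terms, so the product measure
  factorises. The quadratic energy has no such property, which is why it is replaced by
  tangents.\<close>

lemma integral_exp_inner_magnetisation:
  shows "(\<integral>s. exp (m \<bullet> magnetisation N s) \<partial>config N) = (\<Prod>i=1..N. partition_fn (w N i *\<^sub>R m))"
    and "integrable (config N) (\<lambda>s. exp (m \<bullet> magnetisation N s))"
proof -
  interpret product_sigma_finite "\<lambda>_::nat. \<alpha>" by standard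
  have eq: "exp (m \<bullet> magnetisation N s) = (\<Prod>i=1..N. exp ((w N i *\<^sub>R m) \<bullet> s i))" for s
    by (simp add: magnetisation_def inner_sum_right exp_sum)
  show "(\<integral>s. exp (m \<bullet> magnetisation N s) \<partial>config N) = (\<Prod>i=1..N. partition_fn (w N i *\<^sub>R m))"
    unfolding eq partition_fn_def by (rule product_integral_prod[OF finite_atLeastAtMost integrable_exp])
  show "integrable (config N) (\<lambda>s. exp (m \<bullet> magnetisation N s))"
    unfolding eq by (rule product_integrable_prod[OF finite_atLeastAtMost integrable_exp])
qed

text \<open>Identifies \<open>free_energy_at N m\<close> as 1/N times the logarithm of the partition
  function whose energy is the tangent with slope \<open>m\<close> from
  \<open>square_expansion\<close>.\<close>

lemma exp_free_energy_at:
  assumes N: "0 < N"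
  shows "exp (real N * free_energy_at N m) = exp (- (total_weight N * (norm m)\<^sup>2 / (2 * \<theta>)))
    * (\<integral>s. exp (m \<bullet> magnetisation N s) \<partial>config N)"
proof -
  have "real N * free_energy_at N m = - (total_weight N * (norm m)\<^sup>2 / (2 * \<theta>))
      + (\<Sum>i=1..N. ln (partition_fn (w N i *\<^sub>R m)))"
    using N by (simp add: free_energy_at_def field_simps)
  then show ?thesis
    unfolding integral_exp_inner_magnetisation
    by (simp only: exp_add exp_sum[OF finite_atLeastAtMost] exp_ln partition_fn_pos)
qed

text \<open>The first two terms form the tangent at \<open>s = (l / \<theta>) *\<^sub>R m\<close>.
  The remainder is nonnegative, which gives the lower bound on the partition function; it is small
  near the point of contact, which gives the upper bound.\<close>

lemma square_expansion:
  assumes "0 < l"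
  shows "\<theta> / (2 * l) * (norm s)\<^sup>2
    = m \<bullet> s - l * (norm m)\<^sup>2 / (2 * \<theta>) + \<theta> / (2 * l) * (norm (s - (l / \<theta>) *\<^sub>R m))\<^sup>2"
  using assms \<theta>_pos
  by (simp add: power2_norm_eq_inner inner_simps inner_commute field_simps)

lemma mean_field_partition_lower:
  assumes N: "0 < N"
  shows "free_energy_at N m \<le> ln (mean_field_partition N) / real N"
proof -
  let ?l = "total_weight N"
  have l0: "0 < ?l" by (rule total_weight_pos[OF N])
  have "exp (real N * free_energy_at N m)
      = (\<integral>s. exp (- (?l * (norm m)\<^sup>2 / (2 * \<theta>))) * exp (m \<bullet> magnetisation N s) \<partial>config N)"
    by (simp add: exp_free_energy_at[OF N])
  also have "\<dots> \<le> mean_field_partition N"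
    unfolding mean_field_partition_def
  proof (intro integral_mono integrable_mult_right integral_exp_inner_magnetisation(2) exp_energy_integrable)
    fix s
    show "exp (- (?l * (norm m)\<^sup>2 / (2 * \<theta>))) * exp (m \<bullet> magnetisation N s)
        \<le> exp (\<theta> / (2 * ?l) * (norm (magnetisation N s))\<^sup>2)"
      using square_expansion[OF l0, of "magnetisation N s" m] l0 \<theta>_pos by (simp flip: exp_add)
  qed
  finally have "real N * free_energy_at N m \<le> ln (mean_field_partition N)"
    using mean_field_partition_pos[of N] by (simp add: ln_ge_iff)
  then show ?thesis using N by (simp add: field_simps)
qed

text \<open>A finite net of tilts replaces the Gaussian linearisation of the square.\<close>

lemma mean_field_partition_upper:
  assumes N: "0 < N" and \<epsilon>: "0 < \<epsilon>"
    and T: "finite T" "T \<noteq> {}" "cball 0 1 \<subseteq> (\<Union>u\<in>T. ball u \<epsilon>)"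
    and M: "\<And>u. u \<in> T \<Longrightarrow> free_energy_at N (\<theta> *\<^sub>R u) \<le> M"
  shows "ln (mean_field_partition N) / real N
    \<le> ln (card T) / real N + \<theta> * (total_weight N / real N) * \<epsilon>\<^sup>2 / 2 + M"
proof -
  let ?l = "total_weight N"
  have l0: "0 < ?l" by (rule total_weight_pos[OF N])
  \<comment> \<open>Bounds the remainder in \<open>square_expansion\<close> for the tilt
    \<open>\<theta> *\<^sub>R u\<close> whenever \<open>u\<close> is within \<epsilon> of the
    magnetisation per unit of weight.\<close>
  define D where "D = \<theta> * ?l * \<epsilon>\<^sup>2 / 2"
  define f where "f u s = exp D * (exp (- (?l * (norm (\<theta> *\<^sub>R u))\<^sup>2 / (2 * \<theta>))) * exp ((\<theta> *\<^sub>R u) \<bullet> magnetisation N s))" for u s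
  have "mean_field_partition N \<le> (\<integral>s. (\<Sum>u\<in>T. f u s) \<partial>config N)"
    unfolding mean_field_partition_def
  proof (rule integral_mono[OF exp_energy_integrable])
    show "integrable (config N) (\<lambda>s. \<Sum>u\<in>T. f u s)"
      unfolding f_def by (intro Bochner_Integration.integrable_sum integrable_mult_right integral_exp_inner_magnetisation(2))
    fix s assume s: "s \<in> space (config N)"
    have "(1 / ?l) *\<^sub>R magnetisation N s \<in> cball 0 1"
      using norm_magnetisation_le[OF s] l0 by (simp add: field_simps)
    then have "(1 / ?l) *\<^sub>R magnetisation N s \<in> (\<Union>u\<in>T. ball u \<epsilon>)"
      by (rule subsetD[OF T(3)])
    then obtain u where u: "u \<in> T" "dist u ((1 / ?l) *\<^sub>R magnetisation N s) < \<epsilon>"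
      unfolding mem_ball[symmetric] by blast
    have "magnetisation N s - ?l *\<^sub>R u = ?l *\<^sub>R ((1 / ?l) *\<^sub>R magnetisation N s - u)"
      using l0 by (simp add: scaleR_diff_right)
    then have "norm (magnetisation N s - ?l *\<^sub>R u) \<le> ?l * \<epsilon>"
      using u(2) l0 by (simp add: dist_norm norm_minus_commute)
    then have "\<theta> / (2 * ?l) * (norm (magnetisation N s - ?l *\<^sub>R u))\<^sup>2 \<le> \<theta> / (2 * ?l) * (?l * \<epsilon>)\<^sup>2"
      using l0 \<theta>_pos by (intro mult_left_mono power_mono) auto
    also have "\<dots> = D"
      using l0 by (simp add: D_def power2_eq_square)
    finally have "\<theta> / (2 * ?l) * (norm (magnetisation N s))\<^sup>2
        \<le> D + (- (?l * (norm (\<theta> *\<^sub>R u))\<^sup>2 / (2 * \<theta>)) + (\<theta> *\<^sub>R u) \<bullet> magnetisation N s)"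
      using square_expansion[OF l0, of "magnetisation N s" "\<theta> *\<^sub>R u"] \<theta>_pos
      by (simp only: scaleR_scaleR) simp
    then have "exp (\<theta> / (2 * ?l) * (norm (magnetisation N s))\<^sup>2) \<le> f u s"
      by (simp add: f_def flip: exp_add)
    \<comment> \<open>The net point \<open>u\<close> depends on the configuration. Summing over the
      whole net removes this dependence and costs only \<open>ln (card T) / N\<close> in the
      pressure.\<close>
    also have "\<dots> \<le> (\<Sum>u\<in>T. f u s)"
      using T(1) u(1) by (intro member_le_sum) (auto simp: f_def)
    finally show "exp (\<theta> / (2 * ?l) * (norm (magnetisation N s))\<^sup>2) \<le> (\<Sum>u\<in>T. f u s)" .
  qed
  also have "\<dots> = (\<Sum>u\<in>T. \<integral>s. f u s \<partial>config N)"
    unfolding f_def by (intro Bochner_Integration.integral_sum integrable_mult_right integral_exp_inner_magnetisation(2))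
  also have "\<dots> = (\<Sum>u\<in>T. exp D * exp (real N * free_energy_at N (\<theta> *\<^sub>R u)))"
    by (intro sum.cong refl) (simp only: f_def integral_mult_right_zero exp_free_energy_at[OF N])
  also have "\<dots> \<le> (\<Sum>u\<in>T. exp D * exp (real N * M))"
    using M by (intro sum_mono) (simp add: mult_left_mono)
  also have "\<dots> = card T * exp (D + real N * M)"
    by (simp add: exp_add)
  finally have "ln (mean_field_partition N) \<le> ln (card T * exp (D + real N * M))"
    using mean_field_partition_pos[of N] by (subst ln_le_cancel_iff) (auto intro: less_le_trans)
  also have "\<dots> = ln (card T) + (D + real N * M)"
    using T(1,2) by (subst ln_mult) (auto simp: card_gt_0_iff)
  finally have "ln (mean_field_partition N) / real N \<le> (ln (card T) + (D + real N * M)) / real N"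
    by (rule divide_right_mono) simp
  also have "\<dots> = ln (card T) / real N + \<theta> * (total_weight N / real N) * \<epsilon>\<^sup>2 / 2 + M"
    using N by (simp add: D_def field_simps)
  finally show ?thesis .
qed

section \<open>Passage to the limit in the pressure\<close>

lemma total_weight_limit: "(\<lambda>N. total_weight N / real N) \<longlonglongrightarrow> EW"
  unfolding total_weight_def by (rule weights_converge_Lipschitz[OF P weights, of "\<lambda>x. x" 1]) simp

lemma free_energy_at_limit: "(\<lambda>N. free_energy_at N m) \<longlonglongrightarrow> free_energy m"
proof -
  have L: "\<bar>ln (partition_fn (x *\<^sub>R m)) - ln (partition_fn (y *\<^sub>R m))\<bar> \<le> norm m * \<bar>x - y\<bar>" for x y
    using abs_ln_partition_fn_diff_le[of "x *\<^sub>R m" "y *\<^sub>R m"] by (simp add: mult.commute flip: scaleR_diff_left)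
  have "(\<lambda>N. (\<Sum>i=1..N. ln (partition_fn (w N i *\<^sub>R m))) / real N) \<longlonglongrightarrow> (\<integral>x. ln (partition_fn (x *\<^sub>R m)) \<partial>P)"
    by (rule weights_converge_Lipschitz[OF P weights L])
  then show ?thesis
    unfolding free_energy_at_def free_energy_def using \<theta>_pos
    by (intro tendsto_intros total_weight_limit) auto
qed

text \<open>The ratio of the sum of squared weights to the total weight tends to E[W^2] / E[W], so
  the error stays bounded while it is divided by N.\<close>

lemma pressure_error_limit: "(\<lambda>N. pressure_error N / real N) \<longlonglongrightarrow> 0"
proof -
  have S: "(\<lambda>N. (\<Sum>i=1..N. (w N i)\<^sup>2) / real N) \<longlonglongrightarrow> (\<integral>x. x\<^sup>2 \<partial>P)"
    using weights by (simp add: weights_converge_def)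
  have "(\<lambda>N. ((\<Sum>i=1..N. (w N i)\<^sup>2) / real N) / (total_weight N / real N)) \<longlonglongrightarrow> (\<integral>x. x\<^sup>2 \<partial>P) / EW"
    using EW_pos by (intro tendsto_divide S total_weight_limit) auto
  moreover have "((\<Sum>i=1..N. (w N i)\<^sup>2) / real N) / (total_weight N / real N) = (\<Sum>i=1..N. (w N i)\<^sup>2) / total_weight N" for N
    by (cases "N = 0") auto
  ultimately have R: "(\<lambda>N. (\<Sum>i=1..N. (w N i)\<^sup>2) / total_weight N) \<longlonglongrightarrow> (\<integral>x. x\<^sup>2 \<partial>P) / EW"
    by (simp only:)
  have "(\<lambda>N. pressure_error N * (1 / real N)) \<longlonglongrightarrow>
      (((c + \<theta>)\<^sup>2 + 1) * ((\<integral>x. x\<^sup>2 \<partial>P) / EW)\<^sup>2 + (c + \<theta> + 1) * ((\<integral>x. x\<^sup>2 \<partial>P) / EW)) * 0"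
    unfolding pressure_error_def by (intro tendsto_intros R lim_1_over_n)
  then show ?thesis by simp
qed

text \<open>The net is fixed before N grows, so pointwise convergence of
  \<open>free_energy_at\<close> at finitely many tilts is enough. These tilts have norm at most
  \<theta>, which is why \<open>M\<close> need only bound the free energy on that ball.\<close>

lemma mean_field_partition_eventually_le:
  assumes M: "\<And>m. m \<in> cball 0 \<theta> \<Longrightarrow> free_energy m \<le> M" and e: "0 < e"
  shows "\<forall>\<^sub>F N in sequentially. ln (mean_field_partition N) / real N < M + e"
proof -
  \<comment> \<open>Makes the limiting cost \<open>\<theta> * EW * \<epsilon>\<^sup>2 / 2\<close> of
    the net equal to \<open>e / 4\<close>. The cardinality term may then use the slack up to
    \<open>e / 2\<close>, and another \<open>e / 4\<close> is reserved for the convergence at the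
    net points.\<close>
  define \<epsilon> where "\<epsilon> = sqrt (e / (2 * \<theta> * EW))"
  have \<epsilon>: "0 < \<epsilon>" using e \<theta>_pos EW_pos by (simp add: \<epsilon>_def)
  have "compact (cball (0::'a) 1)" by simp
  then obtain T where T: "finite T" "T \<subseteq> cball (0::'a) 1" "cball 0 1 \<subseteq> (\<Union>u\<in>T. ball u \<epsilon>)"
    using seq_compact_imp_totally_bounded[OF compact_imp_seq_compact, rule_format, OF _ \<epsilon>] by metis
  have T0: "T \<noteq> {}" using T(3) by force
  have "\<forall>\<^sub>F N in sequentially. \<forall>u\<in>T. free_energy_at N (\<theta> *\<^sub>R u) < M + e / 4"
    unfolding eventually_ball_finite_distrib[OF T(1)]
  proof
    fix u assume "u \<in> T"
    then have "norm (\<theta> *\<^sub>R u) \<le> \<theta>" using T(2) \<theta>_pos by (auto simp: mult_left_le)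
    then have "free_energy (\<theta> *\<^sub>R u) < M + e / 4" using M[of "\<theta> *\<^sub>R u"] e by simp
    then show "\<forall>\<^sub>F N in sequentially. free_energy_at N (\<theta> *\<^sub>R u) < M + e / 4"
      by (rule order_tendstoD(2)[OF free_energy_at_limit])
  qed
  moreover have "\<forall>\<^sub>F N in sequentially. ln (card T) / real N + \<theta> * (total_weight N / real N) * \<epsilon>\<^sup>2 / 2 < e / 2"
  proof (rule order_tendstoD(2))
    have "(\<lambda>N. ln (card T) * (1 / real N) + \<theta> * (total_weight N / real N) * \<epsilon>\<^sup>2 / 2)
        \<longlonglongrightarrow> ln (card T) * 0 + \<theta> * EW * \<epsilon>\<^sup>2 / 2"
      by (intro tendsto_intros total_weight_limit lim_1_over_n) auto
    then show "(\<lambda>N. ln (card T) / real N + \<theta> * (total_weight N / real N) * \<epsilon>\<^sup>2 / 2) \<longlonglongrightarrow> \<theta> * EW * \<epsilon>\<^sup>2 / 2"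
      by simp
    have "\<epsilon>\<^sup>2 = e / (2 * \<theta> * EW)" using e \<theta>_pos EW_pos by (simp add: \<epsilon>_def)
    then show "\<theta> * EW * \<epsilon>\<^sup>2 / 2 < e / 2"
      using e \<theta>_pos EW_pos by simp
  qed
  ultimately show ?thesis
    using eventually_gt_at_top[of 0]
  proof eventually_elim
    case (elim N)
    have "ln (mean_field_partition N) / real N
        \<le> ln (card T) / real N + \<theta> * (total_weight N / real N) * \<epsilon>\<^sup>2 / 2 + (M + e / 4)"
      using elim(1) by (intro mean_field_partition_upper[OF elim(3) \<epsilon> T(1) T0 T(3)]) (auto intro: less_imp_le)
    with elim(2) e show ?case by linarith
  qed
qed

text \<open>Compactness only provides a maximiser over the ball of radius \<theta>. That it is a
  global one follows from the pressure itself: every tilt gives an asymptotic lower bound, and the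
  maximum over the ball is an asymptotic upper bound.\<close>

theorem annealed_pressure_variational:
  obtains m where "\<And>m'. free_energy m' \<le> free_energy m"
    and "finite_pressure (inner_interaction c \<theta>) w \<alpha> \<longlonglongrightarrow> (c - 1) * EW / 2 + free_energy m"
proof -
  have "compact (cball (0::'a) \<theta>)" "cball (0::'a) \<theta> \<noteq> {}" using \<theta>_pos by auto
  from continuous_attains_sup[OF this free_energy_continuous]
  obtain m where m: "\<And>m'. m' \<in> cball 0 \<theta> \<Longrightarrow> free_energy m' \<le> free_energy m" by blast
  have up: "\<forall>\<^sub>F N in sequentially. ln (mean_field_partition N) / real N < free_energy m + e" if "0 < e" for e
    using m that by (intro mean_field_partition_eventually_le) auto
  have max: "free_energy m' \<le> free_energy m" for m'
  proof (rule field_le_epsilon)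
    fix e :: real assume e: "0 < e"
    have "\<forall>\<^sub>F N in sequentially. free_energy_at N m' \<le> free_energy m + e"
      using up[OF e] eventually_gt_at_top[of 0]
    proof eventually_elim
      case (elim N)
      then show ?case using mean_field_partition_lower[OF elim(2), of m'] by linarith
    qed
    then show "free_energy m' \<le> free_energy m + e"
      by (intro tendsto_upperbound[OF free_energy_at_limit]) auto
  qed
  have lim: "(\<lambda>N. ln (mean_field_partition N) / real N) \<longlonglongrightarrow> free_energy m"
  proof (rule order_tendstoI)
    fix a assume "a < free_energy m"
    from order_tendstoD(1)[OF free_energy_at_limit this] eventually_gt_at_top[of 0]
    show "\<forall>\<^sub>F N in sequentially. a < ln (mean_field_partition N) / real N"
    proof eventually_elim
      case (elim N)
      then show ?case using mean_field_partition_lower[OF elim(2), of m] by linarith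
    qed
  next
    fix a assume "free_energy m < a"
    then show "\<forall>\<^sub>F N in sequentially. ln (mean_field_partition N) / real N < a"
      using up[of "a - free_energy m"] by simp
  qed
  have "(\<lambda>N. (c - 1) * (total_weight N / real N) / 2 + ln (mean_field_partition N) / real N)
      \<longlonglongrightarrow> (c - 1) * EW / 2 + free_energy m"
    by (intro tendsto_intros total_weight_limit lim) auto
  moreover have "(\<lambda>N. finite_pressure (inner_interaction c \<theta>) w \<alpha> N
      - ((c - 1) * (total_weight N / real N) / 2 + ln (mean_field_partition N) / real N)) \<longlonglongrightarrow> 0"
  proof (rule Lim_null_comparison[OF _ pressure_error_limit])
    show "\<forall>\<^sub>F N in sequentially. norm (finite_pressure (inner_interaction c \<theta>) w \<alpha> N
      - ((c - 1) * (total_weight N / real N) / 2 + ln (mean_field_partition N) / real N)) \<le> pressure_error N / real N"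
      using eventually_gt_at_top[of 0]
    proof eventually_elim
      case (elim N)
      then show ?case
        using finite_pressure_mean_field[OF elim] by (simp add: add_divide_distrib)
    qed
  qed
  ultimately have "finite_pressure (inner_interaction c \<theta>) w \<alpha> \<longlonglongrightarrow> (c - 1) * EW / 2 + free_energy m"
    using tendsto_add by fastforce
  with max that show thesis by blast
qed

end

section \<open>The projection of the ball to its axis\<close>

text \<open>For a point with axial coordinate x at distance r from the axis, t = x / sqrt (x^2 +
  r^2) is the axial coordinate of its projection to the sphere. The inverse is x = r t / sqrt (1 -
  t^2), with derivative r / sqrt (1 - t^2)^3.\<close>

lemma polar_substitution:
  fixes r :: real
  assumes r: "0 < r" and A [measurable]: "A \<in> sets borel"
  shows "(\<integral>\<^sup>+x. indicator A (x / sqrt (x\<^sup>2 + r\<^sup>2)) * indicator {x. x\<^sup>2 + r\<^sup>2 < 1} x \<partial>lborel)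
    = (\<integral>\<^sup>+t. indicator A t * ennreal (r / sqrt (1 - t\<^sup>2) ^ 3) * indicator {t. t\<^sup>2 + r\<^sup>2 \<le> 1} t \<partial>lborel)"
proof (cases "r < 1")
  case True
  define b where "b = sqrt (1 - r\<^sup>2)"
  have r2: "r\<^sup>2 < 1" using r True by (simp add: power_less_one_iff abs_square_less_1)
  then have b: "0 < b" "b\<^sup>2 + r\<^sup>2 = 1" by (auto simp: b_def)
  define F :: "real \<Rightarrow> real" where "F x = indicator A (x / sqrt (x\<^sup>2 + r\<^sup>2))" for x
  define g where "g t = r * t / sqrt (1 - t\<^sup>2)" for t
  define g' where "g' t = r / sqrt (1 - t\<^sup>2) ^ 3" for t
  have rb: "sqrt (1 - b\<^sup>2) = r" using b(2) r by (simp add: real_sqrt_unique)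
  \<comment> \<open>The ends of the chord at distance r already lie on the unit sphere, where the
    projection is the identity. Hence x and t range over the same interval.\<close>
  have gb: "g b = b" "g (- b) = - b" using r by (simp_all add: g_def rb)
  have in_b: "x\<^sup>2 + r\<^sup>2 \<le> 1 \<longleftrightarrow> x \<in> {- b..b}" for x
  proof -
    have "x\<^sup>2 + r\<^sup>2 \<le> 1 \<longleftrightarrow> x\<^sup>2 \<le> b\<^sup>2" using b(2) by linarith
    also have "\<dots> \<longleftrightarrow> \<bar>x\<bar> \<le> b" using b(1) by (simp add: abs_le_square_iff[symmetric])
    finally show ?thesis by auto
  qed
  have s: "0 < 1 - t\<^sup>2" if "t \<in> {- b..b}" for t
    using in_b[of t] that r by (smt (verit) zero_less_power)
  have "(\<integral>\<^sup>+x. indicator A (x / sqrt (x\<^sup>2 + r\<^sup>2)) * indicator {x. x\<^sup>2 + r\<^sup>2 < 1} x \<partial>lborel)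
      = (\<integral>\<^sup>+x. ennreal (F x * indicator {g (- b)..g b} x) \<partial>lborel)"
  \<comment> \<open>The ball is open but the substitution rule runs over a closed interval; the two
    integrands differ at most at the end points.\<close>
  proof (rule nn_integral_cong_AE)
    have "AE x in lborel. x \<noteq> b" "AE x in lborel. x \<noteq> - b"
      by (rule AE_lborel_singleton)+
    then show "AE x in lborel. indicator A (x / sqrt (x\<^sup>2 + r\<^sup>2)) * indicator {x. x\<^sup>2 + r\<^sup>2 < 1} x
        = ennreal (F x * indicator {g (- b)..g b} x)"
    proof eventually_elim
      case (elim x)
      have "x\<^sup>2 + r\<^sup>2 \<noteq> 1"
      proof
        assume "x\<^sup>2 + r\<^sup>2 = 1"
        then have "x\<^sup>2 = b\<^sup>2" using b(2) by linarith
        then show False using elim by (simp add: power2_eq_iff)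
      qed
      then have "x\<^sup>2 + r\<^sup>2 < 1 \<longleftrightarrow> x \<in> {- b..b}" unfolding in_b[symmetric] by linarith
      then show ?case unfolding gb F_def
        by (auto simp: indicator_def)
    qed
  qed
  also have "\<dots> = (\<integral>\<^sup>+t. ennreal (F (g t) * g' t * indicator {- b..b} t) \<partial>lborel)"
  proof (rule nn_integral_substitution)
    show "set_borel_measurable borel {g (- b)..g b} F"
      unfolding set_borel_measurable_def F_def by measurable
    show "continuous_on {- b..b} g'"
      unfolding g'_def using s by (intro continuous_intros) fastforce
    show "- b \<le> b" using b by simp
    fix t assume t: "t \<in> {- b..b}"
    show "0 \<le> g' t" using s[OF t] r by (simp add: g'_def)
    define u where "u = sqrt (1 - t\<^sup>2)"
    have u: "0 < u" "u * u = 1 - t\<^sup>2" using s[OF t] by (auto simp: u_def)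
    have "(g has_real_derivative (r * u - r * t * ((0 - 2 * t) * (inverse u / 2))) / (u * u)) (at t)"
      unfolding g_def[abs_def]
      by (rule derivative_eq_intros refl | use s[OF t] u in \<open>simp add: u_def[symmetric]\<close>)+
    moreover have "(r * u - r * t * ((0 - 2 * t) * (inverse u / 2))) / (u * u) = g' t"
    proof -
      have "(r * u - r * t * ((0 - 2 * t) * (inverse u / 2))) = r * (u * u + t\<^sup>2) / u"
        using u(1) by (simp add: field_simps power2_eq_square)
      also have "u * u + t\<^sup>2 = 1" using u(2) by simp
      finally show ?thesis
        using u(1) by (simp add: g'_def u_def[symmetric] power3_eq_cube)
    qed
    ultimately show "(g has_real_derivative g' t) (at t)" by simp
  qed
  also have "\<dots> = (\<integral>\<^sup>+t. indicator A t * ennreal (r / sqrt (1 - t\<^sup>2) ^ 3) * indicator {t. t\<^sup>2 + r\<^sup>2 \<le> 1} t \<partial>lborel)"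
  proof (rule nn_integral_cong)
    fix t
    show "ennreal (F (g t) * g' t * indicator {- b..b} t)
        = indicator A t * ennreal (r / sqrt (1 - t\<^sup>2) ^ 3) * indicator {t. t\<^sup>2 + r\<^sup>2 \<le> 1} t"
    proof (cases "t \<in> {- b..b}")
      case t: True
      define u where "u = sqrt (1 - t\<^sup>2)"
      have u: "0 < u" "u\<^sup>2 = 1 - t\<^sup>2" using s[OF t] by (auto simp: u_def)
      have "(g t)\<^sup>2 + r\<^sup>2 = r\<^sup>2 * (t\<^sup>2 + u\<^sup>2) / u\<^sup>2"
        using u(1) by (simp add: g_def u_def[symmetric] power_divide power_mult_distrib field_simps)
      also have "\<dots> = (r / u)\<^sup>2"
        using u(2) by (simp add: power_divide)
      finally have "(g t)\<^sup>2 + r\<^sup>2 = (r / u)\<^sup>2" .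
      then have "sqrt ((g t)\<^sup>2 + r\<^sup>2) = r / u" using u r by simp
      then have "g t / sqrt ((g t)\<^sup>2 + r\<^sup>2) = t"
        using u r by (simp add: g_def u_def[symmetric])
      then have "F (g t) = indicator A t" by (simp add: F_def)
      then show ?thesis using t in_b[of t] by (auto simp: g'_def indicator_def)
    next
      case False
      then show ?thesis using in_b[of t] by (auto simp: indicator_def)
    qed
  qed
  finally show ?thesis .
next
  case False
  then have r1: "1 \<le> r\<^sup>2" by simp
  have "(\<integral>\<^sup>+x. indicator A (x / sqrt (x\<^sup>2 + r\<^sup>2)) * indicator {x. x\<^sup>2 + r\<^sup>2 < 1} x \<partial>lborel) = (\<integral>\<^sup>+x. 0 \<partial>(lborel :: real measure))"
  proof (rule nn_integral_cong)
    fix x :: real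
    have "\<not> x\<^sup>2 + r\<^sup>2 < 1" using r1 zero_le_power2[of x] by linarith
    then show "indicator A (x / sqrt (x\<^sup>2 + r\<^sup>2)) * indicator {x. x\<^sup>2 + r\<^sup>2 < 1} x = (0::ennreal)" by simp
  qed
  also have "\<dots> = (\<integral>\<^sup>+t. indicator A t * ennreal (r / sqrt (1 - t\<^sup>2) ^ 3) * indicator {t. t\<^sup>2 + r\<^sup>2 \<le> 1} t \<partial>lborel)"
  proof (rule nn_integral_cong_AE)
    \<comment> \<open>For r = 1 the right-hand integrand can be non-zero at the single point t =
      0.\<close>
    have "AE t in lborel. t \<noteq> (0::real)" by (rule AE_lborel_singleton)
    then show "AE t in lborel. 0 = indicator A t * ennreal (r / sqrt (1 - t\<^sup>2) ^ 3) * indicator {t. t\<^sup>2 + r\<^sup>2 \<le> 1} t"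
    proof eventually_elim
      case (elim t)
      then have "0 < t\<^sup>2" by simp
      then have "\<not> t\<^sup>2 + r\<^sup>2 \<le> 1" using r1 by linarith
      then show ?case by simp
    qed
  qed
  finally show ?thesis .
qed

text \<open>Layer-cake formula: the integral equals that of \<nu>{u < \<rho> \<le> s} = V s^q - V
  u^q over u in [0, s], so the volumes of balls determine it, and integrating gives the factor q /
  (q + 1).\<close>

lemma nn_integral_norm_layers:
  fixes \<rho> :: "'b \<Rightarrow> real"
  assumes sf: "sigma_finite_measure \<nu>" and [measurable]: "\<rho> \<in> borel_measurable \<nu>"
    and nonneg: "\<And>y. y \<in> space \<nu> \<Longrightarrow> 0 \<le> \<rho> y"
    and vol: "\<And>r. 0 < r \<Longrightarrow> emeasure \<nu> {y \<in> space \<nu>. \<rho> y \<le> r} = ennreal (V * r ^ q)"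
    and V: "0 \<le> V" and s: "0 < s"
  shows "(\<integral>\<^sup>+y. ennreal (\<rho> y) * indicator {y. \<rho> y \<le> s} y \<partial>\<nu>) = ennreal (V * (real q / (real q + 1)) * s ^ (q + 1))"
proof -
  interpret \<nu>: sigma_finite_measure \<nu> by (rule sf)
  interpret pair_sigma_finite lborel \<nu> by standard
  define F where "F u = V * s ^ q * u - V * u ^ (q + 1) / (real q + 1)" for u
  have "(\<integral>\<^sup>+y. ennreal (\<rho> y) * indicator {y. \<rho> y \<le> s} y \<partial>\<nu>)
      = (\<integral>\<^sup>+y. (\<integral>\<^sup>+u. indicator {0..s} u * (if u < \<rho> y \<and> \<rho> y \<le> s then 1 else 0) \<partial>lborel) \<partial>\<nu>)"
  proof (rule nn_integral_cong)
    fix y assume y: "y \<in> space \<nu>"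
    show "ennreal (\<rho> y) * indicator {y. \<rho> y \<le> s} y
        = (\<integral>\<^sup>+u. indicator {0..s} u * (if u < \<rho> y \<and> \<rho> y \<le> s then 1 else 0) \<partial>lborel)"
    proof (cases "\<rho> y \<le> s")
      case True
      then have "(\<integral>\<^sup>+u. indicator {0..s} u * (if u < \<rho> y \<and> \<rho> y \<le> s then 1 else 0) \<partial>lborel)
          = (\<integral>\<^sup>+u. indicator {0..<\<rho> y} u \<partial>lborel)"
        by (intro nn_integral_cong) (auto simp: indicator_def)
      then show ?thesis using True nonneg[OF y] by simp
    qed simp
  qed
  also have "\<dots> = (\<integral>\<^sup>+u. (\<integral>\<^sup>+y. indicator {0..s} u * (if u < \<rho> y \<and> \<rho> y \<le> s then 1 else 0) \<partial>\<nu>) \<partial>lborel)"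
    by (rule Fubini') measurable
  also have "\<dots> = (\<integral>\<^sup>+u. ennreal (V * s ^ q - V * u ^ q) * indicator {0..s} u \<partial>lborel)"
  proof (rule nn_integral_cong_AE)
    \<comment> \<open>The volumes are given for positive radii only, so u = 0 is set aside as a null
      set.\<close>
    have "AE u in lborel. u \<noteq> (0::real)" by (rule AE_lborel_singleton)
    then show "AE u in lborel. (\<integral>\<^sup>+y. indicator {0..s} u * (if u < \<rho> y \<and> \<rho> y \<le> s then 1 else 0) \<partial>\<nu>)
        = ennreal (V * s ^ q - V * u ^ q) * indicator {0..s} u"
    proof eventually_elim
      case (elim u)
      show ?case
      proof (cases "u \<in> {0..s}")
        case True
        with elim have u: "0 < u" "u \<le> s" by auto
        have "(\<integral>\<^sup>+y. indicator {0..s} u * (if u < \<rho> y \<and> \<rho> y \<le> s then 1 else 0) \<partial>\<nu>)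
            = (\<integral>\<^sup>+y. indicator ({y \<in> space \<nu>. \<rho> y \<le> s} - {y \<in> space \<nu>. \<rho> y \<le> u}) y \<partial>\<nu>)"
          using True by (intro nn_integral_cong) (auto simp: indicator_def)
        also have "\<dots> = emeasure \<nu> ({y \<in> space \<nu>. \<rho> y \<le> s} - {y \<in> space \<nu>. \<rho> y \<le> u})"
          by (rule nn_integral_indicator) measurable
        also have "\<dots> = emeasure \<nu> {y \<in> space \<nu>. \<rho> y \<le> s} - emeasure \<nu> {y \<in> space \<nu>. \<rho> y \<le> u}"
          using u vol[of u] by (intro emeasure_Diff) auto
        also have "\<dots> = ennreal (V * s ^ q - V * u ^ q)"
          using u s V by (simp add: vol ennreal_minus)
        finally show ?thesis using True by simp
      qed simp
    qed
  qed
  also have "\<dots> = ennreal (F s - F 0)"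
  proof (rule nn_integral_FTC_Icc)
    fix u assume u: "u \<in> {0..s}"
    have "real q + 1 \<noteq> 0" by linarith
    then show "(F has_real_derivative V * s ^ q - V * u ^ q) (at u)"
      unfolding F_def[abs_def]
      by - (rule derivative_eq_intros refl | assumption | simp add: add.commute[of 1])+
    show "0 \<le> V * s ^ q - V * u ^ q"
      using u V by (simp add: mult_left_mono power_mono)
  qed (use s in auto)
  also have "F s - F 0 = V * (real q / (real q + 1)) * s ^ (q + 1)"
    by (simp add: F_def field_simps)
  finally show ?thesis .
qed

text \<open>The power \<open>q + 1\<close> comes from the transversal integral and the power 3 from
  the derivative of the substitution. Together they leave (1 - t^2) to the power (q + 1) / 2 - 3 / 2
  = q / 2 - 1.\<close>

lemma powr_sqrt_quotient:
  fixes t :: real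
  assumes "- 1 < t" "t < 1"
  shows "sqrt (1 - t\<^sup>2) ^ (q + 1) / sqrt (1 - t\<^sup>2) ^ 3 = (1 - t) powr (real q / 2 - 1) * (1 + t) powr (real q / 2 - 1)"
proof -
  define x where "x = 1 - t\<^sup>2"
  have xt: "x = (1 - t) * (1 + t)" by (simp add: x_def power2_eq_square algebra_simps)
  then have x: "0 < x" using assms by simp
  have p: "sqrt x ^ k = x powr (real k / 2)" for k
    using x by (simp add: powr_half_sqrt[symmetric] powr_realpow[symmetric] powr_powr mult.commute)
  have "sqrt x ^ (q + 1) / sqrt x ^ 3 = x powr (real (q + 1) / 2 - real 3 / 2)"
    unfolding p powr_diff ..
  also have "real (q + 1) / 2 - real 3 / 2 = real q / 2 - 1" by (simp add: field_simps)
  also have "x powr (real q / 2 - 1) = (1 - t) powr (real q / 2 - 1) * (1 + t) powr (real q / 2 - 1)"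
    unfolding xt using assms by (simp add: powr_mult)
  finally show ?thesis by (simp only: x_def)
qed

text \<open>For a fixed transversal radius \<open>\<rho>\<close> the projection \<open>t = x / sqrt (x\<^sup>2 + \<rho>\<^sup>2)\<close> serves as the
  coordinate on the axis; afterwards the transversal integral only involves ball volumes.\<close>

lemma nn_integral_radial_projection:
  fixes \<rho> :: "'b \<Rightarrow> real"
  assumes sf: "sigma_finite_measure \<nu>" and meas [measurable]: "\<rho> \<in> borel_measurable \<nu>"
    and nonneg: "\<And>y. y \<in> space \<nu> \<Longrightarrow> 0 \<le> \<rho> y"
    and vol: "\<And>r. 0 < r \<Longrightarrow> emeasure \<nu> {y \<in> space \<nu>. \<rho> y \<le> r} = ennreal (V * r ^ q)"
    and V: "0 \<le> V" and q: "0 < q" and A [measurable]: "A \<in> sets borel"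
  shows "(\<integral>\<^sup>+y. (\<integral>\<^sup>+x. indicator A (x / sqrt (x\<^sup>2 + (\<rho> y)\<^sup>2)) * indicator {x. x\<^sup>2 + (\<rho> y)\<^sup>2 < 1} x \<partial>lborel) \<partial>\<nu>)
    = ennreal (V * (real q / (real q + 1))) *
      (\<integral>\<^sup>+t. ennreal ((1 - t) powr (real q / 2 - 1) * (1 + t) powr (real q / 2 - 1) * indicator {-1..1} t) * indicator A t \<partial>lborel)"
proof -
  interpret \<nu>: sigma_finite_measure \<nu> by (rule sf)
  interpret pair_sigma_finite lborel \<nu> by standard
  define K where "K = V * (real q / (real q + 1))"
  have K: "0 \<le> K" using V by (simp add: K_def)
  have "emeasure \<nu> {y \<in> space \<nu>. \<rho> y \<le> 0} \<le> ennreal e" if "0 < e" for e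
  proof -
    \<comment> \<open>The axis lies in every ball {\<rho> \<le> r}, whose volume is V r^q = V e / (V
      + 1) < e for this radius. The denominator \<open>V + 1\<close> also covers V = 0.\<close>
    define r where "r = root q (e / (V + 1))"
    have r: "0 < r" "r ^ q = e / (V + 1)"
      using that V q by (auto simp: r_def real_root_gt_zero)
    have "emeasure \<nu> {y \<in> space \<nu>. \<rho> y \<le> 0} \<le> emeasure \<nu> {y \<in> space \<nu>. \<rho> y \<le> r}"
      using r(1) by (intro emeasure_mono) auto
    also have "\<dots> = ennreal (V * (e / (V + 1)))" using vol[OF r(1)] by (simp only: r(2))
    also have "\<dots> \<le> ennreal e"
      using V that by (intro ennreal_leI) (simp add: field_simps)
    finally show ?thesis .
  qed
  then have "emeasure \<nu> {y \<in> space \<nu>. \<rho> y \<le> 0} \<le> 0"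
    by - (rule ennreal_le_epsilon, simp)
  then have "emeasure \<nu> {y \<in> space \<nu>. \<rho> y \<le> 0} = 0" by simp
  then have "{y \<in> space \<nu>. \<rho> y \<le> 0} \<in> null_sets \<nu>" by (intro null_setsI) measurable
  then have "AE y in \<nu>. y \<notin> {y \<in> space \<nu>. \<rho> y \<le> 0}" by (rule AE_not_in)
  then have pos: "AE y in \<nu>. 0 < \<rho> y"
    using AE_space by eventually_elim auto
  have "(\<integral>\<^sup>+y. (\<integral>\<^sup>+x. indicator A (x / sqrt (x\<^sup>2 + (\<rho> y)\<^sup>2)) * indicator {x. x\<^sup>2 + (\<rho> y)\<^sup>2 < 1} x \<partial>lborel) \<partial>\<nu>)
      = (\<integral>\<^sup>+y. (\<integral>\<^sup>+t. indicator A t * ennreal (\<rho> y / sqrt (1 - t\<^sup>2) ^ 3) * (if t\<^sup>2 + (\<rho> y)\<^sup>2 \<le> 1 then 1 else 0) \<partial>lborel) \<partial>\<nu>)"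
  proof (rule nn_integral_cong_AE)
    show "AE y in \<nu>. (\<integral>\<^sup>+x. indicator A (x / sqrt (x\<^sup>2 + (\<rho> y)\<^sup>2)) * indicator {x. x\<^sup>2 + (\<rho> y)\<^sup>2 < 1} x \<partial>lborel)
        = (\<integral>\<^sup>+t. indicator A t * ennreal (\<rho> y / sqrt (1 - t\<^sup>2) ^ 3) * (if t\<^sup>2 + (\<rho> y)\<^sup>2 \<le> 1 then 1 else 0) \<partial>lborel)"
      using pos
    proof eventually_elim
      case (elim y)
      show ?case
        unfolding polar_substitution[OF elim A] by (intro nn_integral_cong) (auto simp: indicator_def)
    qed
  qed
  also have "\<dots> = (\<integral>\<^sup>+t. (\<integral>\<^sup>+y. indicator A t * ennreal (\<rho> y / sqrt (1 - t\<^sup>2) ^ 3) * (if t\<^sup>2 + (\<rho> y)\<^sup>2 \<le> 1 then 1 else 0) \<partial>\<nu>) \<partial>lborel)"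
    by (rule Fubini') measurable
  also have "\<dots> = (\<integral>\<^sup>+t. ennreal K * (ennreal ((1 - t) powr (real q / 2 - 1) * (1 + t) powr (real q / 2 - 1) * indicator {-1..1} t) * indicator A t) \<partial>lborel)"
  proof (rule nn_integral_cong_AE)
    have "AE t in lborel. t \<noteq> (1::real)" "AE t in lborel. t \<noteq> (- 1::real)"
      by (rule AE_lborel_singleton)+
    then show "AE t in lborel. (\<integral>\<^sup>+y. indicator A t * ennreal (\<rho> y / sqrt (1 - t\<^sup>2) ^ 3) * (if t\<^sup>2 + (\<rho> y)\<^sup>2 \<le> 1 then 1 else 0) \<partial>\<nu>)
        = ennreal K * (ennreal ((1 - t) powr (real q / 2 - 1) * (1 + t) powr (real q / 2 - 1) * indicator {-1..1} t) * indicator A t)"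
    proof eventually_elim
      case (elim t)
      show ?case
      proof (cases "t \<in> {-1..1}")
        case True
        with elim have t: "- 1 < t" "t < 1" by auto
        define s where "s = sqrt (1 - t\<^sup>2)"
        have "t\<^sup>2 < 1" using t by (simp add: abs_square_less_1 abs_less_iff)
        then have s: "0 < s" "s\<^sup>2 = 1 - t\<^sup>2" by (auto simp: s_def)
        have le: "t\<^sup>2 + (\<rho> y)\<^sup>2 \<le> 1 \<longleftrightarrow> \<rho> y \<le> s" if "y \<in> space \<nu>" for y
        proof -
          have "t\<^sup>2 + (\<rho> y)\<^sup>2 \<le> 1 \<longleftrightarrow> (\<rho> y)\<^sup>2 \<le> s\<^sup>2" using s(2) by linarith
          also have "\<dots> \<longleftrightarrow> \<rho> y \<le> s"
            using nonneg[OF that] s(1) by (simp add: abs_le_square_iff[symmetric])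
          finally show ?thesis .
        qed
        have "(\<integral>\<^sup>+y. indicator A t * ennreal (\<rho> y / s ^ 3) * (if t\<^sup>2 + (\<rho> y)\<^sup>2 \<le> 1 then 1 else 0) \<partial>\<nu>)
            = (\<integral>\<^sup>+y. (indicator A t * ennreal (1 / s ^ 3)) * (ennreal (\<rho> y) * indicator {y. \<rho> y \<le> s} y) \<partial>\<nu>)"
        proof (rule nn_integral_cong)
          fix y assume y: "y \<in> space \<nu>"
          have "ennreal (\<rho> y / s ^ 3) = ennreal (1 / s ^ 3) * ennreal (\<rho> y)"
            using nonneg[OF y] s(1) by (subst ennreal_mult[symmetric]) auto
          then show "indicator A t * ennreal (\<rho> y / s ^ 3) * (if t\<^sup>2 + (\<rho> y)\<^sup>2 \<le> 1 then 1 else 0)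
              = (indicator A t * ennreal (1 / s ^ 3)) * (ennreal (\<rho> y) * indicator {y. \<rho> y \<le> s} y)"
            by (simp add: le[OF y] indicator_def mult.assoc)
        qed
        also have "\<dots> = (indicator A t * ennreal (1 / s ^ 3)) * ennreal (K * s ^ (q + 1))"
        proof -
          have "(\<integral>\<^sup>+y. ennreal (\<rho> y) * indicator {y. \<rho> y \<le> s} y \<partial>\<nu>) = ennreal (K * s ^ (q + 1))"
            unfolding K_def by (rule nn_integral_norm_layers[OF sf meas nonneg vol V s(1)])
          then show ?thesis by (subst nn_integral_cmult) simp_all
        qed
        also have "\<dots> = indicator A t * ennreal (K * (s ^ (q + 1) / s ^ 3))"
          using s(1) K by (simp add: mult.assoc flip: ennreal_mult)
        also have "s ^ (q + 1) / s ^ 3 = (1 - t) powr (real q / 2 - 1) * (1 + t) powr (real q / 2 - 1)"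
          unfolding s_def by (rule powr_sqrt_quotient[OF t])
        finally show ?thesis
          unfolding s_def[symmetric] using True K by (simp add: ennreal_mult' mult_ac)
      next
        case False
        then have "\<not> t\<^sup>2 \<le> 1" by (auto simp: abs_square_le_1)
        then have "\<not> t\<^sup>2 + (\<rho> y)\<^sup>2 \<le> 1" for y using zero_le_power2[of "\<rho> y"] by linarith
        then show ?thesis using False by simp
      qed
    qed
  qed
  also have "\<dots> = ennreal K * (\<integral>\<^sup>+t. ennreal ((1 - t) powr (real q / 2 - 1) * (1 + t) powr (real q / 2 - 1) * indicator {-1..1} t) * indicator A t \<partial>lborel)"
    by (rule nn_integral_cmult) measurable
  finally show ?thesis by (simp only: K_def)
qed

section \<open>The law of a coordinate on the sphere\<close>

text \<open>Kept without its normalising constant: the laws from the sphere and from the Beta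
  distribution are both shown to be multiples of this weight, and total mass 1 then forces the
  multiples to agree.\<close>

definition axis_weight :: "nat \<Rightarrow> real \<Rightarrow> real" where
  "axis_weight q t = (1 - t) powr (real q / 2 - 1) * (1 + t) powr (real q / 2 - 1) * indicator {-1..1} t"

lemma axis_weight_nonneg: "0 \<le> axis_weight q t"
  by (simp add: axis_weight_def)

lemma axis_weight_measurable [measurable]: "axis_weight q \<in> borel_measurable borel"
  unfolding axis_weight_def[abs_def] by measurable

lemma axis_weight_minus: "axis_weight q (- t) = axis_weight q t"
  by (auto simp: axis_weight_def indicator_def)

text \<open>The cone measure turns probabilities on the sphere into Lebesgue integrals over the
  ball. Only the origin, which \<open>sgn\<close> does not send to the sphere, has to be discarded,
  and it is a null set.\<close>

lemma emeasure_distr_uniform_sphere: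
  fixes f :: "'a::euclidean_space \<Rightarrow> real"
  assumes f [measurable]: "f \<in> borel_measurable borel" and A [measurable]: "A \<in> sets borel"
  shows "emeasure (distr uniform_sphere borel f) A
    = (\<integral>\<^sup>+x. indicator A (f (sgn x)) * indicator (ball 0 1) x \<partial>lborel) / emeasure lborel (ball (0::'a) 1)"
proof -
  let ?B = "f -` A \<inter> sphere 0 1"
  have fm: "f \<in> borel_measurable uniform_sphere"
    unfolding measurable_cong_sets[OF sets_uniform_sphere refl] by (rule measurable_restrict_space1) simp
  have fA: "f -` A \<in> sets borel" using measurable_sets[OF f A] by simp
  then have B: "?B \<in> sets borel" by auto
  have sB: "sgn -` ?B \<in> sets borel" using measurable_sets[OF sgn_measurable B] by simp
  have "emeasure (distr uniform_sphere borel f) A = emeasure uniform_sphere ?B"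
    using fm by (subst emeasure_distr) auto
  also have "\<dots> = emeasure (distr (uniform_measure lborel (ball 0 1)) borel sgn) ?B"
    unfolding uniform_sphere_def by (rule emeasure_restrict_space) auto
  also have "\<dots> = emeasure lborel (ball 0 1 \<inter> sgn -` ?B) / emeasure lborel (ball (0::'a) 1)"
    using B sB by (subst emeasure_distr) auto
  also have "emeasure lborel (ball 0 1 \<inter> sgn -` ?B) = (\<integral>\<^sup>+x. indicator (ball 0 1 \<inter> sgn -` ?B) x \<partial>lborel)"
    using sB by (subst nn_integral_indicator) auto
  also have "\<dots> = (\<integral>\<^sup>+x. indicator A (f (sgn x)) * indicator (ball 0 1) x \<partial>lborel)"
  proof (rule nn_integral_cong_AE)
    have "AE x in lborel. x \<noteq> (0::'a)" by (rule AE_lborel_singleton)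
    then show "AE x in lborel. indicator (ball 0 1 \<inter> sgn -` ?B) x
        = (indicator A (f (sgn x)) * indicator (ball 0 1) x :: ennreal)"
      by eventually_elim (auto simp: indicator_def norm_sgn)
  qed
  finally show ?thesis .
qed

text \<open>Lebesgue measure is a product over \<open>Basis\<close>. Integrating the coordinate
  along \<open>e\<close> first leaves the q transversal coordinates, which enter only through their
  norm \<rho>, and the balls of \<rho> have volume \<open>unit_ball_vol q * r ^ q\<close>.\<close>

lemma nn_integral_ball_axis:
  fixes e :: "'a::euclidean_space"
  assumes e: "e \<in> Basis" and dim: "DIM('a) = q + 1" and q: "0 < q" and A [measurable]: "A \<in> sets borel"
  shows "(\<integral>\<^sup>+x. indicator A (e \<bullet> sgn x) * indicator (ball (0::'a) 1) x \<partial>lborel)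
    = ennreal (unit_ball_vol q * (real q / (real q + 1))) * (\<integral>\<^sup>+t. ennreal (axis_weight q t) * indicator A t \<partial>lborel)"
proof -
  interpret product_sigma_finite "\<lambda>_::'a. lborel :: real measure" by standard
  define B where "B = (Basis :: 'a set) - {e}"
  have B: "finite B" "e \<notin> B" "Basis = insert e B" "card B = q"
    using e dim by (auto simp: B_def)
  define h :: "'a \<Rightarrow> ennreal" where "h x = indicator A (e \<bullet> sgn x) * indicator (ball 0 1) x" for x
  have [measurable]: "ball (0::'a) 1 \<in> sets borel" by simp
  have h [measurable]: "h \<in> borel_measurable borel" unfolding h_def[abs_def] by measurable
  define \<rho> where "\<rho> y = sqrt (\<Sum>b\<in>B. (y b)\<^sup>2)" for y :: "'a \<Rightarrow> real"
  have comp [measurable]: "(\<lambda>y. y b) \<in> borel_measurable (PiM B (\<lambda>_. lborel))" if "b \<in> B" for b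
    using measurable_component_singleton[OF that, of "\<lambda>_. lborel"] by simp
  have hv: "h (\<Sum>b\<in>Basis. (y(e := x)) b *\<^sub>R b)
      = indicator A (x / sqrt (x\<^sup>2 + (\<rho> y)\<^sup>2)) * indicator {x. x\<^sup>2 + (\<rho> y)\<^sup>2 < 1} x" for x y
  proof -
    define v :: 'a where "v = (\<Sum>b\<in>Basis. (y(e := x)) b *\<^sub>R b)"
    have vb: "v \<bullet> b = (y(e := x)) b" if "b \<in> Basis" for b
      unfolding v_def using that by (rule inner_sum_left_Basis)
    have "(norm v)\<^sup>2 = (\<Sum>b\<in>Basis. (v \<bullet> b) * (v \<bullet> b))"
      unfolding power2_norm_eq_inner by (rule euclidean_inner)
    also have "\<dots> = (\<Sum>b\<in>Basis. ((y(e := x)) b)\<^sup>2)"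
      using vb by (simp add: power2_eq_square)
    also have "\<dots> = x\<^sup>2 + (\<Sum>b\<in>B. ((y(e := x)) b)\<^sup>2)"
      unfolding B(3) by (subst sum.insert) (use B(1,2) in auto)
    also have "(\<Sum>b\<in>B. ((y(e := x)) b)\<^sup>2) = (\<Sum>b\<in>B. (y b)\<^sup>2)"
      using B(2) by (intro sum.cong) auto
    also have "\<dots> = (\<rho> y)\<^sup>2"
      by (simp add: \<rho>_def sum_nonneg)
    finally have n: "(norm v)\<^sup>2 = x\<^sup>2 + (\<rho> y)\<^sup>2" .
    then have n': "norm v = sqrt (x\<^sup>2 + (\<rho> y)\<^sup>2)" by (metis norm_ge_zero real_sqrt_unique)
    have "e \<bullet> sgn v = x / sqrt (x\<^sup>2 + (\<rho> y)\<^sup>2)"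
      using vb[OF e] by (simp add: sgn_div_norm n' inner_commute divide_inverse)
    moreover have "v \<in> ball 0 1 \<longleftrightarrow> x\<^sup>2 + (\<rho> y)\<^sup>2 < 1"
      by (simp add: n' real_sqrt_lt_1_iff)
    ultimately have "h v = indicator A (x / sqrt (x\<^sup>2 + (\<rho> y)\<^sup>2)) * indicator {x. x\<^sup>2 + (\<rho> y)\<^sup>2 < 1} x"
      by (simp add: h_def indicator_def)
    then show ?thesis by (simp only: v_def)
  qed
  have coords [measurable]: "(\<lambda>f. \<Sum>b\<in>Basis. f b *\<^sub>R b :: 'a) \<in> borel_measurable (PiM Basis (\<lambda>_. lborel))"
  proof (intro borel_measurable_sum borel_measurable_scaleR borel_measurable_const)
    show "(\<lambda>f. f b) \<in> borel_measurable (PiM Basis (\<lambda>_. lborel))" if "b \<in> Basis" for b :: 'a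
      using measurable_component_singleton[OF that, of "\<lambda>_. lborel"] by simp
  qed
  have "(\<integral>\<^sup>+x. h x \<partial>lborel) = (\<integral>\<^sup>+f. h (\<Sum>b\<in>Basis. f b *\<^sub>R b) \<partial>PiM Basis (\<lambda>_. lborel))"
    by (subst lborel_eq) (rule nn_integral_distr[OF coords], simp add: h)
  also have "\<dots> = (\<integral>\<^sup>+f. h (\<Sum>b\<in>Basis. f b *\<^sub>R b) \<partial>PiM (insert e B) (\<lambda>_. lborel))"
    by (simp only: B(3)[symmetric])
  also have "\<dots> = (\<integral>\<^sup>+y. (\<integral>\<^sup>+x. h (\<Sum>b\<in>Basis. (y(e := x)) b *\<^sub>R b) \<partial>lborel) \<partial>PiM B (\<lambda>_. lborel))"
    by (rule product_nn_integral_insert[OF B(1,2)]) (unfold B(3)[symmetric], measurable)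
  also have "\<dots> = (\<integral>\<^sup>+y. (\<integral>\<^sup>+x. indicator A (x / sqrt (x\<^sup>2 + (\<rho> y)\<^sup>2)) * indicator {x. x\<^sup>2 + (\<rho> y)\<^sup>2 < 1} x \<partial>lborel) \<partial>PiM B (\<lambda>_. lborel))"
    by (simp only: hv)
  also have "\<dots> = ennreal (unit_ball_vol q * (real q / (real q + 1))) * (\<integral>\<^sup>+t. ennreal (axis_weight q t) * indicator A t \<partial>lborel)"
    unfolding axis_weight_def
  proof (rule nn_integral_radial_projection)
    show "sigma_finite_measure (PiM B (\<lambda>_. lborel :: real measure))" by (rule sigma_finite[OF B(1)])
    show "\<rho> \<in> borel_measurable (PiM B (\<lambda>_. lborel))"
      unfolding \<rho>_def[abs_def] by measurable
    show "0 \<le> \<rho> y" for y by (simp add: \<rho>_def sum_nonneg)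
    show "emeasure (PiM B (\<lambda>_. lborel)) {y \<in> space (PiM B (\<lambda>_. lborel)). \<rho> y \<le> r} = ennreal (unit_ball_vol q * r ^ q)"
      if "0 < r" for r
    proof -
      have "{y \<in> space (PiM B (\<lambda>_. lborel)). \<rho> y \<le> r} = {f. sqrt (\<Sum>i\<in>B. (f i)\<^sup>2) \<le> r} \<inter> space (PiM B (\<lambda>_. lborel))"
        by (auto simp: \<rho>_def)
      then show ?thesis using emeasure_cball_aux[OF B(1) that] B(4) by simp
    qed
  qed (use q in auto)
  finally show ?thesis by (simp only: h_def)
qed

lemma uniform_sphere_axis_density:
  fixes e :: "'a::euclidean_space"
  assumes e: "e \<in> Basis" and dim: "DIM('a) = q + 1" and q: "0 < q"
  obtains C where "0 < C"
    and "distr uniform_sphere borel (\<lambda>\<sigma>. e \<bullet> \<sigma>) = density lborel (\<lambda>t. ennreal (C * axis_weight q t))"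
proof -
  define K where "K = unit_ball_vol (real q) * (real q / (real q + 1))"
  define v where "v = measure lborel (ball (0::'a) 1)"
  have v: "0 < v" unfolding v_def by (simp add: content_ball_pos)
  have K: "0 < K" using q by (simp add: K_def)
  have vol: "emeasure lborel (ball (0::'a) 1) = ennreal v"
    unfolding v_def by (rule emeasure_eq_ennreal_measure) (use emeasure_lborel_ball_finite[of "0::'a" 1] in auto)
  have "distr uniform_sphere borel (\<lambda>\<sigma>. e \<bullet> \<sigma>) = density lborel (\<lambda>t. ennreal (K / v * axis_weight q t))"
  proof (rule measure_eqI)
    fix A assume "A \<in> sets (distr uniform_sphere borel (\<lambda>\<sigma>. e \<bullet> \<sigma>))"
    then have A [measurable]: "A \<in> sets borel" by simp
    have "emeasure (distr uniform_sphere borel (\<lambda>\<sigma>. e \<bullet> \<sigma>)) A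
        = ennreal K * (\<integral>\<^sup>+t. ennreal (axis_weight q t) * indicator A t \<partial>lborel) / ennreal v"
      unfolding K_def
      by (subst emeasure_distr_uniform_sphere) (simp_all add: nn_integral_ball_axis[OF e dim q A] vol)
    also have "\<dots> = ennreal (K / v) * (\<integral>\<^sup>+t. ennreal (axis_weight q t) * indicator A t \<partial>lborel)"
      using v K by (simp add: divide_ennreal[symmetric] divide_ennreal_def mult_ac)
    also have "\<dots> = (\<integral>\<^sup>+t. ennreal (K / v) * (ennreal (axis_weight q t) * indicator A t) \<partial>lborel)"
      by (rule nn_integral_cmult[symmetric]) measurable
    also have "\<dots> = (\<integral>\<^sup>+t. ennreal (K / v * axis_weight q t) * indicator A t \<partial>lborel)"
    proof -
      have "ennreal (K / v * axis_weight q t) = ennreal (K / v) * ennreal (axis_weight q t)" for t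
        using v K by (intro ennreal_mult) (auto simp: axis_weight_nonneg)
      then show ?thesis by (simp only: mult.assoc)
    qed
    also have "\<dots> = emeasure (density lborel (\<lambda>t. ennreal (K / v * axis_weight q t))) A"
      by (rule emeasure_density[symmetric]) measurable
    finally show "emeasure (distr uniform_sphere borel (\<lambda>\<sigma>. e \<bullet> \<sigma>)) A
        = emeasure (density lborel (\<lambda>t. ennreal (K / v * axis_weight q t))) A" .
  qed simp
  with v K show thesis by (intro that[of "K / v"]) auto
qed

section \<open>The symmetric Beta law stretched to the interval from -1 to 1\<close>

lemma prob_space_beta_measure:
  assumes "0 < a" "0 < b"
  shows "prob_space (beta_measure a b)"
proof
  have B: "0 < Beta a b" using assms by (simp add: Beta_def Gamma_real_pos)
  have I: "((\<lambda>t. t powr (a - 1) * (1 - t) powr (b - 1) / Beta a b) has_integral Beta a b / Beta a b) {0..1}"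
    by (intro has_integral_divide has_integral_Beta_real assms)
  have "emeasure (beta_measure a b) (space (beta_measure a b))
      = (\<integral>\<^sup>+x. ennreal (x powr (a - 1) * (1 - x) powr (b - 1) / Beta a b) * indicator {0..1} x \<partial>lborel)"
    unfolding beta_measure_def by (subst emeasure_density) (auto simp: ennreal_mult' ennreal_indicator intro!: nn_integral_cong split: split_indicator)
  also have "\<dots> = ennreal (Beta a b / Beta a b)"
    using B by (intro nn_integral_has_integral_lebesgue'[OF _ I]) simp
  finally show "emeasure (beta_measure a b) (space (beta_measure a b)) = 1" using B by simp
qed

lemma distr_beta_measure_density:
  assumes q: "0 < q"
  obtains C where "0 < C"
    and "distr (beta_measure (real q / 2) (real q / 2)) borel (\<lambda>x. 2 * x - 1) = density lborel (\<lambda>t. ennreal (C * axis_weight q t))"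
proof -
  define b where "b = real q / 2"
  have b: "0 < b" using q by (simp add: b_def)
  have B: "0 < Beta b b" using b by (simp add: Beta_def Gamma_real_pos)
  define f where "f x = x powr (b - 1) * (1 - x) powr (b - 1) / Beta b b * indicator {0..1} x" for x :: real
  have [measurable]: "f \<in> borel_measurable borel" unfolding f_def[abs_def] by measurable
  \<comment> \<open>The first 1/2 is the Jacobian of x = (1 + t) / 2; the other two come out of the
    powers of x = (1 + t) / 2 and 1 - x = (1 - t) / 2.\<close>
  define C where "C = (1 / 2) * ((1 / 2) powr (b - 1) * (1 / 2) powr (b - 1) / Beta b b)"
  have C: "0 < C" using B by (simp add: C_def)
  have f: "1 / 2 * f (1 / 2 + 1 / 2 * t) = C * axis_weight q t" for t
  proof (cases "t \<in> {-1..1}")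
    case True
    have "(1 / 2 + 1 / 2 * t) powr (b - 1) = (1 / 2) powr (b - 1) * (1 + t) powr (b - 1)"
      using True by (subst powr_mult[symmetric]) (auto simp: field_simps)
    moreover have "(1 - (1 / 2 + 1 / 2 * t)) powr (b - 1) = (1 / 2) powr (b - 1) * (1 - t) powr (b - 1)"
      using True by (subst powr_mult[symmetric]) (auto simp: field_simps)
    ultimately show ?thesis
      using True by (simp add: f_def C_def axis_weight_def b_def[symmetric] indicator_def)
  next
    case False
    then have "1 / 2 + 1 / 2 * t \<notin> {0..1}" by auto
    then show ?thesis using False by (simp only: f_def axis_weight_def indicator_simps) simp
  qed
  have "distr (beta_measure b b) borel (\<lambda>x. 2 * x - 1) = density lborel (\<lambda>t. ennreal (C * axis_weight q t))"
  proof (rule measure_eqI)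
    fix A assume "A \<in> sets (distr (beta_measure b b) borel (\<lambda>x. 2 * x - 1))"
    then have A [measurable]: "A \<in> sets borel" by simp
    have [simp]: "sets (beta_measure b b) = sets borel" "space (beta_measure b b) = UNIV"
      by (simp_all add: beta_measure_def)
    have "emeasure (distr (beta_measure b b) borel (\<lambda>x. 2 * x - 1)) A
        = emeasure (beta_measure b b) ((\<lambda>x. 2 * x - 1) -` A)"
      by (subst emeasure_distr) (auto simp: measurable_cong_sets[of "beta_measure b b" borel])
    also have "\<dots> = (\<integral>\<^sup>+x. ennreal (f x) * indicator A (2 * x - 1) \<partial>lborel)"
      unfolding beta_measure_def f_def[symmetric]
      by (subst emeasure_density) (auto intro!: nn_integral_cong simp: indicator_def measurable_sets_borel[of _ borel])
    also have "\<dots> = ennreal (1 / 2) * (\<integral>\<^sup>+t. ennreal (f (1 / 2 + 1 / 2 * t)) * indicator A t \<partial>lborel)"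
      by (subst nn_integral_real_affine[where c="1/2" and t="1/2"]) (auto simp: field_simps)
    also have "\<dots> = (\<integral>\<^sup>+t. ennreal (1 / 2) * (ennreal (f (1 / 2 + 1 / 2 * t)) * indicator A t) \<partial>lborel)"
      by (rule nn_integral_cmult[symmetric]) measurable
    also have "\<dots> = (\<integral>\<^sup>+t. ennreal (C * axis_weight q t) * indicator A t \<partial>lborel)"
    proof -
      have "ennreal (1 / 2 * y) = ennreal (1 / 2) * ennreal y" for y
        by (rule ennreal_mult') simp
      then show ?thesis by (simp only: f[symmetric] mult.assoc)
    qed
    also have "\<dots> = emeasure (density lborel (\<lambda>t. ennreal (C * axis_weight q t))) A"
      by (rule emeasure_density[symmetric]) measurable
    finally show "emeasure (distr (beta_measure b b) borel (\<lambda>x. 2 * x - 1)) A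
        = emeasure (density lborel (\<lambda>t. ennreal (C * axis_weight q t))) A" .
  qed simp
  with C show thesis unfolding b_def by (rule that)
qed

text \<open>Both constants are the inverse of the same total mass of \<open>f\<close>. In this way
  the Beta function and the ball volumes need never be evaluated against each other.\<close>

lemma proportional_density_eq:
  fixes f :: "real \<Rightarrow> real"
  assumes [measurable]: "f \<in> borel_measurable borel"
    and C: "0 < C" "0 < D"
    and p: "prob_space (density lborel (\<lambda>t. ennreal (C * f t)))" "prob_space (density lborel (\<lambda>t. ennreal (D * f t)))"
  shows "density lborel (\<lambda>t. ennreal (C * f t)) = density lborel (\<lambda>t. ennreal (D * f t))"
proof -
  define I where "I = (\<integral>\<^sup>+t. ennreal (f t) \<partial>lborel)"
  have one: "ennreal E * I = 1" if "0 < E" "prob_space (density lborel (\<lambda>t. ennreal (E * f t)))" for E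
  proof -
    have "1 = emeasure (density lborel (\<lambda>t. ennreal (E * f t))) UNIV"
      using prob_space.emeasure_space_1[OF that(2)] by simp
    also have "\<dots> = (\<integral>\<^sup>+t. ennreal E * ennreal (f t) \<partial>lborel)"
      using that(1) by (subst emeasure_density) (auto simp: ennreal_mult')
    also have "\<dots> = ennreal E * I" unfolding I_def by (rule nn_integral_cmult) simp
    finally show ?thesis by simp
  qed
  have "ennreal C = ennreal C * (ennreal D * I)" using one[OF C(2) p(2)] by simp
  also have "\<dots> = ennreal D * (ennreal C * I)" by (simp add: mult_ac)
  also have "\<dots> = ennreal D" using one[OF C(1) p(1)] by simp
  finally have "C = D" using C by simp
  then show ?thesis by simp
qed

lemma distr_axis_uniform_sphere_eq_beta:
  fixes e :: "'a::euclidean_space"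
  assumes e: "e \<in> Basis" and dim: "DIM('a) = q + 1" and q: "0 < q"
  shows "distr uniform_sphere borel (\<lambda>\<sigma>. e \<bullet> \<sigma>) = distr (beta_measure (real q / 2) (real q / 2)) borel (\<lambda>x. 2 * x - 1)"
proof -
  obtain C where C: "0 < C" "distr uniform_sphere borel (\<lambda>\<sigma>. e \<bullet> \<sigma>) = density lborel (\<lambda>t. ennreal (C * axis_weight q t))"
    using uniform_sphere_axis_density[OF assms] .
  obtain D where D: "0 < D" "distr (beta_measure (real q / 2) (real q / 2)) borel (\<lambda>x. 2 * x - 1) = density lborel (\<lambda>t. ennreal (D * axis_weight q t))"
    using distr_beta_measure_density[OF q] .
  have "prob_space (distr uniform_sphere borel (\<lambda>\<sigma>. e \<bullet> \<sigma>))"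
    by (rule prob_space.prob_space_distr[OF prob_space_uniform_sphere])
      (simp add: measurable_cong_sets[OF sets_uniform_sphere refl] measurable_restrict_space1)
  moreover have "prob_space (distr (beta_measure (real q / 2) (real q / 2)) borel (\<lambda>x. 2 * x - 1))"
    using q by (intro prob_space.prob_space_distr prob_space_beta_measure) (auto simp: beta_measure_def)
  ultimately show ?thesis
    unfolding C(2) D(2) by (intro proportional_density_eq C D) auto
qed

lemma sets_stretched_beta: "sets (stretched_beta b) = sets (restrict_space borel {-1..1})"
  unfolding stretched_beta_def by (rule sets_restrict_space_cong) simp

lemma stretched_beta_minus:
  assumes q: "0 < q"
  shows "distr (stretched_beta (real q / 2)) (stretched_beta (real q / 2)) uminus = stretched_beta (real q / 2)"
proof -
  obtain C where C: "0 < C" "distr (beta_measure (real q / 2) (real q / 2)) borel (\<lambda>x. 2 * x - 1) = density lborel (\<lambda>t. ennreal (C * axis_weight q t))"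
    using distr_beta_measure_density[OF q] .
  let ?S = "stretched_beta (real q / 2)"
  note sets = sets_stretched_beta[of "real q / 2"]
  have em: "emeasure ?S A = (\<integral>\<^sup>+t. ennreal (C * axis_weight q t) * indicator A t \<partial>lborel)"
    if "A \<in> sets borel" "A \<subseteq> {-1..1}" for A
    using that unfolding stretched_beta_def C(2)
    by (subst emeasure_restrict_space) (auto simp: emeasure_density)
  show ?thesis
  proof (rule measure_eqI)
    fix A assume "A \<in> sets (distr ?S ?S uminus)"
    then have A: "A \<in> sets borel" "A \<subseteq> {-1..1}" by (auto simp: sets sets_restrict_space)
    note [measurable] = A(1)
    have m: "uminus \<in> measurable ?S ?S"
      unfolding measurable_cong_sets[OF sets sets] by (rule measurable_restrict_space3) auto
    have pre: "uminus -` A \<in> sets borel" "uminus -` A \<subseteq> {-1..1}"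
      using measurable_sets[of "uminus :: real \<Rightarrow> real" borel borel A] A by (auto simp: subset_iff)
    have "emeasure (distr ?S ?S uminus) A = emeasure ?S (uminus -` A)"
      using m A pre by (subst emeasure_distr) (auto simp: sets sets_restrict_space Int_absorb2)
    also have "\<dots> = (\<integral>\<^sup>+t. ennreal (C * axis_weight q t) * indicator (uminus -` A) t \<partial>lborel)"
      by (rule em[OF pre])
    also have "\<dots> = (\<integral>\<^sup>+t. ennreal (C * axis_weight q (- t)) * indicator A (- t) \<partial>lborel)"
      by (simp add: axis_weight_minus indicator_def)
    also have "\<dots> = (\<integral>\<^sup>+t. ennreal (C * axis_weight q t) * indicator A t \<partial>lborel)"
      by (subst (2) nn_integral_real_affine[where c="-1" and t=0]) auto
    also have "\<dots> = emeasure ?S A" by (rule em[OF A, symmetric])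
    finally show "emeasure (distr ?S ?S uminus) A = emeasure ?S A" .
  qed simp
qed

lemma distr_axis_uniform_sphere_eq_stretched_beta:
  fixes e :: "'a::euclidean_space"
  assumes e: "e \<in> Basis" and dim: "DIM('a) = q + 1" and q: "0 < q"
  shows "distr uniform_sphere (restrict_space borel {-1..1}) (\<lambda>\<sigma>. e \<bullet> \<sigma>) = stretched_beta (real q / 2)"
proof (rule measure_eqI)
  let ?D = "distr uniform_sphere (restrict_space borel {-1..1}) (\<lambda>\<sigma>. e \<bullet> \<sigma>)"
  show "sets ?D = sets (stretched_beta (real q / 2))"
    unfolding sets_stretched_beta by simp
  fix A assume "A \<in> sets ?D"
  then have sA: "A \<in> sets (restrict_space borel {-1..1})" by simp
  then have A: "A \<in> sets borel" "A \<subseteq> {-1..1}" by (auto simp: sets_restrict_space)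
  have "\<bar>e \<bullet> \<sigma>\<bar> \<le> 1" if "\<sigma> \<in> sphere 0 1" for \<sigma>
    using Cauchy_Schwarz_ineq2[of e \<sigma>] that e by simp
  then have m: "(\<lambda>\<sigma>. e \<bullet> \<sigma>) \<in> measurable uniform_sphere (restrict_space borel {-1..1})"
    unfolding measurable_cong_sets[OF sets_uniform_sphere refl]
    by (intro measurable_restrict_space3) (auto simp: abs_le_iff minus_le_iff)
  have m': "(\<lambda>\<sigma>. e \<bullet> \<sigma>) \<in> measurable uniform_sphere borel"
    unfolding measurable_cong_sets[OF sets_uniform_sphere refl] by (rule measurable_restrict_space1) simp
  have "emeasure ?D A = emeasure (distr uniform_sphere borel (\<lambda>\<sigma>. e \<bullet> \<sigma>)) A"
    using emeasure_distr[OF m sA] emeasure_distr[OF m' A(1)] by (simp only:)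
  also have "\<dots> = emeasure (stretched_beta (real q / 2)) A"
    using A unfolding distr_axis_uniform_sphere_eq_beta[OF assms] stretched_beta_def
    by (subst emeasure_restrict_space) auto
  finally show "emeasure ?D A = emeasure (stretched_beta (real q / 2)) A" .
qed

section \<open>Tilts and affine kernels\<close>

lemma sets_field_tilt [simp, measurable_cong]: "sets (field_tilt h \<alpha>) = sets \<alpha>"
  by (simp add: field_tilt_def)

lemma field_tilt_zero:
  assumes "prob_space \<alpha>"
  shows "field_tilt 0 \<alpha> = \<alpha>"
proof -
  interpret prob_space \<alpha> by (rule assms)
  show ?thesis by (simp add: field_tilt_def prob_space density_1)
qed

text \<open>The tilting density depends on \<sigma> only through
  \<open>h \<bullet> \<sigma>\<close>, which by assumption is a function of the image point, so the
  normalising integrals agree and the density moves through the map. It is applied to orthogonal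
  maps with \<open>k = f h\<close> and to the projection to the axis with
  \<open>k = norm h\<close>.\<close>

lemma field_tilt_distr:
  fixes f :: "'a::euclidean_space \<Rightarrow> 'b::euclidean_space"
  assumes f [measurable]: "f \<in> measurable \<alpha> N" and id [measurable]: "(\<lambda>\<tau>. \<tau>) \<in> borel_measurable N"
    and eq: "\<And>\<sigma>. \<sigma> \<in> space \<alpha> \<Longrightarrow> k \<bullet> f \<sigma> = h \<bullet> \<sigma>"
  shows "field_tilt k (distr \<alpha> N f) = distr (field_tilt h \<alpha>) N f"
proof -
  have "(\<integral>\<tau>. exp (k \<bullet> \<tau>) \<partial>distr \<alpha> N f) = (\<integral>\<sigma>. exp (k \<bullet> f \<sigma>) \<partial>\<alpha>)"
    by (rule integral_distr) measurable
  also have "\<dots> = (\<integral>\<sigma>. exp (h \<bullet> \<sigma>) \<partial>\<alpha>)"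
    by (intro Bochner_Integration.integral_cong) (auto simp: eq)
  finally have Z: "(\<integral>\<tau>. exp (k \<bullet> \<tau>) \<partial>distr \<alpha> N f) = (\<integral>\<sigma>. exp (h \<bullet> \<sigma>) \<partial>\<alpha>)" .
  have "field_tilt k (distr \<alpha> N f)
      = distr (density \<alpha> (\<lambda>\<sigma>. ennreal (exp (k \<bullet> f \<sigma>) / (\<integral>\<sigma>. exp (h \<bullet> \<sigma>) \<partial>\<alpha>)))) N f"
    unfolding field_tilt_def Z by (rule density_distr) measurable
  also have "density \<alpha> (\<lambda>\<sigma>. ennreal (exp (k \<bullet> f \<sigma>) / (\<integral>\<sigma>. exp (h \<bullet> \<sigma>) \<partial>\<alpha>))) = field_tilt h \<alpha>"
    unfolding field_tilt_def
  proof (rule density_cong)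
    have "(\<lambda>\<sigma>. exp (k \<bullet> f \<sigma>)) \<in> borel_measurable \<alpha>" by measurable
    then have "(\<lambda>\<sigma>. exp (h \<bullet> \<sigma>)) \<in> borel_measurable \<alpha>"
      by (subst measurable_cong[where g="\<lambda>\<sigma>. exp (k \<bullet> f \<sigma>)"]) (auto simp: eq)
    then show "(\<lambda>\<sigma>. ennreal (exp (h \<bullet> \<sigma>) / (\<integral>\<sigma>. exp (h \<bullet> \<sigma>) \<partial>\<alpha>))) \<in> borel_measurable \<alpha>"
      by measurable
  qed (auto simp: eq)
  finally show ?thesis .
qed

context spin_measure
begin

lemma integral_field_tilt:
  fixes f :: "'a \<Rightarrow> 'b::{banach, second_countable_topology}"
  assumes [measurable]: "f \<in> borel_measurable \<alpha>"
  shows "(\<integral>\<sigma>. f \<sigma> \<partial>field_tilt h \<alpha>) = (\<integral>\<sigma>. exp (h \<bullet> \<sigma>) *\<^sub>R f \<sigma> \<partial>\<alpha>) /\<^sub>R partition_fn h"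
proof -
  have "(\<integral>\<sigma>. f \<sigma> \<partial>field_tilt h \<alpha>) = (\<integral>\<sigma>. (exp (h \<bullet> \<sigma>) / partition_fn h) *\<^sub>R f \<sigma> \<partial>\<alpha>)"
    unfolding field_tilt_def partition_fn_def[symmetric] using partition_fn_pos[of h]
    by (intro integral_density) auto
  also have "\<dots> = (\<integral>\<sigma>. inverse (partition_fn h) *\<^sub>R exp (h \<bullet> \<sigma>) *\<^sub>R f \<sigma> \<partial>\<alpha>)"
    by (simp add: divide_inverse mult.commute)
  also have "\<dots> = (\<integral>\<sigma>. exp (h \<bullet> \<sigma>) *\<^sub>R f \<sigma> \<partial>\<alpha>) /\<^sub>R partition_fn h"
    by (rule integral_scaleR_right)
  finally show ?thesis .
qed

lemma spin_measure_field_tilt: "spin_measure (field_tilt h \<alpha>)"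
proof (intro spin_measure.intro spin_measure_axioms.intro prob_spaceI)
  have "emeasure (field_tilt h \<alpha>) (space (field_tilt h \<alpha>)) = (\<integral>\<^sup>+\<sigma>. ennreal (exp (h \<bullet> \<sigma>) / partition_fn h) \<partial>\<alpha>)"
    unfolding field_tilt_def partition_fn_def[symmetric]
    by (subst emeasure_density) (auto intro!: nn_integral_cong simp: indicator_def)
  also have "\<dots> = ennreal (\<integral>\<sigma>. exp (h \<bullet> \<sigma>) / partition_fn h \<partial>\<alpha>)"
    using partition_fn_pos[of h] integrable_exp[of h] by (intro nn_integral_eq_integral) auto
  also have "(\<integral>\<sigma>. exp (h \<bullet> \<sigma>) / partition_fn h \<partial>\<alpha>) = 1"
    using partition_fn_pos[of h] by (simp add: partition_fn_def[symmetric])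
  finally show "emeasure (field_tilt h \<alpha>) (space (field_tilt h \<alpha>)) = 1" by simp
qed (use space_subset sets_eq in auto)

text \<open>Field and tilt add up in the exponent, so properties of the uniform measure at
  \<open>h + v\<close> transfer to the measure with field.\<close>

lemma partition_fn_field_tilt:
  "spin_measure.partition_fn (field_tilt h \<alpha>) v = partition_fn (h + v) / partition_fn h"
  unfolding spin_measure.partition_fn_def[OF spin_measure_field_tilt]
  by (subst integral_field_tilt) (simp_all add: partition_fn_def inner_add_left exp_add divide_inverse mult.commute)

end

section \<open>Mean-field solutions for an affine kernel\<close>

context annealed_spin
begin

text \<open>The kernel is affine in \<sigma>, hence so is the right-hand side of the fixed point
  equation for any bounded \<open>V\<close>. All dependence on \<open>V\<close> is condensed into a
  single vector.\<close>

lemma mean_field_rhs: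
  assumes V: "V \<in> borel_measurable \<alpha>" "\<And>\<tau>. \<tau> \<in> space \<alpha> \<Longrightarrow> \<bar>V \<tau>\<bar> \<le> B"
    and \<sigma>: "\<sigma> \<in> space \<alpha>" and \<theta>c: "\<theta> < c"
  shows "sb_expectation P (\<lambda>x. (\<integral>\<tau>. exp (inner_interaction c \<theta> \<sigma> \<tau>) * exp (x * V \<tau>) \<partial>\<alpha>) / (\<integral>\<tau>. exp (x * V \<tau>) \<partial>\<alpha>))
    = c + \<theta> * (\<sigma> \<bullet> sb_expectation P (\<lambda>x. (\<integral>\<tau>. exp (x * V \<tau>) *\<^sub>R \<tau> \<partial>\<alpha>) /\<^sub>R (\<integral>\<tau>. exp (x * V \<tau>) \<partial>\<alpha>)))"
proof -
  define M where "M x = (\<integral>\<tau>. exp (x * V \<tau>) *\<^sub>R \<tau> \<partial>\<alpha>) /\<^sub>R (\<integral>\<tau>. exp (x * V \<tau>) \<partial>\<alpha>)" for x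
  have iM: "integrable P (\<lambda>x. x *\<^sub>R M x)"
    unfolding M_def
    by (rule integrable_tilted_integral[OF P.finite_measure_axioms _ integrable_P V]) simp_all
  have "(\<integral>\<tau>. exp (inner_interaction c \<theta> \<sigma> \<tau>) * exp (x * V \<tau>) \<partial>\<alpha>) / (\<integral>\<tau>. exp (x * V \<tau>) \<partial>\<alpha>) = c + \<theta> * (\<sigma> \<bullet> M x)" for x
  proof -
    have xV: "(\<lambda>\<tau>. x * V \<tau>) \<in> borel_measurable \<alpha>"
      using V(1) by measurable
    have xVB: "\<bar>x * V \<tau>\<bar> \<le> \<bar>x\<bar> * B" if "\<tau> \<in> space \<alpha>" for \<tau>
      using V(2)[OF that] by (simp add: abs_mult mult_left_mono)
    note i = norm_tilted_integral_le(2,3,4)[OF xV xVB]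
    have K: "exp (inner_interaction c \<theta> \<sigma> \<tau>) = c + \<theta> * (\<sigma> \<bullet> \<tau>)" if "\<tau> \<in> space \<alpha>" for \<tau>
    proof -
      have "\<bar>\<sigma> \<bullet> \<tau>\<bar> \<le> 1" using abs_inner_le[OF that, of \<sigma>] norm_le_1[OF \<sigma>] by linarith
      then have "- \<theta> \<le> \<theta> * (\<sigma> \<bullet> \<tau>)" using \<theta>_pos mult_left_mono[of "- 1" "\<sigma> \<bullet> \<tau>" \<theta>] by auto
      then show ?thesis using \<theta>c by (simp add: inner_interaction_def)
    qed
    have "(\<integral>\<tau>. exp (inner_interaction c \<theta> \<sigma> \<tau>) * exp (x * V \<tau>) \<partial>\<alpha>)
        = (\<integral>\<tau>. c * exp (x * V \<tau>) + \<theta> * (\<sigma> \<bullet> (exp (x * V \<tau>) *\<^sub>R \<tau>)) \<partial>\<alpha>)"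
      by (intro Bochner_Integration.integral_cong refl) (simp add: K algebra_simps)
    also have "\<dots> = c * (\<integral>\<tau>. exp (x * V \<tau>) \<partial>\<alpha>) + \<theta> * (\<sigma> \<bullet> (\<integral>\<tau>. exp (x * V \<tau>) *\<^sub>R \<tau> \<partial>\<alpha>))"
      using i(1) integrable_inner_right[OF i(2), of \<sigma>]
      by (subst Bochner_Integration.integral_add)
        (simp_all add: integral_inner_right[OF i(2)] del: inner_scaleR_right)
    finally show ?thesis
      using i(3) by (simp add: M_def field_simps)
  qed
  then have "sb_expectation P (\<lambda>x. (\<integral>\<tau>. exp (inner_interaction c \<theta> \<sigma> \<tau>) * exp (x * V \<tau>) \<partial>\<alpha>) / (\<integral>\<tau>. exp (x * V \<tau>) \<partial>\<alpha>))
      = (\<integral>x. c * x + \<theta> * (\<sigma> \<bullet> (x *\<^sub>R M x)) \<partial>P) / EW"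
    by (simp add: sb_expectation_def divide_inverse algebra_simps)
  also have "\<dots> = (c * EW + \<theta> * (\<sigma> \<bullet> (\<integral>x. x *\<^sub>R M x \<partial>P))) / EW"
    using integrable_P integrable_inner_right[OF iM, of \<sigma>]
    by (subst Bochner_Integration.integral_add)
      (simp_all add: integral_inner_right[OF iM] del: inner_scaleR_right)
  also have "\<dots> = c + \<theta> * (\<sigma> \<bullet> sb_expectation P M)"
    using EW_pos by (simp add: sb_expectation_def field_simps)
  finally show ?thesis by (simp only: M_def[abs_def])
qed

lemma mean_field_solution_affine:
  assumes sol: "mean_field_solution (inner_interaction c \<theta>) P \<alpha> V"
    and compact: "compact (space \<alpha>)" and \<theta>c: "\<theta> < c"
  obtains m where "\<And>\<sigma>. \<sigma> \<in> space \<alpha> \<Longrightarrow> V \<sigma> = c + m \<bullet> \<sigma>" "magnetization_solution \<theta> P \<alpha> m"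
proof -
  have cont: "continuous_on (space \<alpha>) V"
    using sol unfolding mean_field_solution_def by blast
  have Vm: "V \<in> borel_measurable \<alpha>" by (rule continuous_on_measurable[OF cont])
  obtain B where B: "\<And>\<tau>. \<tau> \<in> space \<alpha> \<Longrightarrow> \<bar>V \<tau>\<bar> \<le> B"
    using compact_imp_bounded[OF compact_continuous_image[OF cont compact]]
    by (auto simp: bounded_iff)
  define M where "M = sb_expectation P (\<lambda>x. (\<integral>\<tau>. exp (x * V \<tau>) *\<^sub>R \<tau> \<partial>\<alpha>) /\<^sub>R (\<integral>\<tau>. exp (x * V \<tau>) \<partial>\<alpha>))"
  have V: "V \<sigma> = c + (\<theta> *\<^sub>R M) \<bullet> \<sigma>" if "\<sigma> \<in> space \<alpha>" for \<sigma>
  proof -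
    have "V \<sigma> = sb_expectation P (\<lambda>x. (\<integral>\<tau>. exp (inner_interaction c \<theta> \<sigma> \<tau>) * exp (x * V \<tau>) \<partial>\<alpha>) / (\<integral>\<tau>. exp (x * V \<tau>) \<partial>\<alpha>))"
      using sol that unfolding mean_field_solution_def by blast
    also have "\<dots> = c + \<theta> * (\<sigma> \<bullet> M)"
      unfolding M_def using that by (intro mean_field_rhs[OF Vm B _ \<theta>c])
    finally have "V \<sigma> = c + \<theta> * (\<sigma> \<bullet> M)" .
    then show ?thesis by (simp add: inner_commute)
  qed
  \<comment> \<open>The constant \<open>c\<close> in \<open>V\<close> contributes the factor
    \<open>exp (x * c)\<close> to numerator and denominator and cancels, so that only the linear
    part \<open>\<theta> *\<^sub>R M\<close> remains.\<close>
  have "(\<integral>\<tau>. exp (x * V \<tau>) *\<^sub>R \<tau> \<partial>\<alpha>) /\<^sub>R (\<integral>\<tau>. exp (x * V \<tau>) \<partial>\<alpha>)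
      = (\<integral>\<tau>. exp (x * ((\<theta> *\<^sub>R M) \<bullet> \<tau>)) *\<^sub>R \<tau> \<partial>\<alpha>) /\<^sub>R (\<integral>\<tau>. exp (x * ((\<theta> *\<^sub>R M) \<bullet> \<tau>)) \<partial>\<alpha>)" for x
  proof -
    have "(\<integral>\<tau>. exp (x * V \<tau>) *\<^sub>R \<tau> \<partial>\<alpha>) = (\<integral>\<tau>. exp (x * c) *\<^sub>R exp (x * ((\<theta> *\<^sub>R M) \<bullet> \<tau>)) *\<^sub>R \<tau> \<partial>\<alpha>)"
      by (intro Bochner_Integration.integral_cong refl) (simp add: V exp_add distrib_left)
    moreover have "(\<integral>\<tau>. exp (x * V \<tau>) \<partial>\<alpha>) = (\<integral>\<tau>. exp (x * c) * exp (x * ((\<theta> *\<^sub>R M) \<bullet> \<tau>)) \<partial>\<alpha>)"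
      by (intro Bochner_Integration.integral_cong refl) (simp add: V exp_add distrib_left)
    ultimately show ?thesis
      unfolding integral_scaleR_right integral_mult_right_zero by simp
  qed
  then have "M = sb_expectation P (\<lambda>x. (\<integral>\<tau>. exp (x * ((\<theta> *\<^sub>R M) \<bullet> \<tau>)) *\<^sub>R \<tau> \<partial>\<alpha>) /\<^sub>R (\<integral>\<tau>. exp (x * ((\<theta> *\<^sub>R M) \<bullet> \<tau>)) \<partial>\<alpha>))"
    by (subst M_def) (simp only:)
  moreover have "(\<theta> *\<^sub>R M) /\<^sub>R \<theta> = M" using \<theta>_pos by simp
  ultimately have "magnetization_solution \<theta> P \<alpha> (\<theta> *\<^sub>R M)"
    unfolding magnetization_solution_def by (simp only:)
  with V show thesis by (rule that)
qed

lemma axial_solution_iff: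
  "axial_solution \<theta> P \<alpha> e r \<longleftrightarrow> magnetization_solution \<theta> P \<alpha> (r *\<^sub>R e)"
  by (simp add: axial_solution_def magnetization_solution_def divide_inverse mult.commute mult.assoc)

lemma pressure_functional_eq:
  assumes "norm e = 1"
  shows "pressure_functional \<theta> P \<alpha> e r = free_energy (r *\<^sub>R e)"
  using assms by (simp add: pressure_functional_def free_energy_def partition_fn_def mult.assoc power_mult_distrib)

end

text \<open>By \<open>finite_pressure_eq\<close> the pressure depends on the spins through their
  inner products only, and \<open>f\<close> preserves these. This justifies turning the field into
  the first coordinate direction.\<close>

lemma finite_pressure_isometry:
  assumes a: "annealed_model \<alpha> P \<theta> w c" and b: "annealed_model (distr \<alpha> N f) P \<theta> w c"
    and f: "f \<in> measurable \<alpha> N" and N: "prob_space N"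
    and iso: "\<And>\<sigma> \<tau>. \<sigma> \<in> space \<alpha> \<Longrightarrow> \<tau> \<in> space \<alpha> \<Longrightarrow> f \<sigma> \<bullet> f \<tau> = \<sigma> \<bullet> \<tau>"
  shows "finite_pressure (inner_interaction c \<theta>) w (distr \<alpha> N f) n = finite_pressure (inner_interaction c \<theta>) w \<alpha> n"
proof -
  interpret A: annealed_model \<alpha> P \<theta> w c by (rule a)
  interpret B: annealed_model "distr \<alpha> N f" P \<theta> w c by (rule b)
  let ?V = "vertex_pairs n"
  have V: "i \<in> {1..n}" "j \<in> {1..n}" if "(i, j) \<in> ?V" for i j
    using that by (auto simp: vertex_pairs_def)
  define G where "G s = (\<Prod>(i, j)\<in>?V. 1 + edge_prob w n i j * (c + \<theta> * (s i \<bullet> s j) - 1))" for s :: "nat \<Rightarrow> 'b"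
  have PiM: "PiM {1..n} (\<lambda>_. distr \<alpha> N f) = distr (PiM {1..n} (\<lambda>_. \<alpha>)) (PiM {1..n} (\<lambda>_. N)) (compose {1..n} f)"
    by (rule distr_PiM_finite_prob_space'[symmetric]) (use f N A.prob_space_axioms in auto)
  have comp: "compose {1..n} f \<in> measurable (PiM {1..n} (\<lambda>_. \<alpha>)) (PiM {1..n} (\<lambda>_. N))"
    unfolding compose_def
  proof (rule measurable_restrict)
    fix i assume "i \<in> {1..n}"
    then show "(\<lambda>s. f (s i)) \<in> measurable (PiM {1..n} (\<lambda>_. \<alpha>)) N"
      by (intro measurable_compose[OF _ f] measurable_component_singleton)
  qed
  have Gm: "G \<in> borel_measurable (PiM {1..n} (\<lambda>_. N))"
  proof -
    have "G \<in> borel_measurable (PiM {1..n} (\<lambda>_. distr \<alpha> N f))"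
      unfolding G_def[abs_def] split_def using V
      by (intro borel_measurable_prod borel_measurable_add borel_measurable_times borel_measurable_diff
          borel_measurable_const borel_measurable_inner B.component_measurable) auto
    then show ?thesis unfolding PiM by simp
  qed
  have "(\<integral>s. G s \<partial>PiM {1..n} (\<lambda>_. distr \<alpha> N f)) = (\<integral>s. G (compose {1..n} f s) \<partial>PiM {1..n} (\<lambda>_. \<alpha>))"
    unfolding PiM by (rule integral_distr[OF comp Gm])
  also have "\<dots> = (\<integral>s. (\<Prod>(i, j)\<in>?V. 1 + edge_prob w n i j * (c + \<theta> * (s i \<bullet> s j) - 1)) \<partial>PiM {1..n} (\<lambda>_. \<alpha>))"
  proof (intro Bochner_Integration.integral_cong refl)
    fix s assume s: "s \<in> space (PiM {1..n} (\<lambda>_. \<alpha>))"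
    show "G (compose {1..n} f s) = (\<Prod>(i, j)\<in>?V. 1 + edge_prob w n i j * (c + \<theta> * (s i \<bullet> s j) - 1))"
      unfolding G_def
    proof (rule prod.cong[OF refl], unfold split_paired_all prod.case)
      fix i j assume ij: "(i, j) \<in> ?V"
      have "f (s i) \<bullet> f (s j) = s i \<bullet> s j"
        using A.component_space[OF s V(1)[OF ij]] A.component_space[OF s V(2)[OF ij]] by (rule iso)
      then show "1 + edge_prob w n i j * (c + \<theta> * (compose {1..n} f s i \<bullet> compose {1..n} f s j) - 1)
          = 1 + edge_prob w n i j * (c + \<theta> * (s i \<bullet> s j) - 1)"
        using V[OF ij] by (simp add: compose_def)
    qed
  qed
  finally show ?thesis
    unfolding A.finite_pressure_eq B.finite_pressure_eq G_def by (simp only:)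
qed

section \<open>Axial fields on the sphere\<close>

lemma spin_measure_uniform_sphere: "spin_measure (uniform_sphere :: 'a::euclidean_space measure)"
  by (intro spin_measure.intro spin_measure_axioms.intro prob_space_uniform_sphere)
    (auto simp: sets_uniform_sphere)

lemma spin_measure_sphere_measure: "spin_measure (sphere_measure h :: 'a::euclidean_space measure)"
  by (rule spin_measure.spin_measure_field_tilt[OF spin_measure_uniform_sphere])

lemma orthogonal_transformation_measurable_sphere:
  fixes f :: "'a::euclidean_space \<Rightarrow> 'a"
  assumes f: "orthogonal_transformation f"
  shows "f \<in> measurable uniform_sphere uniform_sphere"
  unfolding measurable_cong_sets[OF sets_uniform_sphere sets_uniform_sphere]
proof (rule measurable_restrict_space3)
  have "linear f" using f by (rule orthogonal_transformation_linear)
  then show "f \<in> borel_measurable borel"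
    by (intro borel_measurable_continuous_onI linear_continuous_on) (simp add: linear_conv_bounded_linear)
qed (use orthogonal_transformation_norm[OF f] in auto)

lemma sphere_measure_rotation:
  fixes f :: "real ^ 'n::{finite,wellorder} \<Rightarrow> real ^ 'n::{finite,wellorder}"
  assumes f: "orthogonal_transformation f"
  shows "distr (sphere_measure h) uniform_sphere f = sphere_measure (f h)"
proof -
  have "field_tilt (f h) (distr uniform_sphere uniform_sphere f) = distr (field_tilt h uniform_sphere) uniform_sphere f"
    by (rule field_tilt_distr)
      (use f in \<open>auto intro: orthogonal_transformation_measurable_sphere
          spin_measure.measurable_ident_borel[OF spin_measure_uniform_sphere] simp: orthogonal_transformation_def\<close>)
  then show ?thesis by (simp only: uniform_sphere_rotation[OF f])
qed

lemma integral_sphere_measure_rotation: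
  fixes f :: "real ^ 'n::{finite,wellorder} \<Rightarrow> real ^ 'n::{finite,wellorder}"
    and G :: "real ^ 'n::{finite,wellorder} \<Rightarrow> 'b::{banach, second_countable_topology}"
  assumes f: "orthogonal_transformation f" and G: "G \<in> borel_measurable uniform_sphere"
  shows "(\<integral>\<sigma>. G \<sigma> \<partial>sphere_measure (f h)) = (\<integral>\<sigma>. G (f \<sigma>) \<partial>sphere_measure h)"
  unfolding sphere_measure_rotation[OF f, symmetric]
proof (rule integral_distr[OF _ G])
  show "f \<in> measurable (sphere_measure h) uniform_sphere"
    unfolding measurable_cong_sets[OF sets_field_tilt refl] by (rule orthogonal_transformation_measurable_sphere[OF f])
qed

text \<open>Rotation invariance moves both vectors onto one ray. There \<open>exp\<close> itself is
  not pointwise monotone in the length, as the inner product may be negative; averaging over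
  \<sigma> and its antipode replaces it by \<open>cosh\<close>, which is.\<close>

lemma partition_fn_uniform_sphere_mono:
  fixes u v :: "real ^ 'n::{finite,wellorder}"
  assumes uv: "norm u \<le> norm v"
  shows "spin_measure.partition_fn uniform_sphere u \<le> spin_measure.partition_fn uniform_sphere v"
proof -
  interpret spin_measure "uniform_sphere :: (real ^ 'n::{finite,wellorder}) measure"
    by (rule spin_measure_uniform_sphere)
  have us: "sphere_measure 0 = (uniform_sphere :: (real ^ 'n::{finite,wellorder}) measure)"
    by (rule field_tilt_zero[OF prob_space_axioms])
  have rot: "partition_fn (f x) = partition_fn x" if f: "orthogonal_transformation f" for f x
  proof -
    have f0: "f 0 = 0" using orthogonal_transformation_linear[OF f] by (rule linear_0)
    have "partition_fn (f x) = (\<integral>\<sigma>. exp (f x \<bullet> f \<sigma>) \<partial>uniform_sphere)"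
      using integral_sphere_measure_rotation[OF f, of "\<lambda>\<sigma>. exp (f x \<bullet> \<sigma>)" 0]
      by (simp add: partition_fn_def us f0)
    then show ?thesis using f by (simp add: partition_fn_def orthogonal_transformation_def)
  qed
  \<comment> \<open>Any unit vector serves as the common direction, so the index may be
    arbitrary.\<close>
  define a :: "real ^ 'n::{finite,wellorder}" where "a = axis undefined 1"
  have a: "norm a = 1" by (simp add: a_def)
  have radial: "partition_fn x = partition_fn (norm x *\<^sub>R a)" for x
  proof -
    have "norm x = norm (norm x *\<^sub>R a)" using a by simp
    then obtain f where "orthogonal_transformation f" "f x = norm x *\<^sub>R a"
      using orthogonal_transformation_exists by metis
    then show ?thesis using rot by metis
  qed
  have cosh2: "2 * cosh (x \<bullet> \<sigma>) = exp (x \<bullet> \<sigma>) + exp ((- x) \<bullet> \<sigma>)" for x \<sigma> :: "real ^ 'n::{finite,wellorder}"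
    by (simp add: cosh_def)
  have "orthogonal_transformation (\<lambda>x :: real ^ 'n::{finite,wellorder}. - x)"
    by (simp add: orthogonal_transformation_def linear_uminus)
  then have "2 * partition_fn x = partition_fn x + partition_fn (- x)" for x
    using rot[of "\<lambda>x. - x" x] by simp
  also have "partition_fn x + partition_fn (- x) = (\<integral>\<sigma>. 2 * cosh (x \<bullet> \<sigma>) \<partial>uniform_sphere)" for x
    unfolding partition_fn_def cosh2
    by (rule Bochner_Integration.integral_add[symmetric, OF integrable_exp integrable_exp])
  finally have cosh: "2 * partition_fn x = (\<integral>\<sigma>. 2 * cosh (x \<bullet> \<sigma>) \<partial>uniform_sphere)" for x .
  have icosh: "integrable uniform_sphere (\<lambda>\<sigma>. 2 * cosh (x \<bullet> \<sigma>))" for x :: "real ^ 'n::{finite,wellorder}"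
    unfolding cosh2 by (intro Bochner_Integration.integrable_add integrable_exp)
  have "2 * partition_fn (norm u *\<^sub>R a) \<le> 2 * partition_fn (norm v *\<^sub>R a)"
    unfolding cosh
  proof (rule integral_mono[OF icosh icosh])
    fix \<sigma> :: "real ^ 'n::{finite,wellorder}"
    have "\<bar>(norm u *\<^sub>R a) \<bullet> \<sigma>\<bar> \<le> \<bar>(norm v *\<^sub>R a) \<bullet> \<sigma>\<bar>"
      using uv by (simp add: abs_mult mult_right_mono)
    then have "cosh \<bar>(norm u *\<^sub>R a) \<bullet> \<sigma>\<bar> \<le> cosh \<bar>(norm v *\<^sub>R a) \<bullet> \<sigma>\<bar>"
      by (subst cosh_real_nonneg_le_iff) auto
    then show "2 * cosh ((norm u *\<^sub>R a) \<bullet> \<sigma>) \<le> 2 * cosh ((norm v *\<^sub>R a) \<bullet> \<sigma>)"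
      by simp
  qed
  then show ?thesis using radial[of u] radial[of v] by simp
qed

text \<open>The equation is equivariant: a change of variables turns the spins, and the bounded
  linear map \<open>f\<close> commutes with both integrals. The field is turned as well, so
  invariance of the solution set is the special case h = 0.\<close>

lemma magnetization_solution_orthogonal:
  fixes f :: "real ^ 'n::{finite,wellorder} \<Rightarrow> real ^ 'n::{finite,wellorder}"
  assumes P: "real_distribution P" "integrable P (\<lambda>x. x)" and f: "orthogonal_transformation f"
    and m: "magnetization_solution \<theta> P (sphere_measure h) m"
  shows "magnetization_solution \<theta> P (sphere_measure (f h)) (f m)"
proof -
  interpret P: real_distribution P by (rule P)
  interpret S: spin_measure "sphere_measure h" by (rule spin_measure_sphere_measure)
  interpret U: spin_measure "uniform_sphere :: (real ^ 'n::{finite,wellorder}) measure" by (rule spin_measure_uniform_sphere)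
  have bl: "bounded_linear f"
    using orthogonal_transformation_linear[OF f] by (simp add: linear_conv_bounded_linear)
  interpret f: bounded_linear f by (rule bl)
  have ff: "f x \<bullet> f y = x \<bullet> y" for x y using f by (simp add: orthogonal_transformation_def)
  define g where "g x = (\<integral>\<sigma>. exp (x * (m \<bullet> \<sigma>)) *\<^sub>R \<sigma> \<partial>sphere_measure h) /\<^sub>R (\<integral>\<sigma>. exp (x * (m \<bullet> \<sigma>)) \<partial>sphere_measure h)" for x
  have xm: "x * (m \<bullet> \<sigma>) = (x *\<^sub>R m) \<bullet> \<sigma>" for x \<sigma> by simp
  have ig: "integrable P (\<lambda>x. x *\<^sub>R g x)"
    unfolding g_def
    by (rule S.integrable_tilted_integral[where B="norm m"])
      (auto intro: P.finite_measure_axioms P S.abs_inner_le)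
  have "(\<integral>\<sigma>. exp (x * (f m \<bullet> \<sigma>)) *\<^sub>R \<sigma> \<partial>sphere_measure (f h)) /\<^sub>R (\<integral>\<sigma>. exp (x * (f m \<bullet> \<sigma>)) \<partial>sphere_measure (f h)) = f (g x)" for x
  proof -
    have "(\<integral>\<sigma>. exp (x * (f m \<bullet> \<sigma>)) *\<^sub>R \<sigma> \<partial>sphere_measure (f h)) = (\<integral>\<sigma>. exp (x * (m \<bullet> \<sigma>)) *\<^sub>R f \<sigma> \<partial>sphere_measure h)"
      by (subst integral_sphere_measure_rotation[OF f]) (simp_all add: ff)
    also have "\<dots> = (\<integral>\<sigma>. f (exp (x * (m \<bullet> \<sigma>)) *\<^sub>R \<sigma>) \<partial>sphere_measure h)"
      by (simp add: f.scaleR)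
    also have "\<dots> = f (\<integral>\<sigma>. exp (x * (m \<bullet> \<sigma>)) *\<^sub>R \<sigma> \<partial>sphere_measure h)"
      unfolding xm by (rule integral_bounded_linear[OF bl S.integrable_exp_scaleR])
    finally have "(\<integral>\<sigma>. exp (x * (f m \<bullet> \<sigma>)) *\<^sub>R \<sigma> \<partial>sphere_measure (f h)) = f (\<integral>\<sigma>. exp (x * (m \<bullet> \<sigma>)) *\<^sub>R \<sigma> \<partial>sphere_measure h)" .
    moreover have "(\<integral>\<sigma>. exp (x * (f m \<bullet> \<sigma>)) \<partial>sphere_measure (f h)) = (\<integral>\<sigma>. exp (x * (m \<bullet> \<sigma>)) \<partial>sphere_measure h)"
      by (subst integral_sphere_measure_rotation[OF f]) (simp_all add: ff)
    ultimately show ?thesis by (simp add: g_def f.scaleR)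
  qed
  moreover have "sb_expectation P (\<lambda>x. f (g x)) = f (sb_expectation P g)"
  proof -
    have "(\<integral>x. x *\<^sub>R f (g x) \<partial>P) = f (\<integral>x. x *\<^sub>R g x \<partial>P)"
      unfolding f.scaleR[symmetric] by (rule integral_bounded_linear[OF bl ig])
    then show ?thesis by (simp add: sb_expectation_def f.scaleR)
  qed
  moreover have "m /\<^sub>R \<theta> = sb_expectation P g"
    using m by (simp add: magnetization_solution_def g_def[abs_def])
  ultimately show ?thesis
    by (simp add: magnetization_solution_def f.scaleR[symmetric])
qed

lemma partition_fn_sphere_measure_mono:
  fixes h u v :: "real ^ 'n::{finite,wellorder}"
  assumes "norm (h + u) \<le> norm (h + v)"
  shows "spin_measure.partition_fn (sphere_measure h) u \<le> spin_measure.partition_fn (sphere_measure h) v"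
proof -
  interpret spin_measure "uniform_sphere :: (real ^ 'n::{finite,wellorder}) measure"
    by (rule spin_measure_uniform_sphere)
  show ?thesis
    unfolding partition_fn_field_tilt using partition_fn_pos[of h] partition_fn_uniform_sphere_mono[OF assms]
    by (simp add: divide_right_mono)
qed

text \<open>The equation \<open>h = norm h *\<^sub>R e\<close> includes h = 0, so the comparison
  with the Beta model covers the model without a field.\<close>

locale axial_field =
  fixes q :: nat and h e :: "real ^ 'n::{finite,wellorder}"
  assumes q: "0 < q" and dim: "CARD('n) = q + 1" and e: "e \<in> Basis"
    and h: "h = norm h *\<^sub>R e"
begin

abbreviation beta :: "real measure" where
  "beta \<equiv> tilted_stretched_beta (real q / 2) (norm h)"

lemma norm_e: "norm e = 1" using e by simp

lemma e_e: "e \<bullet> e = 1" using e by (simp add: inner_same_Basis)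

lemma DIM: "DIM(real ^ 'n::{finite,wellorder}) = q + 1" using dim by simp

lemma axis_measurable: "(\<lambda>\<sigma>. e \<bullet> \<sigma>) \<in> measurable uniform_sphere (restrict_space borel {-1..1})"
proof -
  have "\<bar>e \<bullet> \<sigma>\<bar> \<le> 1" if "\<sigma> \<in> sphere 0 1" for \<sigma>
    using Cauchy_Schwarz_ineq2[of e \<sigma>] that norm_e by simp
  then show ?thesis
    unfolding measurable_cong_sets[OF sets_uniform_sphere refl]
    by (intro measurable_restrict_space3) (auto simp: abs_le_iff minus_le_iff)
qed

lemma axis_measurable': "(\<lambda>\<sigma>. e \<bullet> \<sigma>) \<in> measurable (sphere_measure h) (restrict_space borel {-1..1})"
  unfolding measurable_cong_sets[OF sets_field_tilt refl] by (rule axis_measurable)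

lemma distr_sphere_measure_axis: "distr (sphere_measure h) (restrict_space borel {-1..1}) (\<lambda>\<sigma>. e \<bullet> \<sigma>) = beta"
proof -
  have "field_tilt (norm h) (distr uniform_sphere (restrict_space borel {-1..1}) (\<lambda>\<sigma>. e \<bullet> \<sigma>))
      = distr (field_tilt h uniform_sphere) (restrict_space borel {-1..1}) (\<lambda>\<sigma>. e \<bullet> \<sigma>)"
  proof (rule field_tilt_distr[OF axis_measurable])
    show "norm h \<bullet> (e \<bullet> \<sigma>) = h \<bullet> \<sigma>" for \<sigma>
      by (subst (2) h) simp
  qed (simp add: measurable_restrict_space1)
  then show ?thesis
    by (simp only: distr_axis_uniform_sphere_eq_stretched_beta[OF e DIM q])
qed

lemma sets_beta: "sets beta = sets (restrict_space borel {-1..1})"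
  by (simp add: sets_stretched_beta)

lemma spin_measure_beta: "spin_measure beta"
proof (intro spin_measure.intro spin_measure_axioms.intro)
  show "prob_space beta"
    unfolding distr_sphere_measure_axis[symmetric]
    by (intro prob_space.prob_space_distr axis_measurable' spin_measure.axioms(1)[OF spin_measure_sphere_measure])
qed (auto simp: sets_stretched_beta)

lemma integral_beta:
  fixes G :: "real \<Rightarrow> 'b::{banach, second_countable_topology}"
  assumes "G \<in> borel_measurable beta"
  shows "(\<integral>t. G t \<partial>beta) = (\<integral>\<sigma>. G (e \<bullet> \<sigma>) \<partial>sphere_measure h)"
proof -
  have "G \<in> borel_measurable (restrict_space borel {-1..1})"
    using assms unfolding measurable_cong_sets[OF sets_beta refl] .
  then show ?thesis
    unfolding distr_sphere_measure_axis[symmetric] by (intro integral_distr axis_measurable')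
qed

text \<open>The half turn about the axis preserves the measure and reverses the transversal
  components, so only the axial component of a vector integral survives.\<close>

lemma integral_axial_vector:
  fixes G :: "real \<Rightarrow> real"
  assumes G: "G \<in> borel_measurable beta" and int: "integrable (sphere_measure h) (\<lambda>\<sigma>. G (e \<bullet> \<sigma>) *\<^sub>R \<sigma>)"
  shows "(\<integral>\<sigma>. G (e \<bullet> \<sigma>) *\<^sub>R \<sigma> \<partial>sphere_measure h) = (\<integral>t. G t *\<^sub>R t \<partial>beta) *\<^sub>R e"
proof -
  interpret B: spin_measure beta by (rule spin_measure_beta)
  define f where "f \<sigma> = (2 * (e \<bullet> \<sigma>)) *\<^sub>R e - \<sigma>" for \<sigma>
  have f: "orthogonal_transformation f"
    unfolding orthogonal_transformation_def
  proof (intro conjI allI linearI)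
    show "f (x + y) = f x + f y" for x y
      by (simp add: f_def inner_add_right distrib_left scaleR_add_left)
    show "f (a *\<^sub>R x) = a *\<^sub>R f x" for a x
      by (simp add: f_def scaleR_diff_right mult.left_commute)
    show "f x \<bullet> f y = x \<bullet> y" for x y
      by (simp add: f_def inner_diff_left inner_diff_right e_e inner_commute[of x e] algebra_simps)
  qed
  have bl: "bounded_linear f"
    using orthogonal_transformation_linear[OF f] by (simp add: linear_conv_bounded_linear)
  have ef: "e \<bullet> f \<sigma> = e \<bullet> \<sigma>" for \<sigma> by (simp add: f_def inner_simps e_e)
  have fh: "f h = h"
  proof -
    have "e \<bullet> h = norm h" by (subst h) (simp add: e_e)
    then have "f h = (2 * norm h) *\<^sub>R e - h" by (simp add: f_def)
    also have "(2 * norm h) *\<^sub>R e = h + h" using h by (metis mult_2 scaleR_add_left)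
    finally show ?thesis by simp
  qed
  define I where "I = (\<integral>\<sigma>. G (e \<bullet> \<sigma>) *\<^sub>R \<sigma> \<partial>sphere_measure h)"
  have Gm: "(\<lambda>\<sigma>. G (e \<bullet> \<sigma>) *\<^sub>R \<sigma>) \<in> borel_measurable uniform_sphere"
    using borel_measurable_integrable[OF int] unfolding measurable_cong_sets[OF sets_field_tilt refl] .
  have "I = (\<integral>\<sigma>. G (e \<bullet> \<sigma>) *\<^sub>R \<sigma> \<partial>sphere_measure (f h))" by (simp add: I_def fh)
  also have "\<dots> = (\<integral>\<sigma>. G (e \<bullet> f \<sigma>) *\<^sub>R f \<sigma> \<partial>sphere_measure h)"
    by (rule integral_sphere_measure_rotation[OF f Gm])
  also have "\<dots> = (\<integral>\<sigma>. f (G (e \<bullet> \<sigma>) *\<^sub>R \<sigma>) \<partial>sphere_measure h)"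
    by (simp add: ef linear_scale[OF orthogonal_transformation_linear[OF f]])
  also have "\<dots> = f I"
    unfolding I_def by (rule integral_bounded_linear[OF bl int])
  finally have "I + I = (2 * (e \<bullet> I)) *\<^sub>R e" by (simp add: f_def)
  then have "2 *\<^sub>R I = 2 *\<^sub>R ((e \<bullet> I) *\<^sub>R e)" by (simp add: scaleR_2)
  then have "I = (e \<bullet> I) *\<^sub>R e" by (metis scaleR_cancel_left zero_neq_numeral)
  moreover have "e \<bullet> I = (\<integral>t. G t *\<^sub>R t \<partial>beta)"
  proof -
    have "e \<bullet> I = (\<integral>\<sigma>. e \<bullet> (G (e \<bullet> \<sigma>) *\<^sub>R \<sigma>) \<partial>sphere_measure h)"
      unfolding I_def by (rule integral_inner_right[OF int, symmetric])
    also have "\<dots> = (\<integral>t. G t *\<^sub>R t \<partial>beta)"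
      using G B.measurable_ident_borel by (subst integral_beta) simp_all
    finally show ?thesis .
  qed
  ultimately show ?thesis by (simp add: I_def)
qed

text \<open>A continuous right inverse of the axial coordinate, a half circle through
  \<open>e\<close> and a second basis vector, which exists since q \<ge> 1. It carries continuity of
  \<sigma> \<mapsto> V (e \<bullet> \<sigma>) back to continuity of V.\<close>

lemma axis_section:
  obtains s where "continuous_on {-1..1} s" "\<And>t. t \<in> {-1..1} \<Longrightarrow> s t \<in> sphere 0 1 \<and> e \<bullet> s t = t"
proof -
  have "Basis \<noteq> {e}"
  proof
    assume "Basis = {e}"
    then have "DIM(real ^ 'n::{finite,wellorder}) = card {e}" by (rule arg_cong)
    then show False unfolding DIM using q by simp
  qed
  then obtain b where b: "b \<in> Basis" "b \<noteq> e" using e by blast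
  have eb: "e \<bullet> b = 0" "b \<bullet> e = 0" "b \<bullet> b = 1"
    using b e by (auto simp: inner_Basis)
  define s where "s t = t *\<^sub>R e + sqrt (1 - t\<^sup>2) *\<^sub>R b" for t
  show thesis
  proof (rule that)
    show "continuous_on {-1..1} s" unfolding s_def by (intro continuous_intros)
    fix t :: real assume "t \<in> {-1..1}"
    then have "t\<^sup>2 \<le> 1" by (auto simp: abs_square_le_1)
    then have "s t \<bullet> s t = 1"
      by (simp add: s_def inner_simps eb e_e flip: power2_eq_square)
    then have "norm (s t) = 1" by (simp add: norm_eq_1)
    then show "s t \<in> sphere 0 1 \<and> e \<bullet> s t = t" by (simp add: s_def inner_simps eb e_e)
  qed
qed

end

section \<open>Comparison of the spherical model with the Beta model\<close>

locale axial_model = axial_field +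
  fixes P :: "real measure" and \<theta> c :: real and w :: "nat \<Rightarrow> nat \<Rightarrow> real"
  assumes P: "real_distribution P" and weights: "weights_converge w P"
    and EW_pos: "0 < (\<integral>x. x \<partial>P)" and \<theta>_pos: "0 < \<theta>" and \<theta>_less_c: "\<theta> < c"
begin

lemma annealed_modelI: "spin_measure \<alpha> \<Longrightarrow> annealed_model \<alpha> P \<theta> w c"
  by (intro annealed_model.intro annealed_spin.intro annealed_spin_axioms.intro annealed_model_axioms.intro
      P weights EW_pos \<theta>_pos \<theta>_less_c weights_converge_integrable[OF P weights])

sublocale S: annealed_model "sphere_measure h" P \<theta> w c
  by (rule annealed_modelI[OF spin_measure_sphere_measure])

sublocale B: annealed_model beta P \<theta> w c
  by (rule annealed_modelI[OF spin_measure_beta])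

lemma free_energy_beta: "B.free_energy r = S.free_energy (r *\<^sub>R e)"
proof -
  have "B.partition_fn (x *\<^sub>R r) = S.partition_fn (x *\<^sub>R (r *\<^sub>R e))" for x
    unfolding B.partition_fn_def S.partition_fn_def by (subst integral_beta) simp_all
  then show ?thesis
    by (simp add: B.free_energy_def S.free_energy_def norm_e power_mult_distrib)
qed

text \<open>The quadratic term only depends on \<open>norm m\<close>. In the logarithmic term a
  vertex of weight x \<ge> 0 sees \<open>norm (h + x *\<^sub>R m)\<close>, which for given
  \<open>norm m\<close> is largest when \<open>m\<close> points along the axis of the field.\<close>

lemma free_energy_le_axis: "S.free_energy m \<le> S.free_energy (norm m *\<^sub>R e)"
proof -
  have "(\<integral>x. ln (S.partition_fn (x *\<^sub>R m)) \<partial>P) \<le> (\<integral>x. ln (S.partition_fn (x *\<^sub>R (norm m *\<^sub>R e))) \<partial>P)"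
  proof (rule integral_mono_AE[OF S.integrable_ln_partition_fn S.integrable_ln_partition_fn])
    show "AE x in P. ln (S.partition_fn (x *\<^sub>R m)) \<le> ln (S.partition_fn (x *\<^sub>R (norm m *\<^sub>R e)))"
      using weights_converge_limit_nonneg[OF P weights]
    proof eventually_elim
      case (elim x)
      have "h + x *\<^sub>R (norm m *\<^sub>R e) = (norm h + x * norm m) *\<^sub>R e"
        by (subst h) (simp add: scaleR_add_left)
      then have "norm (h + x *\<^sub>R (norm m *\<^sub>R e)) = norm h + x * norm m"
        using elim by (simp add: norm_e)
      moreover have "norm (h + x *\<^sub>R m) \<le> norm h + x * norm m"
        using norm_triangle_ineq[of h "x *\<^sub>R m"] elim by simp
      ultimately have "S.partition_fn (x *\<^sub>R m) \<le> S.partition_fn (x *\<^sub>R (norm m *\<^sub>R e))"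
        by (intro partition_fn_sphere_measure_mono) (simp only:)
      then show ?case using S.partition_fn_pos by simp
    qed
  qed
  then show ?thesis by (simp add: S.free_energy_def norm_e)
qed

text \<open>Turning a maximiser onto the axis keeps it maximal among all vectors, not merely among
  axial ones. Hence it satisfies the full vector equation, whose axial form has the scalar
  \<open>norm m\<close>.\<close>

lemma axial_pressure:
  obtains r where "0 \<le> r" "axial_solution \<theta> P (sphere_measure h) e r"
    and "\<And>m. S.free_energy m \<le> S.free_energy (r *\<^sub>R e)"
    and "finite_pressure (inner_interaction c \<theta>) w (sphere_measure h)
      \<longlonglongrightarrow> (c - 1) * (\<integral>x. x \<partial>P) / 2 + S.free_energy (r *\<^sub>R e)"
proof -
  obtain m where m: "\<And>m'. S.free_energy m' \<le> S.free_energy m"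
    and lim: "finite_pressure (inner_interaction c \<theta>) w (sphere_measure h)
      \<longlonglongrightarrow> (c - 1) * (\<integral>x. x \<partial>P) / 2 + S.free_energy m"
    by (rule S.annealed_pressure_variational) blast
  have eq: "S.free_energy m = S.free_energy (norm m *\<^sub>R e)"
    using m free_energy_le_axis by (intro antisym)
  show thesis
  proof (rule that)
    show max: "S.free_energy m' \<le> S.free_energy (norm m *\<^sub>R e)" for m'
      using m[of m'] eq by simp
    show "axial_solution \<theta> P (sphere_measure h) e (norm m)"
      unfolding S.axial_solution_iff by (rule S.maximiser_magnetization_solution[OF max])
    show "finite_pressure (inner_interaction c \<theta>) w (sphere_measure h)
      \<longlonglongrightarrow> (c - 1) * (\<integral>x. x \<partial>P) / 2 + S.free_energy (norm m *\<^sub>R e)"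
      using lim eq by simp
  qed simp
qed

text \<open>Only the limits are compared. The free energy of the Beta model is that of the sphere
  restricted to the axis, and the axis carries the maximum of the latter, so the two maxima
  coincide.\<close>

lemma pressure_beta:
  "\<exists>\<psi>. finite_pressure (inner_interaction c \<theta>) w (sphere_measure h) \<longlonglongrightarrow> \<psi> \<and>
    finite_pressure (inner_interaction c \<theta>) w beta \<longlonglongrightarrow> \<psi>"
proof -
  obtain r where r: "\<And>m. S.free_energy m \<le> S.free_energy (r *\<^sub>R e)"
    and lim: "finite_pressure (inner_interaction c \<theta>) w (sphere_measure h)
      \<longlonglongrightarrow> (c - 1) * (\<integral>x. x \<partial>P) / 2 + S.free_energy (r *\<^sub>R e)"
    by (rule axial_pressure) blast
  obtain s where s: "\<And>s'. B.free_energy s' \<le> B.free_energy s"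
    and lim': "finite_pressure (inner_interaction c \<theta>) w beta \<longlonglongrightarrow> (c - 1) * (\<integral>x. x \<partial>P) / 2 + B.free_energy s"
    by (rule B.annealed_pressure_variational) blast
  have "B.free_energy s = S.free_energy (r *\<^sub>R e)"
    using s[of r] r[of "s *\<^sub>R e"] by (intro antisym) (simp_all add: free_energy_beta)
  then show ?thesis using lim lim' by auto
qed

lemma sb_expectation_axial:
  assumes V: "V \<in> borel_measurable beta" "\<And>t. t \<in> {-1..1} \<Longrightarrow> \<bar>V t\<bar> \<le> K"
  shows "sb_expectation P (\<lambda>x. (\<integral>\<sigma>. exp (x * V (e \<bullet> \<sigma>)) *\<^sub>R \<sigma> \<partial>sphere_measure h) /\<^sub>R (\<integral>\<sigma>. exp (x * V (e \<bullet> \<sigma>)) \<partial>sphere_measure h))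
    = sb_expectation P (\<lambda>x. (\<integral>t. exp (x * V t) *\<^sub>R t \<partial>beta) /\<^sub>R (\<integral>t. exp (x * V t) \<partial>beta)) *\<^sub>R e"
proof -
  define M where "M x = (\<integral>t. exp (x * V t) *\<^sub>R t \<partial>beta) /\<^sub>R (\<integral>t. exp (x * V t) \<partial>beta)" for x
  have V': "(\<lambda>\<sigma>. V (e \<bullet> \<sigma>)) \<in> borel_measurable (sphere_measure h)"
    using V(1) unfolding measurable_cong_sets[OF sets_beta refl]
    by (rule measurable_compose[OF axis_measurable'])
  have VK: "\<bar>V (e \<bullet> \<sigma>)\<bar> \<le> K" if "\<sigma> \<in> space (sphere_measure h)" for \<sigma>
    using V(2) measurable_space[OF axis_measurable' that] by (simp add: space_restrict_space)
  have iM: "integrable P (\<lambda>x. x *\<^sub>R M x)"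
    unfolding M_def
    by (rule B.integrable_tilted_integral[OF S.P.finite_measure_axioms _ S.integrable_P V]) simp_all
  have "(\<integral>\<sigma>. exp (x * V (e \<bullet> \<sigma>)) *\<^sub>R \<sigma> \<partial>sphere_measure h) /\<^sub>R (\<integral>\<sigma>. exp (x * V (e \<bullet> \<sigma>)) \<partial>sphere_measure h) = M x *\<^sub>R e" for x
  proof -
    have [measurable]: "V \<in> borel_measurable beta" by (rule V(1))
    have g: "(\<lambda>t. exp (x * V t)) \<in> borel_measurable beta" by measurable
    have xV: "(\<lambda>\<sigma>. x * V (e \<bullet> \<sigma>)) \<in> borel_measurable (sphere_measure h)"
      using V' by measurable
    have xVK: "\<bar>x * V (e \<bullet> \<sigma>)\<bar> \<le> \<bar>x\<bar> * K" if "\<sigma> \<in> space (sphere_measure h)" for \<sigma>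
      using VK[OF that] by (simp add: abs_mult mult_left_mono)
    have int: "integrable (sphere_measure h) (\<lambda>\<sigma>. exp (x * V (e \<bullet> \<sigma>)) *\<^sub>R \<sigma>)"
      by (rule S.norm_tilted_integral_le(3)[OF xV xVK])
    show ?thesis
      unfolding M_def integral_axial_vector[OF g int] integral_beta[OF g] by simp
  qed
  moreover have "sb_expectation P (\<lambda>x. M x *\<^sub>R e) = sb_expectation P M *\<^sub>R e"
  proof -
    have "(\<integral>x. x *\<^sub>R (M x *\<^sub>R e) \<partial>P) = (\<integral>x. (x *\<^sub>R M x) *\<^sub>R e \<partial>P)" by simp
    also have "\<dots> = (\<integral>x. x *\<^sub>R M x \<partial>P) *\<^sub>R e"
      using iM by (rule integral_scaleR_left)
    finally show ?thesis by (simp add: sb_expectation_def)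
  qed
  ultimately show ?thesis by (simp add: M_def[abs_def])
qed

lemma axial_solution_beta:
  "axial_solution \<theta> P (sphere_measure h) e r \<longleftrightarrow> magnetization_solution \<theta> P beta r"
proof -
  define M where "M = sb_expectation P (\<lambda>x. (\<integral>t. exp (x * (r * t)) *\<^sub>R t \<partial>beta) /\<^sub>R (\<integral>t. exp (x * (r * t)) \<partial>beta))"
  have ax: "sb_expectation P (\<lambda>x. (\<integral>\<sigma>. exp (x * (r * (e \<bullet> \<sigma>))) *\<^sub>R \<sigma> \<partial>sphere_measure h) /\<^sub>R (\<integral>\<sigma>. exp (x * (r * (e \<bullet> \<sigma>))) \<partial>sphere_measure h))
    = M *\<^sub>R e"
    unfolding M_def by (rule sb_expectation_axial[where K="\<bar>r\<bar>"]) (auto simp: abs_mult abs_le_iff intro!: mult_left_le)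
  have "axial_solution \<theta> P (sphere_measure h) e r \<longleftrightarrow> (r / \<theta>) *\<^sub>R e = M *\<^sub>R e"
    unfolding axial_solution_def mult.assoc ax ..
  also have "\<dots> \<longleftrightarrow> r / \<theta> = M"
    using norm_e by auto
  also have "\<dots> \<longleftrightarrow> r /\<^sub>R \<theta> = M"
    by (simp add: divide_inverse mult.commute)
  finally show ?thesis
    unfolding magnetization_solution_def inner_real_def M_def .
qed

text \<open>For continuous \<open>V\<close> both equations reduce to
  \<open>V t = c + \<theta> * (t * M)\<close> with the same scalar \<open>M\<close>, because the
  transversal part of the spherical average vanishes. The axial coordinate takes every value in
  [-1, 1], so the two ranges of validity agree.\<close>

lemma mean_field_solution_beta:
  "mean_field_solution (inner_interaction c \<theta>) P (sphere_measure h) (\<lambda>\<sigma>. V (e \<bullet> \<sigma>)) \<longleftrightarrow>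
    mean_field_solution (inner_interaction c \<theta>) P beta V"
proof -
  obtain s where s: "continuous_on {-1..1} s" "\<And>t. t \<in> {-1..1} \<Longrightarrow> s t \<in> sphere 0 1 \<and> e \<bullet> s t = t"
    by (rule axis_section) blast
  have e_range: "e \<bullet> \<sigma> \<in> {-1..1}" if "\<sigma> \<in> sphere 0 1" for \<sigma>
    using Cauchy_Schwarz_ineq2[of e \<sigma>] that norm_e by (auto simp: abs_le_iff)
  have cont: "continuous_on (sphere 0 1) (\<lambda>\<sigma>. V (e \<bullet> \<sigma>)) \<longleftrightarrow> continuous_on {-1..1} V"
  proof
    assume "continuous_on (sphere 0 1) (\<lambda>\<sigma>. V (e \<bullet> \<sigma>))"
    then have "continuous_on {-1..1} (\<lambda>t. V (e \<bullet> s t))"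
      using s by (intro continuous_on_compose2[OF _ s(1)]) auto
    then show "continuous_on {-1..1} V"
      by (rule continuous_on_eq) (use s(2) in auto)
  next
    assume "continuous_on {-1..1} V"
    then show "continuous_on (sphere 0 1) (\<lambda>\<sigma>. V (e \<bullet> \<sigma>))"
      by (rule continuous_on_compose2) (use e_range in \<open>auto intro!: continuous_intros\<close>)
  qed
  show ?thesis
  proof (cases "continuous_on {-1..1} V")
    case True
    have Vm: "V \<in> borel_measurable beta"
      by (rule B.continuous_on_measurable) (simp add: True)
    obtain K where "\<forall>y\<in>V ` {-1..1}. norm y \<le> K"
      using compact_imp_bounded[OF compact_continuous_image[OF True compact_Icc]]
      unfolding bounded_iff by blast
    then have K: "\<bar>V t\<bar> \<le> K" if "t \<in> {-1..1}" for t
      using that by simp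
    have Vm': "(\<lambda>\<sigma>. V (e \<bullet> \<sigma>)) \<in> borel_measurable (sphere_measure h)"
      by (rule S.continuous_on_measurable) (simp add: cont True)
    have K': "\<bar>V (e \<bullet> \<sigma>)\<bar> \<le> K" if "\<sigma> \<in> space (sphere_measure h)" for \<sigma>
      using K e_range that by simp
    define M where "M = sb_expectation P (\<lambda>x. (\<integral>t. exp (x * V t) *\<^sub>R t \<partial>beta) /\<^sub>R (\<integral>t. exp (x * V t) \<partial>beta))"
    have "mean_field_solution (inner_interaction c \<theta>) P beta V \<longleftrightarrow> (\<forall>t\<in>{-1..1}. V t = c + \<theta> * (t * M))"
      using True K B.mean_field_rhs[OF Vm _ _ \<theta>_less_c, of K]
      by (simp add: mean_field_solution_def M_def)
    moreover have "mean_field_solution (inner_interaction c \<theta>) P (sphere_measure h) (\<lambda>\<sigma>. V (e \<bullet> \<sigma>))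
        \<longleftrightarrow> (\<forall>\<sigma>\<in>sphere 0 1. V (e \<bullet> \<sigma>) = c + \<theta> * ((e \<bullet> \<sigma>) * M))"
    proof -
      have "sb_expectation P (\<lambda>x. (\<integral>\<tau>. exp (inner_interaction c \<theta> \<sigma> \<tau>) * exp (x * V (e \<bullet> \<tau>)) \<partial>sphere_measure h)
          / (\<integral>\<tau>. exp (x * V (e \<bullet> \<tau>)) \<partial>sphere_measure h)) = c + \<theta> * ((e \<bullet> \<sigma>) * M)" if "\<sigma> \<in> sphere 0 1" for \<sigma>
      proof -
        have ax: "sb_expectation P (\<lambda>x. (\<integral>\<tau>. exp (x * V (e \<bullet> \<tau>)) *\<^sub>R \<tau> \<partial>sphere_measure h) /\<^sub>R (\<integral>\<tau>. exp (x * V (e \<bullet> \<tau>)) \<partial>sphere_measure h)) = M *\<^sub>R e"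
          unfolding M_def by (rule sb_expectation_axial[OF Vm K])
        show ?thesis
          using S.mean_field_rhs[OF Vm' K' _ \<theta>_less_c, of \<sigma>] that
          unfolding ax by (simp add: inner_commute[of e \<sigma>] mult.commute)
      qed
      then show ?thesis using cont True by (simp add: mean_field_solution_def)
    qed
    moreover have "(\<forall>\<sigma>\<in>sphere 0 1. V (e \<bullet> \<sigma>) = c + \<theta> * ((e \<bullet> \<sigma>) * M)) \<longleftrightarrow> (\<forall>t\<in>{-1..1}. V t = c + \<theta> * (t * M))"
      using e_range s(2) by metis
    ultimately show ?thesis by simp
  next
    case False
    then show ?thesis using cont by (simp add: mean_field_solution_def)
  qed
qed

end

section \<open>The main theorem\<close>

text \<open>The limit in the part on the pressure contains \<open>- EW / 2\<close>, where
  \<open>EW\<close> is the mean of \<open>P\<close>: an edge is absent with probability 1 - p, so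
  its mean factor is 1 + p (K - 1), and the constant part of the exponent is (c - 1) l / 2. The two
  reductions made without loss of generality appear as existence of a rotation: for h = 0 together
  with an equivalence of the vector and axial equations, for h \<noteq> 0 with equality of all
  finite pressures.\<close>

theorem mainTheorem9:
  fixes q :: nat
    and h e1 :: "real ^ 'n::{finite,wellorder}"
    and c \<theta> :: real
    and w :: "nat \<Rightarrow> nat \<Rightarrow> real"
    and P :: "real measure"
  assumes q: "1 \<le> q" and dim: "CARD('n) = q + 1"
    and e1: "e1 = axis (LEAST i. True) 1"
    and c: "0 < c" and \<theta>: "0 < \<theta>"
    and K_pos: "\<And>\<sigma> \<tau> :: real ^ 'n::{finite,wellorder}. \<sigma> \<in> sphere 0 1 \<Longrightarrow> \<tau> \<in> sphere 0 1 \<Longrightarrow> 0 < c + \<theta> * (\<sigma> \<bullet> \<tau>)"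
    and P: "real_distribution P"
    and weights: "weights_converge w P"
    and EW_pos: "0 < (\<integral>x. x \<partial>P)"
  shows "
    (\<forall>V. mean_field_solution (inner_interaction c \<theta>) P (sphere_measure h) V \<longrightarrow>
       (\<exists>m. (\<forall>\<sigma>\<in>sphere 0 1. V \<sigma> = c + m \<bullet> \<sigma>) \<and> magnetization_solution \<theta> P (sphere_measure h) m)) \<and>
    (h = 0 \<longrightarrow>
       (\<forall>m R. magnetization_solution \<theta> P (sphere_measure h) m \<and> rotation_matrix R \<longrightarrow>
          magnetization_solution \<theta> P (sphere_measure h) (R *v m)) \<and>
       (\<forall>m. \<exists>R. rotation_matrix R \<and> R *v m = norm m *\<^sub>R e1) \<and>
       (\<forall>m. magnetization_solution \<theta> P (sphere_measure h) m \<longleftrightarrow>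
          axial_solution \<theta> P uniform_sphere e1 (norm m))) \<and>
    (h \<noteq> 0 \<longrightarrow>
       (\<exists>R. rotation_matrix R \<and> R *v h = norm h *\<^sub>R e1 \<and>
          (\<forall>N. finite_pressure (inner_interaction c \<theta>) w (sphere_measure (R *v h)) N =
               finite_pressure (inner_interaction c \<theta>) w (sphere_measure h) N))) \<and>
    (h \<noteq> 0 \<and> h = norm h *\<^sub>R e1 \<longrightarrow>
       {r. 0 \<le> r \<and> axial_solution \<theta> P (sphere_measure h) e1 r} \<noteq> {} \<and>
       bdd_above (pressure_functional \<theta> P (sphere_measure h) e1 `
          {r. 0 \<le> r \<and> axial_solution \<theta> P (sphere_measure h) e1 r}) \<and>
       finite_pressure (inner_interaction c \<theta>) w (sphere_measure h) \<longlonglongrightarrow>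
         c * (\<integral>x. x \<partial>P) / 2 - (\<integral>x. x \<partial>P) / 2 +
         (SUP r\<in>{r. 0 \<le> r \<and> axial_solution \<theta> P (sphere_measure h) e1 r}.
            pressure_functional \<theta> P (sphere_measure h) e1 r)) \<and>
    (\<exists>C>0. distributed uniform_sphere lborel (\<lambda>\<sigma>. e1 \<bullet> \<sigma>)
       (\<lambda>t. ennreal (C * (1 - t) powr (real q / 2 - 1) * (1 + t) powr (real q / 2 - 1) * indicator {-1..1} t))) \<and>
    (distr (stretched_beta (real q / 2)) (stretched_beta (real q / 2)) uminus = stretched_beta (real q / 2)) \<and>
    (distr uniform_sphere (restrict_space borel {-1..1}) (\<lambda>\<sigma>. e1 \<bullet> \<sigma>) = stretched_beta (real q / 2)) \<and>
    (h = norm h *\<^sub>R e1 \<longrightarrow>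
       distr (sphere_measure h) (restrict_space borel {-1..1}) (\<lambda>\<sigma>. e1 \<bullet> \<sigma>) =
         tilted_stretched_beta (real q / 2) (norm h) \<and>
       (\<forall>r. axial_solution \<theta> P (sphere_measure h) e1 r \<longleftrightarrow>
          magnetization_solution \<theta> P (tilted_stretched_beta (real q / 2) (norm h)) r) \<and>
       (\<forall>V. mean_field_solution (inner_interaction c \<theta>) P (sphere_measure h) (\<lambda>\<sigma>. V (e1 \<bullet> \<sigma>)) \<longleftrightarrow>
          mean_field_solution (inner_interaction c \<theta>) P (tilted_stretched_beta (real q / 2) (norm h)) V) \<and>
       (\<exists>\<psi>. finite_pressure (inner_interaction c \<theta>) w (sphere_measure h) \<longlonglongrightarrow> \<psi> \<and>
          finite_pressure (inner_interaction c \<theta>) w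
            (tilted_stretched_beta (real q / 2) (norm h)) \<longlonglongrightarrow> \<psi>))"
proof -
  let ?U = "uniform_sphere :: (real ^ 'n::{finite,wellorder}) measure"
  note iP = weights_converge_integrable[OF P weights]
  have q0: "0 < q" and C2: "2 \<le> CARD('n)" using q dim by auto
  have DIM: "DIM(real ^ 'n::{finite,wellorder}) = q + 1" using dim by simp
  have e1_Basis: "e1 \<in> Basis" unfolding e1 by (simp add: axis_in_Basis_iff)
  have norm_e1: "norm e1 = 1" using e1_Basis by simp
  \<comment> \<open>Antipodal spins attain the minimum c - \<theta> of the kernel.\<close>
  have \<theta>c: "\<theta> < c"
    using K_pos[of e1 "- e1"] e1_Basis by (simp add: inner_same_Basis)
  have model: "annealed_model \<alpha> P \<theta> w c" if "spin_measure \<alpha>" for \<alpha> :: "(real ^ 'n::{finite,wellorder}) measure"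
    using that by (intro annealed_model.intro annealed_spin.intro annealed_spin_axioms.intro annealed_model_axioms.intro
        P weights EW_pos \<theta> \<theta>c iP)
  have U0: "sphere_measure 0 = ?U" by (rule field_tilt_zero[OF prob_space_uniform_sphere])
  have rotation: "orthogonal_transformation ((*v) R)" if "rotation_matrix R" for R :: "real ^ 'n::{finite,wellorder} ^ 'n::{finite,wellorder}"
    using that by (simp add: orthogonal_transformation_matrix rotation_matrix_def)
  \<comment> \<open>The determinant can be made 1 because the dimension q + 1 is at least 2.\<close>
  have rotate: "\<exists>R. rotation_matrix R \<and> R *v m = norm m *\<^sub>R e1" for m
  proof -
    have "norm m = norm (norm m *\<^sub>R e1)" using norm_e1 by simp
    then obtain f where f: "orthogonal_transformation f" "det (matrix f) = 1" "f m = norm m *\<^sub>R e1"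
      using rotation_exists[OF C2] by metis
    then have "linear f" "orthogonal_matrix (matrix f)"
      by (simp_all add: orthogonal_transformation_matrix)
    then show ?thesis using f(2,3) by (intro exI[of _ "matrix f"]) (simp add: rotation_matrix_def matrix_works)
  qed
  have magnetization_rotate: "magnetization_solution \<theta> P (sphere_measure 0) (f m)"
    if "orthogonal_transformation f" "magnetization_solution \<theta> P (sphere_measure 0) m"
    for f :: "real ^ 'n::{finite,wellorder} \<Rightarrow> real ^ 'n::{finite,wellorder}" and m
    using magnetization_solution_orthogonal[OF P iP that] linear_0[OF orthogonal_transformation_linear[OF that(1)]]
    by simp
  have a: "\<forall>V. mean_field_solution (inner_interaction c \<theta>) P (sphere_measure h) V \<longrightarrow>
       (\<exists>m. (\<forall>\<sigma>\<in>sphere 0 1. V \<sigma> = c + m \<bullet> \<sigma>) \<and> magnetization_solution \<theta> P (sphere_measure h) m)"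
  proof (intro allI impI)
    fix V assume V: "mean_field_solution (inner_interaction c \<theta>) P (sphere_measure h) V"
    interpret annealed_model "sphere_measure h" P \<theta> w c by (rule model[OF spin_measure_sphere_measure])
    obtain m where "\<And>\<sigma>. \<sigma> \<in> space (sphere_measure h) \<Longrightarrow> V \<sigma> = c + m \<bullet> \<sigma>" "magnetization_solution \<theta> P (sphere_measure h) m"
      by (rule mean_field_solution_affine[OF V _ \<theta>c]) simp_all
    then show "\<exists>m. (\<forall>\<sigma>\<in>sphere 0 1. V \<sigma> = c + m \<bullet> \<sigma>) \<and> magnetization_solution \<theta> P (sphere_measure h) m"
      by auto
  qed
  have b: "(\<forall>m R. magnetization_solution \<theta> P (sphere_measure h) m \<and> rotation_matrix R \<longrightarrow>
          magnetization_solution \<theta> P (sphere_measure h) (R *v m)) \<and>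
       (\<forall>m. \<exists>R. rotation_matrix R \<and> R *v m = norm m *\<^sub>R e1) \<and>
       (\<forall>m. magnetization_solution \<theta> P (sphere_measure h) m \<longleftrightarrow>
          axial_solution \<theta> P uniform_sphere e1 (norm m))" if h: "h = 0"
  proof (intro conjI allI impI rotate)
    show "magnetization_solution \<theta> P (sphere_measure h) (R *v m)"
      if "magnetization_solution \<theta> P (sphere_measure h) m \<and> rotation_matrix R" for m R
      using that magnetization_rotate[OF rotation] by (simp add: h)
    fix m
    interpret U: annealed_model ?U P \<theta> w c by (rule model[OF spin_measure_uniform_sphere])
    obtain R where R: "rotation_matrix R" "R *v m = norm m *\<^sub>R e1" using rotate by blast
    let ?f = "(*v) R"
    have f: "orthogonal_transformation ?f" by (rule rotation[OF R(1)])
    \<comment> \<open>The converse implication is the same invariance, applied to the inverse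
      map.\<close>
    have "inv ?f (?f m) = m" using orthogonal_transformation_inj[OF f] by (rule inv_f_f)
    then have "magnetization_solution \<theta> P (sphere_measure 0) m"
      if "magnetization_solution \<theta> P (sphere_measure 0) (?f m)"
      using magnetization_rotate[OF orthogonal_transformation_inv[OF f] that] by (simp only:)
    with magnetization_rotate[OF f, of m]
    have "magnetization_solution \<theta> P (sphere_measure 0) m \<longleftrightarrow> magnetization_solution \<theta> P (sphere_measure 0) (?f m)"
      by blast
    then show "magnetization_solution \<theta> P (sphere_measure h) m \<longleftrightarrow> axial_solution \<theta> P uniform_sphere e1 (norm m)"
      unfolding U.axial_solution_iff R(2)[symmetric] U0 h .
  qed
  have c1: "\<exists>R. rotation_matrix R \<and> R *v h = norm h *\<^sub>R e1 \<and>
          (\<forall>N. finite_pressure (inner_interaction c \<theta>) w (sphere_measure (R *v h)) N =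
               finite_pressure (inner_interaction c \<theta>) w (sphere_measure h) N)"
  proof -
    obtain R where R: "rotation_matrix R" "R *v h = norm h *\<^sub>R e1" using rotate by blast
    let ?f = "(*v) R"
    have f: "orthogonal_transformation ?f" by (rule rotation[OF R(1)])
    have "finite_pressure (inner_interaction c \<theta>) w (sphere_measure (?f h)) N
        = finite_pressure (inner_interaction c \<theta>) w (sphere_measure h) N" for N
      unfolding sphere_measure_rotation[OF f, symmetric]
    proof (rule finite_pressure_isometry)
      show "annealed_model (sphere_measure h) P \<theta> w c" by (rule model[OF spin_measure_sphere_measure])
      show "annealed_model (distr (sphere_measure h) uniform_sphere ?f) P \<theta> w c"
        unfolding sphere_measure_rotation[OF f] by (rule model[OF spin_measure_sphere_measure])
      show "?f \<in> measurable (sphere_measure h) uniform_sphere"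
        unfolding measurable_cong_sets[OF sets_field_tilt refl] by (rule orthogonal_transformation_measurable_sphere[OF f])
      show "?f \<sigma> \<bullet> ?f \<tau> = \<sigma> \<bullet> \<tau>" for \<sigma> \<tau>
        using f by (simp add: orthogonal_transformation_def)
    qed (rule prob_space_uniform_sphere)
    with R show ?thesis by blast
  qed
  have c2: "{r. 0 \<le> r \<and> axial_solution \<theta> P (sphere_measure h) e1 r} \<noteq> {} \<and>
       bdd_above (pressure_functional \<theta> P (sphere_measure h) e1 `
          {r. 0 \<le> r \<and> axial_solution \<theta> P (sphere_measure h) e1 r}) \<and>
       finite_pressure (inner_interaction c \<theta>) w (sphere_measure h) \<longlonglongrightarrow>
         c * (\<integral>x. x \<partial>P) / 2 - (\<integral>x. x \<partial>P) / 2 +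
         (SUP r\<in>{r. 0 \<le> r \<and> axial_solution \<theta> P (sphere_measure h) e1 r}.
            pressure_functional \<theta> P (sphere_measure h) e1 r)" if "h \<noteq> 0 \<and> h = norm h *\<^sub>R e1"
  proof -
    from that have h: "h = norm h *\<^sub>R e1" ..
    interpret axial_model q h e1 P \<theta> c w
      by (intro axial_model.intro axial_field.intro axial_model_axioms.intro q0 dim e1_Basis h P weights EW_pos \<theta> \<theta>c)
    let ?A = "{r. 0 \<le> r \<and> axial_solution \<theta> P (sphere_measure h) e1 r}"
    let ?F = "pressure_functional \<theta> P (sphere_measure h) e1"
    obtain r where r: "r \<in> ?A" and max: "\<And>m. S.free_energy m \<le> S.free_energy (r *\<^sub>R e1)"
      and lim: "finite_pressure (inner_interaction c \<theta>) w (sphere_measure h)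
        \<longlonglongrightarrow> (c - 1) * (\<integral>x. x \<partial>P) / 2 + S.free_energy (r *\<^sub>R e1)"
      by (rule axial_pressure) blast
    have F: "?F s = S.free_energy (s *\<^sub>R e1)" for s by (rule S.pressure_functional_eq[OF norm_e1])
    \<comment> \<open>The scalar \<open>r\<close> maximises over all vectors, so the bound holds for
      every \<open>s\<close>, solution or not. As \<open>r\<close> is itself an axial solution,
      restricting the supremum to solutions does not lower it.\<close>
    have le: "?F s \<le> ?F r" for s unfolding F by (rule max)
    then have bdd: "bdd_above (?F ` ?A)" by (intro bdd_aboveI[of _ "?F r"]) auto
    have "(SUP r\<in>?A. ?F r) = ?F r"
      using r le by (intro cSup_eq_maximum) auto
    with lim have "finite_pressure (inner_interaction c \<theta>) w (sphere_measure h) \<longlonglongrightarrow>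
        c * (\<integral>x. x \<partial>P) / 2 - (\<integral>x. x \<partial>P) / 2 + (SUP r\<in>?A. ?F r)"
      by (simp add: F field_simps)
    with r bdd show ?thesis by blast
  qed
  have d1: "\<exists>C>0. distributed uniform_sphere lborel (\<lambda>\<sigma>. e1 \<bullet> \<sigma>)
       (\<lambda>t. ennreal (C * (1 - t) powr (real q / 2 - 1) * (1 + t) powr (real q / 2 - 1) * indicator {-1..1} t))"
  proof -
    obtain C where C: "0 < C" and d: "distr uniform_sphere borel (\<lambda>\<sigma>. e1 \<bullet> \<sigma>) = density lborel (\<lambda>t. ennreal (C * axis_weight q t))"
      by (rule uniform_sphere_axis_density[OF e1_Basis DIM q0])
    have "distr ?U lborel (\<lambda>\<sigma>. e1 \<bullet> \<sigma>) = distr ?U borel (\<lambda>\<sigma>. e1 \<bullet> \<sigma>)"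
      by (rule distr_cong) auto
    moreover have "(\<lambda>\<sigma>. e1 \<bullet> \<sigma>) \<in> borel_measurable ?U"
      unfolding measurable_cong_sets[OF sets_uniform_sphere refl] by (rule measurable_restrict_space1) simp
    ultimately have "distributed ?U lborel (\<lambda>\<sigma>. e1 \<bullet> \<sigma>) (\<lambda>t. ennreal (C * axis_weight q t))"
      unfolding distributed_def using d by simp
    then show ?thesis using C unfolding axis_weight_def mult.assoc[symmetric] by blast
  qed
  have d2: "distr (sphere_measure h) (restrict_space borel {-1..1}) (\<lambda>\<sigma>. e1 \<bullet> \<sigma>) =
         tilted_stretched_beta (real q / 2) (norm h) \<and>
       (\<forall>r. axial_solution \<theta> P (sphere_measure h) e1 r \<longleftrightarrow>
          magnetization_solution \<theta> P (tilted_stretched_beta (real q / 2) (norm h)) r) \<and>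
       (\<forall>V. mean_field_solution (inner_interaction c \<theta>) P (sphere_measure h) (\<lambda>\<sigma>. V (e1 \<bullet> \<sigma>)) \<longleftrightarrow>
          mean_field_solution (inner_interaction c \<theta>) P (tilted_stretched_beta (real q / 2) (norm h)) V) \<and>
       (\<exists>\<psi>. finite_pressure (inner_interaction c \<theta>) w (sphere_measure h) \<longlonglongrightarrow> \<psi> \<and>
          finite_pressure (inner_interaction c \<theta>) w
            (tilted_stretched_beta (real q / 2) (norm h)) \<longlonglongrightarrow> \<psi>)" if h: "h = norm h *\<^sub>R e1"
  proof -
    interpret axial_model q h e1 P \<theta> c w
      by (intro axial_model.intro axial_field.intro axial_model_axioms.intro q0 dim e1_Basis h P weights EW_pos \<theta> \<theta>c)
    show ?thesis
      by (intro conjI allI distr_sphere_measure_axis axial_solution_beta mean_field_solution_beta pressure_beta)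
  qed
  show ?thesis
    by (rule conjI[OF a conjI[OF impI[OF b] conjI[OF impI[OF c1] conjI[OF impI[OF c2] conjI[OF d1
          conjI[OF stretched_beta_minus[OF q0]
          conjI[OF distr_axis_uniform_sphere_eq_stretched_beta[OF e1_Basis DIM q0] impI[OF d2]]]]]]]])
qed

end
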